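(* Let $n\in\mathbb{N}$, $n\ge1$. The coupled SUSY Segal-Bargmann transforms $\mathcal{B}_1:\mathfrak{H}_1\to\mathfrak{F}_1$ and $\mathcal{B}_2:\mathfrak{H}_2\to\mathfrak{F}_2$ are unitary operators; so for all $f_1\in\mathfrak{H}_1$ and $f_2\in\mathfrak{H}_2$, $$\langle\mathcal{B}_1f_1,\mathcal{B}_1f_1\rangle_1=\langle f_1,f_1\rangle,\qquad \langle\mathcal{B}_2f_2,\mathcal{B}_2f_2\rangle_2=\langle f_2,f_2\rangle.$$
   Context: Fix an integer $n\ge 1$. Let $\mathfrak{H}_1=\mathfrak{H}_2=L^2(\mathbb{R},\mathrm{d}x)$ (complex-valued) with the usual inner product $\langle\cdot,\cdot\rangle$. Let $\mathrm{d}A$ be Lebesgue measure on $\mathbb{C}$ and let $K_\nu$ be the modified Bessel function of the second kind, $K_\nu(x)=\int_0^\infty e^{-x\cosh t}\cosh(\nu t)\,\mathrm{d}t$ for $x>0$. Define the weights $$\rho_1(z,\bar z)=\frac{2}{(2n)^{\frac{1}{2n}}\pi\,\Gamma\big(\frac{1}{2n}\big)}(z\bar z)^{n-\frac12}K_{1-\frac{1}{2n}}\Big(\frac{(z\bar z)^n}{n}\Big),\qquad \rho_2(z,\bar z)=\frac{2}{(2n)^{\frac{1}{2n}}\pi\,\Gamma\big(\frac{1}{2n}\big)}(z\bar z)^{n-\frac12}K_{\frac{1}{2n}}\Big(\frac{(z\bar z)^n}{n}\Big),$$ and the inner products $\langle f,g\rangle_j=\int_{\mathbb{C}}f(z)\overline{g(z)}\rho_j(z,\bar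 z)\,\mathrm{d}A(z)$, $j=1,2$. For $k=0,1,2,\ldots$ define $$e_{2k}(z)=\sqrt{\frac{\Gamma(\frac{1}{2n})}{(2n)^{2k}\,\Gamma(k+\frac{1}{2n})\,k!}}\;z^{2nk},\qquad e_{2k+1}(z)=\sqrt{\frac{\Gamma(\frac{1}{2n})}{(2n)^{2k+2-\frac1n}\,\Gamma(k+2-\frac{1}{2n})\,k!}}\;z^{2nk+2n-1},$$ $$\widetilde e_{2k}(z)=\sqrt{\frac{\Gamma(\frac{1}{2n})}{(2n)^{2k+1-\frac1n}\,\Gamma(k+1-\frac{1}{2n})\,k!}}\;z^{2nk+n-1},\qquad \widetilde e_{2k+1}(z)=\sqrt{\frac{\Gamma(\frac{1}{2n})}{(2n)^{2k+1}\,\Gamma(k+1+\frac{1}{2n})\,k!}}\;z^{2nk+n}.$$ The Hilbert spaces of entire functions $$\mathfrak{F}_1=\Big\{\sum_{l\ge0}c_le_l:\ \sum_l|c_l|^2<\infty\Big\},\qquad \mathfrak{F}_2=\Big\{\sum_{l\ge0}d_l\widetilde e_l:\ \sum_l|d_l|^2<\infty\Big\}$$ carry the inner products $\langle\cdot,\cdot\rangle_1$ and $\langle\cdot,\cdot\rangle_2$ respectively. The transforms are the integral operators $$\mathcal{B}_jf(z)=\int_{\mathbb{R}}A_j(z,x)f(x)\,\mathrm{d}x,\qquad A_j(z,x)=e^{-\frac{z^{2n}}{2n}}B_j(z,x)e^{-\frac{x^{2n}}{2n}},\qquad z\in\mathbb{C},\ x\in\mathbb{R},\ j=1,2,$$ where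 $$B_1(z,x)=\alpha\sum_{l=0}^\infty\frac{2^l(zx)^{2nl}}{(2n)^{2l}\Gamma(l+\frac{1}{2n})\,l!}+\beta\sum_{l=0}^\infty\frac{2^{l+\frac12}(zx)^{2nl+2n-1}}{(2n)^{2l+1}\Gamma(l+2-\frac{1}{2n})\,l!},$$ $$B_2(z,x)=\beta\sum_{l=0}^\infty\frac{2^l(zx)^{2nl+n-1}}{(2n)^{2l}\Gamma(l+1-\frac{1}{2n})\,l!}+\alpha\sum_{l=0}^\infty\frac{2^{l+\frac12}(zx)^{2nl+n}}{(2n)^{2l+1}\Gamma(l+1+\frac{1}{2n})\,l!},$$ $$\alpha=n^{\frac12-\frac{1}{4n}}\sqrt{\Gamma\big(\tfrac{1}{2n}\big)},\qquad \beta=2^{-\frac12+\frac{1}{2n}}\,n^{-\frac12+\frac{3}{4n}}\sqrt{\Gamma\big(\tfrac{1}{2n}\big)}.$$ *)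

theory Defs
  imports "HOL-Analysis.Analysis"
begin

text \<open>
  Elements of \<open>L\<^sup>2(\<real>)\<close> are represented by Borel measurable functions; equality in
  \<open>L\<^sup>2(\<real>)\<close> is equality almost everywhere. Inner products are linear in the first argument.
\<close>

definition L2R :: "(real \<Rightarrow> complex) set" where
  "L2R = {f. f \<in> borel_measurable lborel \<and> integrable lborel (\<lambda>x. (cmod (f x))\<^sup>2)}"

definition L2R_inner :: "(real \<Rightarrow> complex) \<Rightarrow> (real \<Rightarrow> complex) \<Rightarrow> complex" where
  "L2R_inner f g = (LINT x|lborel. f x * cnj (g x))"

definition weighted_inner ::
    "(complex \<Rightarrow> real) \<Rightarrow> (complex \<Rightarrow> complex) \<Rightarrow> (complex \<Rightarrow> complex) \<Rightarrow> complex" where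
  "weighted_inner \<rho> f g = (LINT z|lborel. f z * cnj (g z) * of_real (\<rho> z))"

text \<open>
  A unitary operator from \<open>L\<^sup>2(\<real>)\<close> onto a space \<open>F\<close> of functions with inner product \<open>ip\<close>:
  linear, onto, and preserving inner products. Since \<open>U\<close> acts on representatives, the second
  conjunct says that it descends to almost-everywhere classes and is injective on these.
\<close>

definition unitary_from_L2R ::
    "((real \<Rightarrow> complex) \<Rightarrow> complex \<Rightarrow> complex) \<Rightarrow> (complex \<Rightarrow> complex) set \<Rightarrow>
     ((complex \<Rightarrow> complex) \<Rightarrow> (complex \<Rightarrow> complex) \<Rightarrow> complex) \<Rightarrow> bool" where
  "unitary_from_L2R U F ip \<longleftrightarrow>
     U ` L2R = F \<and>
     (\<forall>f\<in>L2R. \<forall>g\<in>L2R. U f = U g \<longleftrightarrow> (AE x in lborel. f x = g x)) \<and>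
     (\<forall>f\<in>L2R. \<forall>g\<in>L2R. \<forall>a b. U (\<lambda>x. a * f x + b * g x) = (\<lambda>z. a * U f z + b * U g z)) \<and>
     (\<forall>f\<in>L2R. \<forall>g\<in>L2R. ip (U f) (U g) = L2R_inner f g)"

text \<open>
  For \<open>x \<le> 0\<close> the integral below diverges and the value is junk; in the weights this
  affects only the point \<open>z = 0\<close>.
\<close>

definition bessel_K :: "real \<Rightarrow> real \<Rightarrow> real" where
  "bessel_K \<nu> x = (LINT t:{0<..}|lborel. exp (- x * cosh t) * cosh (\<nu> * t))"

definition weight_const :: "nat \<Rightarrow> real" where
  "weight_const n = 2 / ((2 * real n) powr (1 / (2 * real n)) * pi * Gamma (1 / (2 * real n)))"

definition \<rho>\<^sub>1 :: "nat \<Rightarrow> complex \<Rightarrow> real" where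
  "\<rho>\<^sub>1 n z = weight_const n * ((cmod z)\<^sup>2) powr (real n - 1/2)
     * bessel_K (1 - 1 / (2 * real n)) (((cmod z)\<^sup>2) ^ n / real n)"

definition \<rho>\<^sub>2 :: "nat \<Rightarrow> complex \<Rightarrow> real" where
  "\<rho>\<^sub>2 n z = weight_const n * ((cmod z)\<^sup>2) powr (real n - 1/2)
     * bessel_K (1 / (2 * real n)) (((cmod z)\<^sup>2) ^ n / real n)"

definition e\<^sub>1 :: "nat \<Rightarrow> nat \<Rightarrow> complex \<Rightarrow> complex" where
  "e\<^sub>1 n l z = (let k = l div 2 in
     if even l
     then of_real (sqrt (Gamma (1 / (2 * real n)) /
            ((2 * real n) ^ (2 * k) * Gamma (real k + 1 / (2 * real n)) * fact k)))
          * z ^ (2 * n * k)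
     else of_real (sqrt (Gamma (1 / (2 * real n)) /
            ((2 * real n) powr (2 * real k + 2 - 1 / real n)
             * Gamma (real k + 2 - 1 / (2 * real n)) * fact k)))
          * z ^ (2 * n * k + 2 * n - 1))"

definition e\<^sub>2 :: "nat \<Rightarrow> nat \<Rightarrow> complex \<Rightarrow> complex" where
  "e\<^sub>2 n l z = (let k = l div 2 in
     if even l
     then of_real (sqrt (Gamma (1 / (2 * real n)) /
            ((2 * real n) powr (2 * real k + 1 - 1 / real n)
             * Gamma (real k + 1 - 1 / (2 * real n)) * fact k)))
          * z ^ (2 * n * k + n - 1)
     else of_real (sqrt (Gamma (1 / (2 * real n)) /
            ((2 * real n) ^ (2 * k + 1) * Gamma (real k + 1 + 1 / (2 * real n)) * fact k)))
          * z ^ (2 * n * k + n))"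

definition l2_span :: "(nat \<Rightarrow> complex \<Rightarrow> complex) \<Rightarrow> (complex \<Rightarrow> complex) set" where
  "l2_span e = {f. \<exists>c :: nat \<Rightarrow> complex. summable (\<lambda>l. (cmod (c l))\<^sup>2) \<and>
                      (\<forall>z. (\<lambda>l. c l * e l z) sums f z)}"

definition \<FF>\<^sub>1 :: "nat \<Rightarrow> (complex \<Rightarrow> complex) set" where
  "\<FF>\<^sub>1 n = l2_span (e\<^sub>1 n)"

definition \<FF>\<^sub>2 :: "nat \<Rightarrow> (complex \<Rightarrow> complex) set" where
  "\<FF>\<^sub>2 n = l2_span (e\<^sub>2 n)"

definition SB_\<alpha> :: "nat \<Rightarrow> real" where
  "SB_\<alpha> n = real n powr (1/2 - 1 / (4 * real n)) * sqrt (Gamma (1 / (2 * real n)))"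

definition SB_\<beta> :: "nat \<Rightarrow> real" where
  "SB_\<beta> n = 2 powr (- 1/2 + 1 / (2 * real n)) * real n powr (- 1/2 + 3 / (4 * real n))
     * sqrt (Gamma (1 / (2 * real n)))"

definition B\<^sub>1 :: "nat \<Rightarrow> complex \<Rightarrow> real \<Rightarrow> complex" where
  "B\<^sub>1 n z x =
     of_real (SB_\<alpha> n) * (\<Sum>l. of_real (2 ^ l) * (z * of_real x) ^ (2 * n * l)
        / of_real ((2 * real n) ^ (2 * l) * Gamma (real l + 1 / (2 * real n)) * fact l))
   + of_real (SB_\<beta> n) * (\<Sum>l. of_real (2 powr (real l + 1/2)) * (z * of_real x) ^ (2 * n * l + 2 * n - 1)
        / of_real ((2 * real n) ^ (2 * l + 1) * Gamma (real l + 2 - 1 / (2 * real n)) * fact l))"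

definition B\<^sub>2 :: "nat \<Rightarrow> complex \<Rightarrow> real \<Rightarrow> complex" where
  "B\<^sub>2 n z x =
     of_real (SB_\<beta> n) * (\<Sum>l. of_real (2 ^ l) * (z * of_real x) ^ (2 * n * l + n - 1)
        / of_real ((2 * real n) ^ (2 * l) * Gamma (real l + 1 - 1 / (2 * real n)) * fact l))
   + of_real (SB_\<alpha> n) * (\<Sum>l. of_real (2 powr (real l + 1/2)) * (z * of_real x) ^ (2 * n * l + n)
        / of_real ((2 * real n) ^ (2 * l + 1) * Gamma (real l + 1 + 1 / (2 * real n)) * fact l))"

definition SB_kernel ::
    "nat \<Rightarrow> (complex \<Rightarrow> real \<Rightarrow> complex) \<Rightarrow> complex \<Rightarrow> real \<Rightarrow> complex" where
  "SB_kernel n B z x =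
     exp (- (z ^ (2 * n)) / of_nat (2 * n)) * B z x * of_real (exp (- (x ^ (2 * n)) / real (2 * n)))"

definition SB_transform\<^sub>1 :: "nat \<Rightarrow> (real \<Rightarrow> complex) \<Rightarrow> complex \<Rightarrow> complex" where
  "SB_transform\<^sub>1 n f z = (LINT x|lborel. SB_kernel n (B\<^sub>1 n) z x * f x)"

definition SB_transform\<^sub>2 :: "nat \<Rightarrow> (real \<Rightarrow> complex) \<Rightarrow> complex \<Rightarrow> complex" where
  "SB_transform\<^sub>2 n f z = (LINT x|lborel. SB_kernel n (B\<^sub>2 n) z x * f x)"

end

theory Submission
  imports Defs
begin

text \<open>
  Each transform sends a complete orthonormal system of \<open>L\<^sup>2(\<real>)\<close> to the monomial basis of its target.
  Write \<open>u = x\<^sup>2\<^sup>n / n\<close> and \<open>w = z\<^sup>2\<^sup>n / (2n)\<close>. In the system, a function is \<open>x\<^sup>p e\<^sup>-\<^sup>u\<^sup>/\<^sup>2\<close> times a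
  Laguerre polynomial in \<open>u\<close> of parameter \<open>\<nu> = (2p + 1) / (2n) - 1\<close>, where \<open>p\<close> runs through two
  exponents of opposite parity: \<open>0, 2n - 1\<close> for the first transform and \<open>n - 1, n\<close> for the second.
  The generating function \<open>\<Sum>\<^sub>l (uw)\<^sup>l / (\<Gamma>(\<nu> + 1 + l) l!) = e\<^sup>w \<Sum>\<^sub>k L\<^sub>k(u) (-w)\<^sup>k / \<Gamma>(\<nu> + 1 + k)\<close> shows
  that the kernel pairs with the system to give the basis. The basis is orthonormal because
  distinct monomials are orthogonal for a radial weight, while the norms are Mellin transforms of
  \<open>K\<^sub>\<nu>\<close>. The system is complete because a function orthogonal to it has vanishing moments against
  the powers of \<open>u\<close>, hence of \<open>e\<^sup>-\<^sup>c\<^sup>u\<close>, so that its even and its odd part vanish.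
\<close>

section \<open>Orthonormal series in \<open>L\<^sup>2\<close>\<close>

text \<open>In either transform the two exponents p and q add up to 2n - 1, so their parameters
  \<nu> are opposite, and K, even in its index, serves both halves of the basis. The moment of the
  weight against |z|^(2(2nk + p)) is a Mellin transform of K at \<mu> = 2k + 2 + \<nu>, which yields
  \<Gamma>(k + 1 + \<nu>) k!: the factors found in the norms of the Laguerre functions. This
  agreement is why unit vectors go to unit vectors.

  The generating function enters through its coefficients: u^l paired with the k-th Laguerre
  function gives a Gamma factor, which cancels the one in the kernel, times (l choose k). What is
  left is an exponential series in w, cancelled by the factor e^(-w).

  The obstacle to completeness is that u is unbounded, so Weierstrass approximation does not apply
  to its powers. The series of exp(-\<delta> x^(2n)) is integrated term by term under a bound that
  needs \<delta> below the decay rate already present; hence the rate is raised in steps of a fixed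
  \<delta>, and the approximation takes place in v = exp(-\<delta> x^(2n)), whose values lie in
  [0, 1].\<close>

definition L2 :: "'a measure \<Rightarrow> ('a \<Rightarrow> complex) set" where
  "L2 M = {f \<in> borel_measurable M. integrable M (\<lambda>x. (cmod (f x))\<^sup>2)}"

definition ip :: "'a measure \<Rightarrow> ('a \<Rightarrow> complex) \<Rightarrow> ('a \<Rightarrow> complex) \<Rightarrow> complex" where
  "ip M f g = (LINT x|M. f x * cnj (g x))"

definition nsq :: "'a measure \<Rightarrow> ('a \<Rightarrow> complex) \<Rightarrow> real" where
  "nsq M f = (LINT x|M. (cmod (f x))\<^sup>2)"

lemma L2_measurable [measurable_dest]: "f \<in> L2 M \<Longrightarrow> f \<in> borel_measurable M"
  by (simp add: L2_def)

lemma L2_integrable: "f \<in> L2 M \<Longrightarrow> integrable M (\<lambda>x. (cmod (f x))\<^sup>2)"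
  by (simp add: L2_def)

lemma L2_mult_integrable:
  assumes "f \<in> L2 M" "g \<in> L2 M"
  shows "integrable M (\<lambda>x. f x * g x)"
proof (rule Bochner_Integration.integrable_bound)
  show "integrable M (\<lambda>x. (cmod (f x))\<^sup>2 + (cmod (g x))\<^sup>2)"
    using assms by (auto simp: L2_def)
  show "(\<lambda>x. f x * g x) \<in> borel_measurable M" using assms by measurable
  have "a * b \<le> a\<^sup>2 + b\<^sup>2" if "a \<ge> 0" "b \<ge> 0" for a b :: real
    using mult_nonneg_nonneg[OF that] sum_squares_bound[of a b] by simp
  then show "AE x in M. norm (f x * g x) \<le> norm ((cmod (f x))\<^sup>2 + (cmod (g x))\<^sup>2)"
    by (simp add: norm_mult)
qed

lemma borel_measurable_cnj [measurable (raw)]: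
  "f \<in> borel_measurable M \<Longrightarrow> (\<lambda>x. cnj (f x)) \<in> borel_measurable M"
  by (rule measurable_compose[of f M borel cnj borel])
     (auto intro!: borel_measurable_continuous_onI continuous_intros)

lemma L2_cnj [simp]: "(\<lambda>x. cnj (f x)) \<in> L2 M \<longleftrightarrow> f \<in> L2 M"
proof -
  have "(\<lambda>x. cnj (f x)) \<in> L2 M" if "f \<in> L2 M" for f :: "'a \<Rightarrow> complex"
    using that borel_measurable_cnj[of f M] by (simp add: L2_def)
  from this[of f] this[of "\<lambda>x. cnj (f x)"] show ?thesis
    unfolding complex_cnj_cnj by blast
qed

lemma L2_scale: "f \<in> L2 M \<Longrightarrow> (\<lambda>x. c * f x) \<in> L2 M"
  by (auto simp: L2_def norm_mult power_mult_distrib)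

lemma L2_add:
  assumes "f \<in> L2 M" "g \<in> L2 M"
  shows "(\<lambda>x. f x + g x) \<in> L2 M"
proof -
  have "integrable M (\<lambda>x. (cmod (f x + g x))\<^sup>2)"
  proof (rule Bochner_Integration.integrable_bound)
    show "integrable M (\<lambda>x. 2 * (cmod (f x))\<^sup>2 + 2 * (cmod (g x))\<^sup>2)"
      using assms by (auto simp: L2_def)
    show "(\<lambda>x. (cmod (f x + g x))\<^sup>2) \<in> borel_measurable M" using assms by measurable
    have "(cmod (a + b))\<^sup>2 \<le> 2 * (cmod a)\<^sup>2 + 2 * (cmod b)\<^sup>2" for a b
    proof -
      have "(cmod (a + b))\<^sup>2 \<le> (cmod a + cmod b)\<^sup>2" by (simp add: norm_triangle_ineq)
      also have "\<dots> \<le> 2 * (cmod a)\<^sup>2 + 2 * (cmod b)\<^sup>2"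
        using zero_le_power2[of "cmod a - cmod b"] by (simp add: power2_eq_square algebra_simps)
      finally show ?thesis .
    qed
    then show "AE x in M. norm ((cmod (f x + g x))\<^sup>2) \<le> norm (2 * (cmod (f x))\<^sup>2 + 2 * (cmod (g x))\<^sup>2)"
      by simp
  qed
  moreover have "(\<lambda>x. f x + g x) \<in> borel_measurable M" using assms by measurable
  ultimately show ?thesis by (simp add: L2_def)
qed

lemma L2_diff: "f \<in> L2 M \<Longrightarrow> g \<in> L2 M \<Longrightarrow> (\<lambda>x. f x - g x) \<in> L2 M"
  using L2_add[of f M "\<lambda>x. -1 * g x"] L2_scale[of g M "-1"] by simp

lemma L2_zero [simp]: "(\<lambda>x. 0) \<in> L2 M"
  by (simp add: L2_def)

lemma L2_sum: "(\<And>i. i \<in> A \<Longrightarrow> f i \<in> L2 M) \<Longrightarrow> (\<lambda>x. \<Sum>i\<in>A. f i x) \<in> L2 M"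
  by (induction A rule: infinite_finite_induct) (auto intro: L2_add)

lemma ip_integrable: "f \<in> L2 M \<Longrightarrow> g \<in> L2 M \<Longrightarrow> integrable M (\<lambda>x. f x * cnj (g x))"
  using L2_mult_integrable[of f M "\<lambda>x. cnj (g x)"] by simp

lemma ip_cnj: "ip M g f = cnj (ip M f g)"
proof -
  have "cnj (ip M f g) = (LINT x|M. cnj (f x * cnj (g x)))"
    unfolding ip_def by (rule Bochner_Integration.integral_cnj[symmetric])
  then show ?thesis by (simp add: ip_def mult.commute)
qed

lemma ip_self: "ip M f f = of_real (nsq M f)"
  unfolding ip_def nsq_def complex_norm_square[symmetric] by (rule integral_complex_of_real)

lemma ip_scale_left: "ip M (\<lambda>x. c * f x) g = c * ip M f g"
  by (simp add: ip_def mult.assoc)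

lemma ip_diff_left:
  "f \<in> L2 M \<Longrightarrow> f' \<in> L2 M \<Longrightarrow> g \<in> L2 M \<Longrightarrow> ip M (\<lambda>x. f x - f' x) g = ip M f g - ip M f' g"
  by (simp add: ip_def left_diff_distrib ip_integrable)

lemma ip_diff_right:
  "f \<in> L2 M \<Longrightarrow> g \<in> L2 M \<Longrightarrow> g' \<in> L2 M \<Longrightarrow> ip M f (\<lambda>x. g x - g' x) = ip M f g - ip M f g'"
  by (simp add: ip_def right_diff_distrib ip_integrable)

lemma ip_sum_left:
  assumes "\<And>i. i \<in> A \<Longrightarrow> f i \<in> L2 M" "g \<in> L2 M"
  shows "ip M (\<lambda>x. \<Sum>i\<in>A. f i x) g = (\<Sum>i\<in>A. ip M (f i) g)"
  using assms by (simp add: ip_def sum_distrib_right ip_integrable)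

lemma ip_cong_AE:
  assumes "AE x in M. f x = f' x" "AE x in M. g x = g' x"
    and [measurable]: "f \<in> borel_measurable M" "f' \<in> borel_measurable M" "g \<in> borel_measurable M" "g' \<in> borel_measurable M"
  shows "ip M f g = ip M f' g'"
  unfolding ip_def by (rule integral_cong_AE) (use assms(1,2) in auto)

lemma nsq_nonneg [simp]: "nsq M f \<ge> 0"
  by (simp add: nsq_def)

lemma nsq_eq_0_iff: "f \<in> L2 M \<Longrightarrow> nsq M f = 0 \<longleftrightarrow> (AE x in M. f x = 0)"
  unfolding nsq_def by (subst integral_nonneg_eq_0_iff_AE) (auto simp: L2_def)

lemma nsq_nn_integral: "f \<in> L2 M \<Longrightarrow> (\<integral>\<^sup>+x. ennreal ((cmod (f x))\<^sup>2) \<partial>M) = ennreal (nsq M f)"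
  unfolding nsq_def by (rule nn_integral_eq_integral) (auto simp: L2_def)

lemma L2_I_nn:
  assumes "f \<in> borel_measurable M" "(\<integral>\<^sup>+x. ennreal ((cmod (f x))\<^sup>2) \<partial>M) < \<infinity>"
  shows "f \<in> L2 M"
  unfolding L2_def using assms by (auto intro!: integrableI_nonneg)

text \<open>A weak form of the Cauchy--Schwarz inequality, sufficient to pass to limits.\<close>
lemma ip_bound:
  assumes f: "f \<in> L2 M" and g: "g \<in> L2 M"
  shows "cmod (ip M f g) \<le> sqrt (nsq M f) * (1 + nsq M g)"
proof (cases "nsq M f = 0")
  case True
  then have "AE x in M. f x = 0" using f by (simp add: nsq_eq_0_iff)
  then have "ip M f g = ip M (\<lambda>x. 0) g" using f g by (intro ip_cong_AE) auto
  then show ?thesis by (simp add: ip_def True)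
next
  case False
  \<comment> \<open>Weighting the inequality a b \<le> a^2 / s + s b^2 by the norm s of f makes both
    terms of the integrated bound multiples of s.\<close>
  define s where "s = sqrt (nsq M f)"
  have s: "s > 0" "s * s = nsq M f" using False nsq_nonneg[of M f] by (auto simp: s_def order.not_eq_order_implies_strict)
  have "cmod (ip M f g) \<le> (LINT x|M. cmod (f x * cnj (g x)))"
    unfolding ip_def by (rule integral_norm_bound)
  also have "\<dots> \<le> (LINT x|M. (cmod (f x))\<^sup>2 / s + s * (cmod (g x))\<^sup>2)"
  proof (rule integral_mono)
    show "integrable M (\<lambda>x. cmod (f x * cnj (g x)))" using ip_integrable[OF f g] by (rule integrable_norm)
    show "integrable M (\<lambda>x. (cmod (f x))\<^sup>2 / s + s * (cmod (g x))\<^sup>2)"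
      using f g by (auto simp: L2_def)
    fix x
    have "0 \<le> (cmod (f x) - s * cmod (g x))\<^sup>2" by simp
    then have "2 * s * (cmod (f x) * cmod (g x)) \<le> (cmod (f x))\<^sup>2 + s\<^sup>2 * (cmod (g x))\<^sup>2"
      by (simp add: power2_eq_square algebra_simps)
    moreover have "s * (cmod (f x) * cmod (g x)) \<ge> 0" using s by auto
    ultimately have "s * (cmod (f x) * cmod (g x)) \<le> (cmod (f x))\<^sup>2 + s\<^sup>2 * (cmod (g x))\<^sup>2"
      by linarith
    then show "cmod (f x * cnj (g x)) \<le> (cmod (f x))\<^sup>2 / s + s * (cmod (g x))\<^sup>2"
      using s(1) by (simp add: norm_mult field_simps power2_eq_square)
  qed
  also have "\<dots> = nsq M f / s + s * nsq M g"
    using f g by (simp add: nsq_def L2_def)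
  also have "\<dots> = s * (1 + nsq M g)" using s by (simp add: field_simps flip: s(2))
  finally show ?thesis by (simp add: s_def)
qed

text \<open>Convergence in mean is expressed by the norm of the remainder, so that representatives
  can be used throughout; \<open>F\<close> is determined by \<open>c\<close> only almost everywhere.
  The measure is a parameter because the same theory serves the line and the weighted plane.\<close>

definition L2_series :: "'a measure \<Rightarrow> (nat \<Rightarrow> 'a \<Rightarrow> complex) \<Rightarrow> ('a \<Rightarrow> complex) \<Rightarrow> (nat \<Rightarrow> complex) \<Rightarrow> bool" where
  "L2_series M h F c \<longleftrightarrow> F \<in> L2 M \<and> (\<lambda>N. nsq M (\<lambda>x. F x - (\<Sum>l<N. c l * h l x))) \<longlonglongrightarrow> 0"

definition orthonormal_seq :: "'a measure \<Rightarrow> (nat \<Rightarrow> 'a \<Rightarrow> complex) \<Rightarrow> bool" where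
  "orthonormal_seq M h \<longleftrightarrow>
     (\<forall>l. h l \<in> L2 M) \<and> (\<forall>i j. ip M (h i) (h j) = (if i = j then 1 else 0))"

section \<open>Parseval, Riesz-Fischer and completeness for a fixed orthonormal system\<close>

context
  fixes M :: "'a measure" and h :: "nat \<Rightarrow> 'a \<Rightarrow> complex"
  assumes os: "orthonormal_seq M h"
begin

lemma orthonormal_seq_L2: "h l \<in> L2 M"
  and orthonormal_seq_ip: "ip M (h i) (h j) = (if i = j then 1 else 0)"
  using os by (simp_all add: orthonormal_seq_def)

lemma lincomb_L2: "(\<lambda>x. \<Sum>l\<in>A. c l * h l x) \<in> L2 M"
  by (intro L2_sum L2_scale orthonormal_seq_L2)

lemma ip_lincomb: 
  assumes "finite A"
  shows "ip M (\<lambda>x. \<Sum>l\<in>A. c l * h l x) (h j) = (if j \<in> A then c j else 0)"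
proof -
  have "ip M (\<lambda>x. \<Sum>l\<in>A. c l * h l x) (h j) = (\<Sum>l\<in>A. c l * (if l = j then 1 else 0))"
    by (subst ip_sum_left) (auto simp: L2_scale orthonormal_seq_L2 ip_scale_left orthonormal_seq_ip)
  also have "\<dots> = (if j \<in> A then c j else 0)" using assms by (simp add: if_distrib sum.delta cong: if_cong)
  finally show ?thesis .
qed

lemma ip_lincomb_right: 
  assumes "g \<in> L2 M"
  shows "ip M g (\<lambda>x. \<Sum>l\<in>A. c l * h l x) = (\<Sum>l\<in>A. cnj (c l) * ip M g (h l))"
proof -
  have "ip M (\<lambda>x. \<Sum>l\<in>A. c l * h l x) g = (\<Sum>l\<in>A. c l * ip M (h l) g)"
    using assms by (subst ip_sum_left) (auto simp: L2_scale orthonormal_seq_L2 ip_scale_left)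
  then show ?thesis by (subst ip_cnj) (simp add: ip_cnj[of M g])
qed

lemma nsq_lincomb: 
  assumes "finite A"
  shows "nsq M (\<lambda>x. \<Sum>l\<in>A. c l * h l x) = (\<Sum>l\<in>A. (cmod (c l))\<^sup>2)"
proof -
  have "complex_of_real (nsq M (\<lambda>x. \<Sum>l\<in>A. c l * h l x)) = (\<Sum>l\<in>A. cnj (c l) * c l)"
    unfolding ip_self[symmetric] using assms
    by (subst ip_lincomb_right) (auto simp: lincomb_L2 ip_lincomb)
  also have "\<dots> = of_real (\<Sum>l\<in>A. (cmod (c l))\<^sup>2)"
    unfolding of_real_sum complex_norm_square by (simp add: mult.commute)
  finally show ?thesis by (simp only: of_real_eq_iff)
qed

text \<open>Pairing with a fixed \<open>g\<close> is continuous in mean: \<open>ip_bound\<close>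
  estimates the difference to the N-th partial sum by the norm of the remainder times a
  constant.\<close>

lemma L2_series_ip:
  assumes F: "L2_series M h F c" and g: "g \<in> L2 M"
  shows "(\<lambda>l. c l * ip M (h l) g) sums ip M F g"
proof -
  let ?S = "\<lambda>N x. \<Sum>l<N. c l * h l x"
  have FL: "F \<in> L2 M" using F by (simp add: L2_series_def)
  have "(\<lambda>N. ip M F g - ip M (?S N) g) \<longlonglongrightarrow> 0"
  proof (rule Lim_null_comparison)
    show "\<forall>\<^sub>F N in sequentially. norm (ip M F g - ip M (?S N) g) \<le> 
            sqrt (nsq M (\<lambda>x. F x - ?S N x)) * (1 + nsq M g)"
      by (subst ip_diff_left[symmetric]) (auto simp: FL g lincomb_L2 intro!: always_eventually ip_bound L2_diff)
    have "(\<lambda>N. sqrt (nsq M (\<lambda>x. F x - ?S N x)) * (1 + nsq M g)) \<longlonglongrightarrow> sqrt 0 * (1 + nsq M g)"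
      using F unfolding L2_series_def by (intro tendsto_intros) auto
    then show "(\<lambda>N. sqrt (nsq M (\<lambda>x. F x - ?S N x)) * (1 + nsq M g)) \<longlonglongrightarrow> 0" by simp
  qed
  then have "(\<lambda>N. ip M F g - (ip M F g - ip M (?S N) g)) \<longlonglongrightarrow> ip M F g - 0"
    by (intro tendsto_intros)
  moreover have "ip M (?S N) g = (\<Sum>l<N. c l * ip M (h l) g)" for N
    using g by (subst ip_sum_left) (auto simp: L2_scale orthonormal_seq_L2 ip_scale_left)
  ultimately show ?thesis by (simp add: sums_def)
qed

lemma L2_series_coeff:
  assumes "L2_series M h F c"
  shows "ip M F (h j) = c j"
proof -
  have "(\<lambda>l. c l * ip M (h l) (h j)) sums ip M F (h j)"
    by (rule L2_series_ip[OF assms orthonormal_seq_L2])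
  also have "(\<lambda>l. c l * ip M (h l) (h j)) = (\<lambda>l. if l = j then c j else 0)"
    by (auto simp: orthonormal_seq_ip)
  finally show ?thesis using sums_single[of j "\<lambda>_. c j"] sums_unique2 by blast
qed

lemma parseval:
  assumes F: "L2_series M h F c" and G: "L2_series M h G d"
  shows "(\<lambda>l. c l * cnj (d l)) sums ip M F G"
  using L2_series_ip[OF F, of G] G by (simp add: L2_series_def ip_cnj[of M _ G] L2_series_coeff[OF G])

text \<open>Fatou's lemma along \<open>r\<close> bounds the squared norm of the remainder after N
  terms by the tail of the coefficient series. The bound holds for every N although pointwise
  convergence is known only along a subsequence, which is the situation in
  \<open>riesz_fischer\<close>.\<close>

lemma L2_seriesI:
  assumes c: "summable (\<lambda>l. (cmod (c l))\<^sup>2)" and r: "strict_mono r" and [measurable]: "F \<in> borel_measurable M"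
    and lim: "AE x in M. (\<lambda>k. \<Sum>l<r k. c l * h l x) \<longlonglongrightarrow> F x"
  shows "L2_series M h F c"
proof -
  let ?S = "\<lambda>N x. \<Sum>l<N. c l * h l x"
  define T where "T N = (\<Sum>l. (cmod (c (l + N)))\<^sup>2)" for N
  have [measurable]: "?S N \<in> borel_measurable M" for N by (rule L2_measurable[OF lincomb_L2])
  have rk: "k \<le> r k" for k using r by (rule seq_suble)
  have *: "(\<integral>\<^sup>+x. ennreal ((cmod (F x - ?S N x))\<^sup>2) \<partial>M) \<le> ennreal (T N)" for N
  proof -
    have "(\<integral>\<^sup>+x. ennreal ((cmod (F x - ?S N x))\<^sup>2) \<partial>M) = 
          (\<integral>\<^sup>+x. liminf (\<lambda>k. ennreal ((cmod (?S (r k) x - ?S N x))\<^sup>2)) \<partial>M)"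
    proof (rule nn_integral_cong_AE)
      show "AE x in M. ennreal ((cmod (F x - ?S N x))\<^sup>2) = liminf (\<lambda>k. ennreal ((cmod (?S (r k) x - ?S N x))\<^sup>2))"
        using lim
      proof eventually_elim
        case (elim x)
        have "(\<lambda>k. ennreal ((cmod (?S (r k) x - ?S N x))\<^sup>2)) \<longlonglongrightarrow> ennreal ((cmod (F x - ?S N x))\<^sup>2)"
          using elim by (intro tendsto_intros)
        then show ?case by (rule lim_imp_Liminf[OF sequentially_bot, symmetric])
      qed
    qed
    also have "\<dots> \<le> liminf (\<lambda>k. \<integral>\<^sup>+x. ennreal ((cmod (?S (r k) x - ?S N x))\<^sup>2) \<partial>M)"
      by (rule nn_integral_liminf) measurable
    also have "\<dots> \<le> liminf (\<lambda>k. ennreal (T N))"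
    proof (rule Liminf_mono, rule eventually_sequentiallyI)
      fix k assume "N \<le> k"
      then have k: "N \<le> r k" using rk[of k] by simp
      then have eq: "{..<r k} = {..<N} \<union> {N..<r k}" "{..<N} \<inter> {N..<r k} = {}" by auto
      have "?S (r k) x - ?S N x = (\<Sum>l\<in>{N..<r k}. c l * h l x)" for x
        unfolding eq(1) by (subst sum.union_disjoint) auto
      then have "(\<integral>\<^sup>+x. ennreal ((cmod (?S (r k) x - ?S N x))\<^sup>2) \<partial>M) = 
                 ennreal (\<Sum>l\<in>{N..<r k}. (cmod (c l))\<^sup>2)"
        by (simp add: nsq_nn_integral lincomb_L2 nsq_lincomb)
      also have "(\<Sum>l\<in>{N..<r k}. (cmod (c l))\<^sup>2) = (\<Sum>l<r k - N. (cmod (c (l + N)))\<^sup>2)"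
        using k by (intro sum.reindex_bij_witness[of _ "\<lambda>i. i + N" "\<lambda>i. i - N"]) auto
      also have "\<dots> \<le> T N" unfolding T_def
        by (rule sum_le_suminf) (use c in \<open>auto simp: summable_iff_shift[of "\<lambda>l. (cmod (c l))\<^sup>2"]\<close>)
      finally show "(\<integral>\<^sup>+x. ennreal ((cmod (?S (r k) x - ?S N x))\<^sup>2) \<partial>M) \<le> ennreal (T N)"
        by (simp add: ennreal_leI)
    qed
    also have "\<dots> = ennreal (T N)" by (rule Liminf_const) simp
    finally show ?thesis .
  qed
  have D: "(\<lambda>x. F x - ?S N x) \<in> L2 M" for N
    by (rule L2_I_nn) (use *[of N] in \<open>auto simp: less_top[symmetric] top_unique\<close>)
  \<comment> \<open>For N = 0 the partial sum is empty, so the remainder is \<open>F\<close>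
    itself.\<close>
  have "F \<in> L2 M" using D[of 0] by simp
  moreover have "(\<lambda>N. nsq M (\<lambda>x. F x - ?S N x)) \<longlonglongrightarrow> 0"
  proof (rule Lim_null_comparison)
    have T0: "T N \<ge> 0" for N unfolding T_def
      by (intro suminf_nonneg) (use c in \<open>auto simp: summable_iff_shift[of "\<lambda>l. (cmod (c l))\<^sup>2"]\<close>)
    have "nsq M (\<lambda>x. F x - ?S N x) \<le> T N" for N
      using *[of N] T0[of N] by (simp add: nsq_nn_integral[OF D])
    then show "\<forall>\<^sub>F N in sequentially. norm (nsq M (\<lambda>x. F x - ?S N x)) \<le> T N" by simp
    show "T \<longlonglongrightarrow> 0" using suminf_exist_split2[OF c] by (simp add: T_def[abs_def])
  qed
  ultimately show ?thesis by (simp add: L2_series_def)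
qed

text \<open>The sum is built pointwise. The indices \<open>r\<close> are so sparse that the blocks
  \<open>D k\<close> between them have squared norm at most 4^(-k); hence the sum of 2^k |D k|^2 is
  integrable and almost everywhere finite, and |D k| \<le> 2^(-k) + 2^k |D k|^2 makes the blocks
  summable there.\<close>

lemma riesz_fischer:
  assumes c: "summable (\<lambda>l. (cmod (c l))\<^sup>2)"
  shows "\<exists>F. L2_series M h F c"
proof -
  let ?S = "\<lambda>N x. \<Sum>l<N. c l * h l x"
  have [measurable]: "?S N \<in> borel_measurable M" for N by (rule L2_measurable[OF lincomb_L2])
  have "\<exists>N. \<forall>m\<ge>N. \<forall>n. (\<Sum>l\<in>{m..<n}. (cmod (c l))\<^sup>2) < (1/4)^k" for k
    using summable_Cauchy[THEN iffD1, OF c, rule_format, of "(1/4)^k"] by (auto simp: sum_nonneg)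
  then obtain N where N: "\<And>k m n. m \<ge> N k \<Longrightarrow> (\<Sum>l\<in>{m..<n}. (cmod (c l))\<^sup>2) < (1/4)^k"
    by metis
  \<comment> \<open>The summand \<open>k\<close> makes \<open>r\<close> strictly increasing, the sum
    of the \<open>N i\<close> keeps \<open>r k\<close> at least \<open>N k\<close>.\<close>
  define r where "r k = k + (\<Sum>i\<le>k. N i)" for k
  have r: "strict_mono r" by (rule strict_monoI_Suc) (simp add: r_def)
  have rN: "N k \<le> r k" for k
    using member_le_sum[of k "{..k}" N] by (simp add: r_def)
  define D where "D k x = ?S (r (Suc k)) x - ?S (r k) x" for k x
  have D: "D k = (\<lambda>x. \<Sum>l\<in>{r k..<r (Suc k)}. c l * h l x)" for k
  proof
    fix x
    have le: "r k \<le> r (Suc k)" using r by (simp add: strict_mono_less_eq)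
    then have eq: "{..<r (Suc k)} = {..<r k} \<union> {r k..<r (Suc k)}" "{..<r k} \<inter> {r k..<r (Suc k)} = {}" by auto
    show "D k x = (\<Sum>l\<in>{r k..<r (Suc k)}. c l * h l x)"
      unfolding D_def eq(1) by (subst sum.union_disjoint) auto
  qed
  have DL2: "D k \<in> L2 M" for k unfolding D by (rule lincomb_L2)
  note [measurable] = L2_measurable[OF DL2]
  have "(\<integral>\<^sup>+x. (\<Sum>k. ennreal (2 ^ k * (cmod (D k x))\<^sup>2)) \<partial>M) = (\<Sum>k. \<integral>\<^sup>+x. ennreal (2 ^ k * (cmod (D k x))\<^sup>2) \<partial>M)"
    by (rule nn_integral_suminf) measurable
  also have "\<dots> \<le> (\<Sum>k. ennreal ((1/2)^k))"
  proof (intro suminf_le)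
    fix k
    have "(\<integral>\<^sup>+x. ennreal (2 ^ k * (cmod (D k x))\<^sup>2) \<partial>M) = ennreal (2^k) * (\<integral>\<^sup>+x. ennreal ((cmod (D k x))\<^sup>2) \<partial>M)"
      by (simp add: ennreal_mult nn_integral_cmult)
    also have "\<dots> = ennreal (2^k * (\<Sum>l\<in>{r k..<r (Suc k)}. (cmod (c l))\<^sup>2))"
      by (simp add: nsq_nn_integral[OF DL2] ennreal_mult sum_nonneg) (simp add: D nsq_lincomb)
    also have "\<dots> \<le> ennreal (2^k * (1/4)^k)"
      using less_imp_le[OF N[OF rN[of k], of "r (Suc k)"]] by (intro ennreal_leI mult_left_mono) auto
    also have "(2::real)^k * (1/4)^k = (1/2)^k" by (simp add: power_mult_distrib[symmetric])
    finally show "(\<integral>\<^sup>+x. ennreal (2 ^ k * (cmod (D k x))\<^sup>2) \<partial>M) \<le> ennreal ((1/2)^k)" .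
  qed auto
  also have "\<dots> = ennreal (\<Sum>k. (1/2)^k)" by (rule suminf_ennreal2) (auto simp: summable_geometric)
  also have "\<dots> < \<infinity>" by simp
  finally have fin: "(\<integral>\<^sup>+x. (\<Sum>k. ennreal (2 ^ k * (cmod (D k x))\<^sup>2)) \<partial>M) \<noteq> \<infinity>" by simp
  have conv: "AE x in M. convergent (\<lambda>k. ?S (r k) x)"
    using nn_integral_PInf_AE[OF _ fin]
  proof (rule AE_mp)
    show "(\<lambda>x. \<Sum>k. ennreal (2 ^ k * (cmod (D k x))\<^sup>2)) \<in> borel_measurable M" by measurable
    show "AE x in M. (\<Sum>k. ennreal (2 ^ k * (cmod (D k x))\<^sup>2)) \<noteq> \<infinity> \<longrightarrow> convergent (\<lambda>k. ?S (r k) x)"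
    proof (rule AE_I2, rule impI)
      fix x assume "(\<Sum>k. ennreal (2 ^ k * (cmod (D k x))\<^sup>2)) \<noteq> \<infinity>"
      then have s: "summable (\<lambda>k. 2 ^ k * (cmod (D k x))\<^sup>2)"
        by (intro summable_suminf_not_top) auto
      have "summable (\<lambda>k. (1/2)^k + 2 ^ k * (cmod (D k x))\<^sup>2)"
        by (intro summable_add s) (simp add: summable_geometric)
      then have "summable (\<lambda>k. D k x)"
      proof (rule summable_comparison_test'[where N = 0])
        fix k :: nat
        have "2 * (2^k * cmod (D k x)) \<le> 1 + (2^k * cmod (D k x))\<^sup>2"
          using sum_squares_bound[of 1 "2^k * cmod (D k x)"] by simp
        moreover have "0 \<le> 2^k * cmod (D k x)" by simp
        ultimately have "2^k * cmod (D k x) \<le> 1 + (2^k * cmod (D k x))\<^sup>2" by linarith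
        then show "norm (D k x) \<le> (1/2)^k + 2 ^ k * (cmod (D k x))\<^sup>2"
          by (simp add: field_simps power2_eq_square)
      qed
      then have "convergent (\<lambda>n. \<Sum>k<n. ?S (r (Suc k)) x - ?S (r k) x)"
        unfolding D_def by (simp add: summable_iff_convergent)
      then have "convergent (\<lambda>n. (?S (r n) x - ?S (r 0) x) + ?S (r 0) x)"
        unfolding sum_lessThan_telescope[of "\<lambda>k. ?S (r k) x"] by (intro convergent_add convergent_const)
      then show "convergent (\<lambda>k. ?S (r k) x)" by simp
    qed
  qed
  have "L2_series M h (\<lambda>x. lim (\<lambda>k. ?S (r k) x)) c"
  proof (rule L2_seriesI[OF c r])
    show "(\<lambda>x. lim (\<lambda>k. ?S (r k) x)) \<in> borel_measurable M"
      by (rule borel_measurable_lim_metric) measurable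
    show "AE x in M. (\<lambda>k. ?S (r k) x) \<longlonglongrightarrow> lim (\<lambda>k. ?S (r k) x)"
      using conv by eventually_elim (simp add: convergent_LIMSEQ_iff)
  qed
  then show ?thesis by blast
qed

lemma bessel:
  assumes f: "f \<in> L2 M"
  shows "summable (\<lambda>l. (cmod (ip M f (h l)))\<^sup>2)"
proof (rule summableI_nonneg_bounded)
  fix N
  let ?S = "\<lambda>x. \<Sum>l<N. ip M f (h l) * h l x"
  have "complex_of_real (nsq M (\<lambda>x. f x - ?S x)) = ip M (\<lambda>x. f x - ?S x) f - ip M (\<lambda>x. f x - ?S x) ?S"
    unfolding ip_self[symmetric]
    by (rule ip_diff_right) (use f in \<open>auto simp: lincomb_L2 L2_diff\<close>)
  also have "ip M (\<lambda>x. f x - ?S x) ?S = 0"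
    by (subst ip_lincomb_right) (use f in \<open>auto simp: lincomb_L2 L2_diff ip_diff_left orthonormal_seq_L2 ip_lincomb\<close>)
  also have "ip M (\<lambda>x. f x - ?S x) f = of_real (nsq M f) - (\<Sum>l<N. ip M f (h l) * ip M (h l) f)"
    by (subst ip_diff_left) (use f in \<open>auto simp: lincomb_L2 orthonormal_seq_L2 ip_self L2_scale ip_sum_left ip_scale_left\<close>)
  also have "(\<Sum>l<N. ip M f (h l) * ip M (h l) f) = of_real (\<Sum>l<N. (cmod (ip M f (h l)))\<^sup>2)"
    unfolding of_real_sum complex_norm_square by (simp add: ip_cnj[of M _ f])
  finally have "nsq M (\<lambda>x. f x - ?S x) = nsq M f - (\<Sum>l<N. (cmod (ip M f (h l)))\<^sup>2)"
    by (simp only: diff_zero of_real_diff[symmetric] of_real_eq_iff)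
  then show "(\<Sum>l<N. (cmod (ip M f (h l)))\<^sup>2) \<le> nsq M f"
    using nsq_nonneg[of M "\<lambda>x. f x - ?S x"] by linarith
qed auto

text \<open>The Riesz-Fischer sum of the coefficients of \<open>f\<close> differs from
  \<open>f\<close> by a function whose coefficients all vanish, so completeness identifies the two
  almost everywhere.\<close>

lemma L2_series_complete:
  assumes complete: "\<And>f. f \<in> L2 M \<Longrightarrow> (\<And>l. ip M f (h l) = 0) \<Longrightarrow> AE x in M. f x = 0"
    and f: "f \<in> L2 M"
  shows "L2_series M h f (\<lambda>l. ip M f (h l))"
proof -
  obtain F where F: "L2_series M h F (\<lambda>l. ip M f (h l))"
    using riesz_fischer[OF bessel[OF f]] by blast
  then have FL: "F \<in> L2 M" by (simp add: L2_series_def)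
  have "AE x in M. f x - F x = 0"
    by (rule complete) (use f FL in \<open>auto simp: L2_diff ip_diff_left orthonormal_seq_L2 L2_series_coeff[OF F]\<close>)
  then have eq: "AE x in M. f x = F x" by eventually_elim simp
  have "nsq M (\<lambda>x. f x - (\<Sum>l<N. c l * h l x)) = nsq M (\<lambda>x. F x - (\<Sum>l<N. c l * h l x))" for N c
    unfolding nsq_def
  proof (rule integral_cong_AE)
    have [measurable]: "(\<lambda>x. \<Sum>l<N. c l * h l x) \<in> borel_measurable M" by (rule L2_measurable[OF lincomb_L2])
    show "(\<lambda>x. (cmod (f x - (\<Sum>l<N. c l * h l x)))\<^sup>2) \<in> borel_measurable M"
         "(\<lambda>x. (cmod (F x - (\<Sum>l<N. c l * h l x)))\<^sup>2) \<in> borel_measurable M" using f FL by measurable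
  qed (use eq in auto)
  with F f show ?thesis by (simp add: L2_series_def)
qed

end

text \<open>Parseval applied to \<open>f\<close> and the conjugate of \<open>K z\<close> expands
  \<open>U f z\<close>, at every point \<open>z\<close>, as the series of the coefficients of
  \<open>f\<close> against \<open>e l z\<close>. In the weighted space this is an orthonormal series
  with the same coefficients, so a second use of Parseval gives the isometry; Riesz-Fischer on the
  line makes \<open>U\<close> onto.\<close>

lemma unitary_from_L2R_I:
  assumes h: "orthonormal_seq lborel h"
    and complete: "\<And>f. f \<in> L2 lborel \<Longrightarrow> (\<And>l. ip lborel f (h l) = 0) \<Longrightarrow> AE x in lborel. f x = 0"
    and h_real: "\<And>l x. cnj (h l x) = h l x"
    and e: "orthonormal_seq (density lborel (\<lambda>z. ennreal (\<rho> z))) e"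
    and \<rho> [measurable]: "\<rho> \<in> borel_measurable borel" and \<rho>_nonneg: "\<And>z. \<rho> z \<ge> 0"
    and e_meas [measurable]: "\<And>l. e l \<in> borel_measurable borel"
    and K: "\<And>z. K z \<in> L2 lborel"
    and Kh: "\<And>z l. (LINT x|lborel. K z x * h l x) = e l z"
  shows "unitary_from_L2R (\<lambda>f z. LINT x|lborel. K z x * f x) (l2_span e) (weighted_inner \<rho>)"
proof -
  define U where "U f z = (LINT x|lborel. K z x * f x)" for f z
  define D where "D = density lborel (\<lambda>z. ennreal (\<rho> z))"
  have L2R: "L2R = L2 lborel" by (auto simp: L2R_def L2_def)
  have inner: "L2R_inner f g = ip lborel f g" for f g by (simp add: L2R_inner_def ip_def)
  have U_sums: "(\<lambda>l. ip lborel f (h l) * e l z) sums U f z" if f: "f \<in> L2 lborel" for f z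
  proof -
    \<comment> \<open>\<open>ip\<close> conjugates its second argument, hence the conjugate of
      \<open>K z\<close>; as the \<open>h l\<close> are real, its coefficients are the conjugates of
      \<open>e l z\<close>.\<close>
    have "(\<lambda>l. ip lborel f (h l) * (\<lambda>l. cnj (ip lborel (\<lambda>x. cnj (K z x)) (h l))) l) sums ip lborel f (\<lambda>x. cnj (K z x))"
      by (intro parseval[OF h] L2_series_complete[OF h] complete) (use f K in auto)
    also have "ip lborel f (\<lambda>x. cnj (K z x)) = U f z" by (simp add: ip_def U_def mult.commute)
    also have "(\<lambda>l. cnj (ip lborel (\<lambda>x. cnj (K z x)) (h l))) = (\<lambda>l. e l z)"
      by (simp add: ip_def Kh[symmetric] h_real flip: Bochner_Integration.integral_cnj)
    finally show ?thesis .
  qed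
  \<comment> \<open>The series converges at every point, so \<open>L2_seriesI\<close> applies to the
    full sequence of partial sums and identifies the pointwise sum with the sum in mean.\<close>
  have U_series: "L2_series D e F c"
    if "summable (\<lambda>l. (cmod (c l))\<^sup>2)" "\<And>z. (\<lambda>l. c l * e l z) sums F z" for F c
    unfolding D_def
  proof (rule L2_seriesI[OF e that(1) strict_mono_id])
    have "F \<in> borel_measurable borel"
    proof (rule borel_measurable_LIMSEQ_metric)
      show "(\<lambda>z. \<Sum>l<N. c l * e l z) \<in> borel_measurable borel" for N by measurable
    qed (use that(2) in \<open>simp add: sums_def\<close>)
    then show "F \<in> borel_measurable (density lborel (\<lambda>z. ennreal (\<rho> z)))" by simp
  qed (use that(2) in \<open>simp add: sums_def\<close>)
  have ip_D: "weighted_inner \<rho> F G = ip D F G" if "F \<in> L2 D" "G \<in> L2 D" for F G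
  proof -
    have [measurable]: "F \<in> borel_measurable borel" "G \<in> borel_measurable borel" 
      using that by (auto simp: L2_def D_def)
    have "ip D F G = (LINT z|lborel. \<rho> z *\<^sub>R (F z * cnj (G z)))"
      unfolding ip_def D_def by (rule integral_density) (auto simp: \<rho>_nonneg)
    then show ?thesis by (simp add: weighted_inner_def scaleR_conv_of_real mult_ac)
  qed
  have isometry: "weighted_inner \<rho> (U f) (U g) = ip lborel f g" if f: "f \<in> L2 lborel" and g: "g \<in> L2 lborel" for f g
  proof -
    note fg = U_series[OF bessel[OF h f] U_sums[OF f]] U_series[OF bessel[OF h g] U_sums[OF g]]
    have "(\<lambda>l. ip lborel f (h l) * cnj (ip lborel g (h l))) sums ip D (U f) (U g)"
      using parseval[OF e] fg unfolding D_def by blast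
    moreover have "(\<lambda>l. ip lborel f (h l) * cnj (ip lborel g (h l))) sums ip lborel f g"
      by (intro parseval[OF h] L2_series_complete[OF h] complete f g) auto
    ultimately have "ip D (U f) (U g) = ip lborel f g" by (rule sums_unique2)
    then show ?thesis using fg by (subst ip_D) (auto simp: L2_series_def)
  qed
  have linear: "U (\<lambda>x. a * f x + b * g x) = (\<lambda>z. a * U f z + b * U g z)" 
    if "f \<in> L2 lborel" "g \<in> L2 lborel" for f g a b
  proof
    fix z
    have "U (\<lambda>x. a * f x + b * g x) z = (LINT x|lborel. a * (K z x * f x) + b * (K z x * g x))"
      by (simp add: U_def algebra_simps)
    also have "\<dots> = a * U f z + b * U g z"
      unfolding U_def using L2_mult_integrable[OF K that(1)] L2_mult_integrable[OF K that(2)] by simp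
    finally show "U (\<lambda>x. a * f x + b * g x) z = a * U f z + b * U g z" .
  qed
  have inj: "U f = U g \<longleftrightarrow> (AE x in lborel. f x = g x)" if f: "f \<in> L2 lborel" and g: "g \<in> L2 lborel" for f g
  proof
    assume eq: "U f = U g"
    have d: "(\<lambda>x. f x - g x) \<in> L2 lborel" using f g by (rule L2_diff)
    have "U (\<lambda>x. f x - g x) = (\<lambda>z. 0)" using linear[OF f g, of 1 "-1"] eq by simp
    with isometry[OF d d] have "nsq lborel (\<lambda>x. f x - g x) = 0"
      by (simp add: weighted_inner_def ip_self)
    then show "AE x in lborel. f x = g x" using d by (simp add: nsq_eq_0_iff)
  next
    assume ae: "AE x in lborel. f x = g x"
    show "U f = U g"
    proof
      fix z
      show "U f z = U g z" unfolding U_def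
      proof (rule integral_cong_AE)
        show "(\<lambda>x. K z x * f x) \<in> borel_measurable lborel" "(\<lambda>x. K z x * g x) \<in> borel_measurable lborel"
          using L2_measurable[OF K] L2_measurable[OF f] L2_measurable[OF g] by measurable
      qed (use ae in auto)
    qed
  qed
  have image: "U ` L2 lborel = l2_span e"
  proof
    show "U ` L2 lborel \<subseteq> l2_span e"
      unfolding l2_span_def using bessel[OF h] U_sums
      by (intro image_subsetI CollectI exI[of _ "\<lambda>l. ip lborel _ (h l)"] conjI allI) auto
    show "l2_span e \<subseteq> U ` L2 lborel"
    proof
      fix F assume "F \<in> l2_span e"
      then obtain c where c: "summable (\<lambda>l. (cmod (c l))\<^sup>2)" "\<And>z. (\<lambda>l. c l * e l z) sums F z"
        by (auto simp: l2_span_def)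
      obtain f where f: "L2_series lborel h f c" using riesz_fischer[OF h c(1)] by blast
      then have fL: "f \<in> L2 lborel" by (simp add: L2_series_def)
      have "U f z = F z" for z
        using U_sums[OF fL, of z] c(2)[of z] L2_series_coeff[OF h f] by (simp add: sums_unique2)
      then have "F = U f" by auto
      with fL show "F \<in> U ` L2 lborel" by blast
    qed
  qed
  show ?thesis
    unfolding unitary_from_L2R_def L2R inner U_def[abs_def, symmetric]
    using image inj linear isometry by blast
qed

section \<open>Substitution and moment integrals\<close>

text \<open>The rule on compact intervals passes to an increasing union by monotone convergence,
  which covers ranges such as the positive half-line or the whole line.\<close>

lemma nn_integral_substitution_UN:
  fixes f :: "real \<Rightarrow> ennreal" and l u :: "nat \<Rightarrow> real"
  assumes f [measurable]: "f \<in> borel_measurable borel"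
    and lu: "decseq l" "incseq u" "\<And>i. l i < u i"
    and deriv: "\<And>i x. x \<in> {l i..u i} \<Longrightarrow> (g has_real_derivative g' x) (at x)"
    and cont: "\<And>i. continuous_on {l i..u i} g'"
    and nonneg: "\<And>i x. x \<in> {l i..u i} \<Longrightarrow> g' x \<ge> 0"
  shows "(\<integral>\<^sup>+x. f x * indicator (\<Union>i. {g (l i)..g (u i)}) x \<partial>lborel) =
         (\<integral>\<^sup>+x. f (g x) * ennreal (g' x) * indicator (\<Union>i. {l i..u i}) x \<partial>lborel)"
proof -
  let ?F = "\<lambda>i x. f (g x) * ennreal (g' x) * indicator {l i..u i} x"
  have mono: "g x \<le> g y" if "x \<in> {l i..u i}" "y \<in> {l i..u i}" "x \<le> y" for i x y
  proof (rule DERIV_nonneg_imp_nondecreasing[OF that(3)])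
    fix t assume "x \<le> t" "t \<le> y"
    then have "t \<in> {l i..u i}" using that by auto
    then show "\<exists>d. (g has_real_derivative d) (at t) \<and> 0 \<le> d" using deriv nonneg by blast
  qed
  have inc1: "{l i..u i} \<subseteq> {l j..u j}" if "i \<le> j" for i j
    using decseqD[OF lu(1) that] incseqD[OF lu(2) that] by auto
  have inc2: "{g (l i)..g (u i)} \<subseteq> {g (l j)..g (u j)}" if "i \<le> j" for i j
  proof -
    have "l i \<in> {l j..u j}" "u i \<in> {l j..u j}" using inc1[OF that] lu(3)[of i] by auto
    then have "g (l j) \<le> g (l i)" "g (u i) \<le> g (u j)" using lu(3)[of j] by (auto intro!: mono[of _ j])
    then show ?thesis by auto
  qed
  have ind: "a * indicator A x \<le> a * indicator B x" if "A \<subseteq> B" for a :: ennreal and A B :: "real set" and x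
    using that by (auto simp: indicator_def)
  have sup: "a * indicator (\<Union>i. A i) x = (SUP i. a * indicator (A i) x)" 
    for a :: ennreal and A :: "nat \<Rightarrow> real set" and x
  proof (cases "x \<in> (\<Union>i. A i)")
    case True
    then obtain j where j: "x \<in> A j" by blast
    have "(SUP i. a * indicator (A i) x) = a"
    proof (rule antisym)
      show "a \<le> (SUP i. a * indicator (A i) x)" using j by (intro SUP_upper2[of j]) auto
    qed (auto intro!: SUP_least simp: indicator_def)
    with True show ?thesis by simp
  qed (auto simp: indicator_def)
  \<comment> \<open>\<open>g\<close> and \<open>g'\<close> are controlled only on the interval, so
    both are cut off by its indicator before measurability is invoked; the outer indicator makes
    this harmless.\<close>
  have [measurable]: "(\<lambda>x. f (g x) * ennreal (g' x) * indicator {l i..u i} x) \<in> borel_measurable borel" for i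
  proof -
    have "continuous_on {l i..u i} g"
      using deriv by (intro continuous_at_imp_continuous_on ballI) (auto intro: DERIV_isCont)
    then have [measurable]: "(\<lambda>x. indicator {l i..u i} x *\<^sub>R g x) \<in> borel_measurable borel"
      by (intro borel_measurable_continuous_on_indicator) auto
    have [measurable]: "(\<lambda>x. indicator {l i..u i} x *\<^sub>R g' x) \<in> borel_measurable borel"
      using cont by (intro borel_measurable_continuous_on_indicator) auto
    have "(\<lambda>x. f (indicator {l i..u i} x *\<^sub>R g x) * ennreal (indicator {l i..u i} x *\<^sub>R g' x) * indicator {l i..u i} x) \<in> borel_measurable borel"
      by measurable
    also have "(\<lambda>x. f (indicator {l i..u i} x *\<^sub>R g x) * ennreal (indicator {l i..u i} x *\<^sub>R g' x) * indicator {l i..u i} x) =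
       (\<lambda>x. f (g x) * ennreal (g' x) * indicator {l i..u i} x)"
      by (auto simp: indicator_def)
    finally show ?thesis .
  qed
  have "(\<integral>\<^sup>+x. f x * indicator (\<Union>i. {g (l i)..g (u i)}) x \<partial>lborel) = 
        (SUP i. \<integral>\<^sup>+x. f x * indicator {g (l i)..g (u i)} x \<partial>lborel)"
    unfolding sup
    by (rule nn_integral_monotone_convergence_SUP)
       (auto intro!: incseq_SucI le_funI ind inc2)
  also have "\<dots> = (SUP i. \<integral>\<^sup>+x. ?F i x \<partial>lborel)"
    by (intro SUP_cong refl nn_integral_substitution_aux) (use deriv cont nonneg lu in auto)
  also have "\<dots> = (\<integral>\<^sup>+x. (SUP i. ?F i x) \<partial>lborel)"
    by (rule nn_integral_monotone_convergence_SUP[symmetric])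
       (auto intro!: incseq_SucI le_funI ind inc1)
  finally show ?thesis by (simp add: sup)
qed

lemma nn_integral_substitution_powr:
  fixes f :: "real \<Rightarrow> ennreal" and c m :: real
  assumes f [measurable]: "f \<in> borel_measurable borel" and c: "c > 0" and m: "m > 0"
  shows "(\<integral>\<^sup>+x. f (c * x powr m) * ennreal (c * m * x powr (m - 1)) * indicator {0<..} x \<partial>lborel) =
         (\<integral>\<^sup>+y. f y * indicator {0<..} y \<partial>lborel)"
proof -
  \<comment> \<open>Starting at 1/2 rather than 1 keeps \<open>l i < u i\<close> strict at i = 0,
    where \<open>u 0 = 1\<close>.\<close>
  define l :: "nat \<Rightarrow> real" where "l i = 1 / (real i + 2)" for i
  define u :: "nat \<Rightarrow> real" where "u i = real i + 1" for i
  have l: "decseq l" by (auto simp: l_def decseq_def frac_le)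
  have u: "incseq u" by (auto simp: u_def incseq_def)
  have l_pos: "l i > 0" for i by (simp add: l_def)
  have lu: "l i < u i" for i
  proof -
    have "l i < 1" "u i \<ge> 1" by (auto simp: l_def u_def)
    then show ?thesis by linarith
  qed
  have U: "(\<Union>i. {l i..u i}) = {0<..}"
  proof (intro equalityI subsetI)
    fix x :: real assume "x \<in> {0<..}"
    then have x: "x > 0" by simp
    obtain i :: nat where i: "max x (1 / x) \<le> real i" using real_arch_simple by blast
    then have "1 / real (i + 2) \<le> 1 / (1 / x)" using x by (intro divide_left_mono) auto
    then have "l i \<le> x \<and> x \<le> u i" using i by (auto simp: l_def u_def add.commute)
    then show "x \<in> (\<Union>i. {l i..u i})" by (intro UN_I[of i]) auto
  next
    fix x assume "x \<in> (\<Union>i. {l i..u i})"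
    then obtain i where "l i \<le> x" by auto
    with l_pos[of i] show "x \<in> {0<..}" by simp
  qed
  have U2: "(\<Union>i. {c * l i powr m..c * u i powr m}) = {0<..}"
  proof (intro equalityI subsetI)
    fix y :: real assume y: "y \<in> {0<..}"
    define x where "x = (y / c) powr (1 / m)"
    have x: "x > 0" "c * x powr m = y" using y c m by (auto simp: x_def powr_powr)
    with U obtain i where "x \<in> {l i..u i}" by blast
    then have "y \<in> {c * l i powr m..c * u i powr m}"
      using x l_pos[of i] c m by (auto intro!: powr_mono2 simp flip: x(2))
    then show "y \<in> (\<Union>i. {c * l i powr m..c * u i powr m})" by blast
  next
    fix y assume "y \<in> (\<Union>i. {c * l i powr m..c * u i powr m})"
    then obtain i where "c * l i powr m \<le> y" by auto
    moreover have "c * l i powr m > 0" using c l_pos[of i] by simp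
    ultimately show "y \<in> {0<..}" by simp
  qed
  have "(\<integral>\<^sup>+y. f y * indicator (\<Union>i. {c * l i powr m..c * u i powr m}) y \<partial>lborel) = 
        (\<integral>\<^sup>+x. f (c * x powr m) * ennreal (c * m * x powr (m - 1)) * indicator (\<Union>i. {l i..u i}) x \<partial>lborel)"
  proof (rule nn_integral_substitution_UN[OF f l u lu])
    fix i x assume "x \<in> {l i..u i}"
    then have "x > 0" using l_pos[of i] by auto
    then show "((\<lambda>x. c * x powr m) has_real_derivative c * m * x powr (m - 1)) (at x)"
      by (auto intro!: derivative_eq_intros simp: powr_diff field_simps)
    show "0 \<le> c * m * x powr (m - 1)" using c m by simp
  next
    fix i show "continuous_on {l i..u i} (\<lambda>x. c * m * x powr (m - 1))"
      using l_pos[of i] by (auto intro!: continuous_intros)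
  qed
  then show ?thesis by (simp add: U U2)
qed

text \<open>The scaling rule of the Mellin transform under y = c x^m. It serves the moments of
  exp(-c x^(2n)), the inner integral in the Mellin transform of K, and the moments of the
  weights.\<close>

lemma nn_integral_mellin_powr:
  fixes \<phi> :: "real \<Rightarrow> ennreal" and c m s :: real
  assumes [measurable]: "\<phi> \<in> borel_measurable borel" and c: "c > 0" and m: "m > 0"
  shows "(\<integral>\<^sup>+x. ennreal (x powr (s - 1)) * \<phi> (c * x powr m) * indicator {0<..} x \<partial>lborel) =
         ennreal (c powr (- s / m) / m) * (\<integral>\<^sup>+y. ennreal (y powr (s / m - 1)) * \<phi> y * indicator {0<..} y \<partial>lborel)"
proof -
  \<comment> \<open>Chosen so that g (c x^m) times the derivative c m x^(m-1) is the integrand on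
    the left.\<close>
  define g where "g y = ennreal (c powr (- s / m) / m) * (ennreal (y powr (s / m - 1)) * \<phi> y)" for y
  have [measurable]: "g \<in> borel_measurable borel" unfolding g_def by measurable
  have "ennreal (x powr (s - 1)) * \<phi> (c * x powr m) * indicator {0<..} x = 
        g (c * x powr m) * ennreal (c * m * x powr (m - 1)) * indicator {0<..} x" for x
  proof (cases "x > 0")
    case True
    have "c powr (- s / m) / m * (c * x powr m) powr (s / m - 1) * (c * m * x powr (m - 1)) =
          (c powr (- s / m) * c powr (s / m - 1) * c powr 1) * (x powr (m * (s / m - 1)) * x powr (m - 1))"
      using True c m by (simp add: powr_mult powr_powr)
    also have "\<dots> = x powr (s - 1)"
      using True c m by (simp add: powr_add[symmetric] field_simps)
    finally show ?thesis using True c m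
      by (simp add: g_def ennreal_mult[symmetric] mult_ac)
  qed auto
  then have "(\<integral>\<^sup>+x. ennreal (x powr (s - 1)) * \<phi> (c * x powr m) * indicator {0<..} x \<partial>lborel) = 
             (\<integral>\<^sup>+y. g y * indicator {0<..} y \<partial>lborel)"
    using nn_integral_substitution_powr[of g c m] c m by simp
  also have "\<dots> = ennreal (c powr (- s / m) / m) * (\<integral>\<^sup>+y. ennreal (y powr (s / m - 1)) * \<phi> y * indicator {0<..} y \<partial>lborel)"
    unfolding g_def by (subst nn_integral_cmult[symmetric]) (auto simp: mult_ac)
  finally show ?thesis .
qed

section \<open>Moments of exp(-c x^(2n)) on the line\<close>

lemma nn_integral_even:
  fixes f :: "real \<Rightarrow> ennreal"
  assumes [measurable]: "f \<in> borel_measurable borel" and even: "\<And>x. f (- x) = f x"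
  shows "(\<integral>\<^sup>+x. f x \<partial>lborel) = 2 * (\<integral>\<^sup>+x. f x * indicator {0<..} x \<partial>lborel)"
proof -
  have "(\<integral>\<^sup>+x. f x \<partial>lborel) = (\<integral>\<^sup>+x. f x * indicator {0<..} x + f x * indicator {..<0} x \<partial>lborel)"
    by (rule nn_integral_cong_AE, rule eventually_mono[OF AE_lborel_singleton[of 0]]) (auto simp: indicator_def)
  also have "\<dots> = (\<integral>\<^sup>+x. f x * indicator {0<..} x \<partial>lborel) + (\<integral>\<^sup>+x. f x * indicator {..<0} x \<partial>lborel)"
    by (rule nn_integral_add) auto
  also have "(\<integral>\<^sup>+x. f x * indicator {..<0} x \<partial>lborel) = (\<integral>\<^sup>+x. f x * indicator {0<..} x \<partial>lborel)"
    using nn_integral_real_affine[of "\<lambda>x. f x * indicator {..<0} x" "-1" 0]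
    by (simp add: even indicator_def cong: if_cong)
  finally show ?thesis by (simp add: mult_2)
qed

lemma nn_integral_Gamma:
  assumes "s > (0::real)"
  shows "(\<integral>\<^sup>+y. ennreal (y powr (s - 1)) * ennreal (exp (- y)) * indicator {0<..} y \<partial>lborel) = ennreal (Gamma s)"
  unfolding Gamma_conv_nn_integral_real[OF assms]
  by (rule nn_integral_cong) (auto simp: indicator_def exp_minus divide_simps ennreal_mult[symmetric])

lemma integral_power_exp:
  fixes c :: real and q n :: nat
  assumes c: "c > 0" and n: "n \<ge> 1"
  shows "has_bochner_integral lborel (\<lambda>x::real. x ^ (2 * q) * exp (- (c * x ^ (2 * n)))) 
           (c powr (- ((2 * q + 1) / (2 * n))) / n * Gamma ((2 * q + 1) / (2 * n)))"
proof (rule has_bochner_integral_nn_integral)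
  define m where "m = 2 * real n"
  define s where "s = 2 * real q + 1"
  have m: "m > 0" and s: "s > 0" using n by (auto simp: m_def s_def)
  have "(\<integral>\<^sup>+ x. ennreal (x ^ (2 * q) * exp (- (c * x ^ (2 * n)))) \<partial>lborel) = 
     2 * (\<integral>\<^sup>+ x. ennreal (x ^ (2 * q) * exp (- (c * x ^ (2 * n)))) * indicator {0<..} x \<partial>lborel)"
    by (rule nn_integral_even) auto
  also have "(\<integral>\<^sup>+ x. ennreal (x ^ (2 * q) * exp (- (c * x ^ (2 * n)))) * indicator {0<..} x \<partial>lborel) =
     (\<integral>\<^sup>+ x. ennreal (x powr (s - 1)) * ennreal (exp (- (c * x powr m))) * indicator {0<..} x \<partial>lborel)"
  proof (rule nn_integral_cong)
    fix x :: real
    show "ennreal (x ^ (2 * q) * exp (- (c * x ^ (2 * n)))) * indicator {0<..} x =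
      ennreal (x powr (s - 1)) * ennreal (exp (- (c * x powr m))) * indicator {0<..} x"
    proof (cases "x > 0")
      case True
      have "x powr (s - 1) = x ^ (2 * q)" "x powr m = x ^ (2 * n)"
        using True powr_realpow[of x "2 * q"] powr_realpow[of x "2 * n"] by (auto simp: s_def m_def)
      then show ?thesis using True by (simp add: ennreal_mult)
    qed auto
  qed
  also have "\<dots> = ennreal (c powr (- s / m) / m) * (\<integral>\<^sup>+y. ennreal (y powr (s / m - 1)) * ennreal (exp (- y)) * indicator {0<..} y \<partial>lborel)"
    by (rule nn_integral_mellin_powr) (use c m in auto)
  also have "(\<integral>\<^sup>+y. ennreal (y powr (s / m - 1)) * ennreal (exp (- y)) * indicator {0<..} y \<partial>lborel) = ennreal (Gamma (s / m))"
    by (rule nn_integral_Gamma) (use m s in auto)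
  also have "2 * (ennreal (c powr (- s / m) / m) * ennreal (Gamma (s / m))) = ennreal (2 * (c powr (- s / m) / m * Gamma (s / m)))"
  proof -
    have "2 * (ennreal a * ennreal b) = ennreal (2 * (a * b))" if "a \<ge> 0" "b \<ge> 0" for a b
      using that ennreal_mult[of 2 "a * b"] ennreal_mult[of a b] by simp
    then show ?thesis using m s by (simp add: Gamma_real_pos less_imp_le)
  qed
  also have "2 * (c powr (- s / m) / m * Gamma (s / m)) = 
     c powr (- ((2 * q + 1) / (2 * n))) / n * Gamma ((2 * q + 1) / (2 * n))"
  proof -
    have "s / m = (2 * q + 1) / (2 * n)" by (simp add: m_def s_def)
    then show ?thesis using n by (simp add: m_def del: of_nat_add of_nat_mult)
  qed
  finally show "(\<integral>\<^sup>+ x. ennreal (x ^ (2 * q) * exp (- (c * x ^ (2 * n)))) \<partial>lborel) = 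
     ennreal (c powr (- ((2 * q + 1) / (2 * n))) / n * Gamma ((2 * q + 1) / (2 * n)))" .
  show "0 \<le> c powr (- ((2 * q + 1) / (2 * n))) / n * Gamma ((2 * q + 1) / (2 * n))"
    using n by (intro mult_nonneg_nonneg) (auto intro!: less_imp_le Gamma_real_pos divide_pos_pos)
qed auto

section \<open>Laguerre functions: orthonormality\<close>

definition laguerre :: "real \<Rightarrow> nat \<Rightarrow> real \<Rightarrow> real" where
  "laguerre \<nu> k u = (\<Sum>i\<le>k. ((\<nu> + k) gchoose (k - i)) * (- u) ^ i / fact i)"

text \<open>Chu-Vandermonde: \<Gamma>(\<nu> + 1 + l + i) is \<Gamma>(\<nu> + 1 + l) times a rising
  factorial, which with (-1)^i / i! becomes the binomial coefficient of -(\<nu> + 1 + l) over i. The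
  convolution equals (k - l - 1 choose k), and upper negation turns it into (-1)^k (l choose k). Up
  to a constant this is the moment of u^l against the k-th Laguerre polynomial, so it vanishes for l
  < k.\<close>

lemma laguerre_Gamma_sum:
  fixes \<nu> :: real
  assumes \<nu>: "\<nu> > -1"
  shows "(\<Sum>i\<le>k. ((\<nu> + k) gchoose (k - i)) * (-1) ^ i / fact i * Gamma (\<nu> + 1 + (real l + real i))) =
         (-1) ^ k * Gamma (\<nu> + 1 + l) * (l choose k)"
proof -
  have G: "Gamma (\<nu> + 1 + (real l + real i)) = Gamma (\<nu> + 1 + l) * pochhammer (\<nu> + 1 + l) i" for i
  proof -
    have "\<nu> + 1 + real l \<notin> \<int>\<^sub>\<le>\<^sub>0" using \<nu> by (auto simp: nonpos_Ints_def)
    moreover have "Gamma (\<nu> + 1 + real l) \<noteq> 0" using \<nu> by (intro less_imp_neq[symmetric] Gamma_real_pos) auto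
    ultimately show ?thesis using pochhammer_Gamma[of "\<nu> + 1 + real l" i] by (simp add: add_ac)
  qed
  have P: "(-1) ^ i / fact i * pochhammer x i = (- x gchoose i)" for x :: real and i
    by (simp add: gbinomial_pochhammer)
  have "(\<Sum>i\<le>k. ((\<nu> + k) gchoose (k - i)) * (-1) ^ i / fact i * Gamma (\<nu> + 1 + (real l + real i))) =
        Gamma (\<nu> + 1 + l) * (\<Sum>i\<le>k. (- (\<nu> + 1 + l) gchoose i) * ((\<nu> + k) gchoose (k - i)))"
    unfolding G sum_distrib_left P[symmetric] by (intro sum.cong) auto
  also have "(\<Sum>i\<le>k. (- (\<nu> + 1 + l) gchoose i) * ((\<nu> + k) gchoose (k - i))) = ((- (\<nu> + 1 + l) + (\<nu> + k)) gchoose k)"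
    using gbinomial_Vandermonde[of "- (\<nu> + 1 + l)" "\<nu> + k" k] by (simp add: atLeast0AtMost)
  also have "- (\<nu> + 1 + l) + (\<nu> + k) = real k - real l - 1" by simp
  also have "((real k - real l - 1) gchoose k) = (-1) ^ k * (real l gchoose k)"
    using gbinomial_negated_upper[of "real l" k] by simp
  finally show ?thesis by (simp add: binomial_gbinomial)
qed

text \<open>Under u = x^(2n) / n the weight x^(2p) dx on the half-line becomes a multiple of u^\<nu>
  du with this exponent, the Laguerre weight once exp(-u) is added.\<close>

definition nu :: "nat \<Rightarrow> nat \<Rightarrow> real" where
  "nu n p = (2 * p + 1) / (2 * n) - 1"

lemma nu_gt: "n \<ge> 1 \<Longrightarrow> nu n p > -1"
  by (simp add: nu_def)

lemma integral_monomial_weight: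
  assumes n: "n \<ge> 1"
  shows "has_bochner_integral lborel (\<lambda>x::real. x ^ (2 * p) * (x ^ (2 * n) / real n) ^ l * exp (- (x ^ (2 * n) / real n)))
           (n powr nu n p * Gamma (nu n p + 1 + l))"
proof -
  have "has_bochner_integral lborel (\<lambda>x::real. 1 / n ^ l * (x ^ (2 * (p + n * l)) * exp (- (1 / n * x ^ (2 * n)))))
          (1 / n ^ l * ((1 / n) powr (- ((2 * (p + n * l) + 1) / (2 * n))) / n * Gamma ((2 * (p + n * l) + 1) / (2 * n))))"
    by (intro has_bochner_integral_mult_right integral_power_exp) (use n in auto)
  also have "(\<lambda>x::real. 1 / n ^ l * (x ^ (2 * (p + n * l)) * exp (- (1 / n * x ^ (2 * n))))) =
             (\<lambda>x::real. x ^ (2 * p) * (x ^ (2 * n) / real n) ^ l * exp (- (x ^ (2 * n) / real n)))"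
    by (auto simp: power_add power_mult power_mult_distrib power_divide distrib_left)
  also have "(2 * (p + n * l) + 1) / (2 * n) = nu n p + 1 + l"
    using n by (simp add: nu_def field_simps)
  also have "1 / n ^ l * ((1 / n) powr - (nu n p + 1 + l) / n * Gamma (nu n p + 1 + l)) = n powr nu n p * Gamma (nu n p + 1 + l)"
  proof -
    have "(1 / real n) powr - (nu n p + 1 + l) = n powr (nu n p + 1 + l)"
      using n by (simp only: powr_minus) (simp add: powr_divide)
    also have "\<dots> = n powr nu n p * n * n ^ l"
      using n by (simp add: powr_add powr_realpow)
    finally show ?thesis using n by simp
  qed
  finally show ?thesis .
qed

text \<open>The sign (-1)^k cancels the one in \<open>laguerre_Gamma_sum\<close>, so that the
  pairings with x^p u^l exp(-u/2), and through them the basis coefficients, come out nonnegative.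
  The root normalises in L^2.\<close>

definition lag_fun :: "nat \<Rightarrow> nat \<Rightarrow> nat \<Rightarrow> real \<Rightarrow> real" where
  "lag_fun n p k x = (-1) ^ k * sqrt (fact k / (n powr nu n p * Gamma (nu n p + 1 + k))) *
     (x ^ p * laguerre (nu n p) k (x ^ (2 * n) / real n) * exp (- (x ^ (2 * n) / (2 * real n))))"

lemma exp_half: "exp (- (x / (2 * real n))) * exp (- (x / (2 * real n))) = exp (- (x / real n))" if "n \<ge> 1"
  using that by (simp add: exp_add[symmetric] field_simps)

text \<open>Expanding the Laguerre polynomial leaves Gamma moments, which
  \<open>laguerre_Gamma_sum\<close> collapses. The factor \<open>l choose k\<close> carries both
  uses of the formula: its vanishing for l < k gives orthogonality, and its values for l \<ge> k
  give the exponential series of the kernel.\<close>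

lemma integral_monomial_lag_fun:
  assumes n: "n \<ge> 1"
  shows "has_bochner_integral lborel 
     (\<lambda>x. x ^ p * (x ^ (2 * n) / real n) ^ l * exp (- (x ^ (2 * n) / (2 * real n))) * lag_fun n p k x)
     (sqrt (fact k / (n powr nu n p * Gamma (nu n p + 1 + k))) * (n powr nu n p * Gamma (nu n p + 1 + l) * (l choose k)))"
proof -
  let ?\<nu> = "nu n p"
  let ?C = "sqrt (fact k / (n powr nu n p * Gamma (nu n p + 1 + k)))"
  have "has_bochner_integral lborel
     (\<lambda>x. \<Sum>i\<le>k. (-1) ^ k * ?C * (((?\<nu> + k) gchoose (k - i)) * (-1) ^ i / fact i) * 
        (x ^ (2 * p) * (x ^ (2 * n) / real n) ^ (l + i) * exp (- (x ^ (2 * n) / real n))))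
     (\<Sum>i\<le>k. (-1) ^ k * ?C * (((?\<nu> + k) gchoose (k - i)) * (-1) ^ i / fact i) * (n powr ?\<nu> * Gamma (?\<nu> + 1 + (l + i))))"
    by (intro has_bochner_integral_sum has_bochner_integral_mult_right)
       (use integral_monomial_weight[OF n] in fastforce)
  also have "(\<Sum>i\<le>k. (-1) ^ k * ?C * (((?\<nu> + k) gchoose (k - i)) * (-1) ^ i / fact i) * (n powr ?\<nu> * Gamma (?\<nu> + 1 + (l + i))))
    = (-1) ^ k * ?C * n powr ?\<nu> * (\<Sum>i\<le>k. ((?\<nu> + k) gchoose (k - i)) * (-1) ^ i / fact i * Gamma (?\<nu> + 1 + (l + i)))"
    by (simp add: sum_distrib_left mult_ac)
  also have "\<dots> = ?C * (n powr ?\<nu> * Gamma (?\<nu> + 1 + l) * (l choose k))"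
    unfolding of_nat_add by (subst laguerre_Gamma_sum[OF nu_gt[OF n]]) (simp add: power_add[symmetric])
  also have "(\<lambda>x. \<Sum>i\<le>k. (-1) ^ k * ?C * (((?\<nu> + k) gchoose (k - i)) * (-1) ^ i / fact i) * 
        (x ^ (2 * p) * (x ^ (2 * n) / real n) ^ (l + i) * exp (- (x ^ (2 * n) / real n)))) =
    (\<lambda>x. x ^ p * (x ^ (2 * n) / real n) ^ l * exp (- (x ^ (2 * n) / (2 * real n))) * lag_fun n p k x)"
  proof
    fix x :: real
    define u where "u = x ^ (2 * n) / n"
    define E where "E = exp (- (x ^ (2 * n) / (2 * real n)))"
    have E: "exp (- u) = E * E" unfolding E_def u_def using exp_half[OF n, of "x ^ (2 * n)"] by simp
    have "(\<Sum>i\<le>k. (-1) ^ k * ?C * (((?\<nu> + k) gchoose (k - i)) * (-1) ^ i / fact i) * (x ^ (2 * p) * u ^ (l + i) * exp (- u))) = 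
       (\<Sum>i\<le>k. (((?\<nu> + k) gchoose (k - i)) * (- u) ^ i / fact i) * ((-1) ^ k * ?C * x ^ p * x ^ p * u ^ l * E * E))"
      unfolding mult_2[of p] power_add E by (intro sum.cong refl) (simp add: power_minus[of u] mult_ac)
    also have "\<dots> = x ^ p * u ^ l * E * lag_fun n p k x"
      unfolding sum_distrib_right[symmetric] lag_fun_def laguerre_def u_def E_def by (simp add: mult_ac)
    finally show "(\<Sum>i\<le>k. (-1) ^ k * ?C * (((?\<nu> + k) gchoose (k - i)) * (-1) ^ i / fact i) * 
        (x ^ (2 * p) * (x ^ (2 * n) / real n) ^ (l + i) * exp (- (x ^ (2 * n) / real n)))) =
      x ^ p * (x ^ (2 * n) / real n) ^ l * exp (- (x ^ (2 * n) / (2 * real n))) * lag_fun n p k x"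
      unfolding u_def E_def by simp
  qed
  finally show ?thesis .
qed

text \<open>The function of lower index is expanded: its powers u^i have i \<le> j \<le> k, and the
  factor \<open>i choose k\<close> leaves at most the term i = k, which occurs only if j =
  k.\<close>

lemma integral_lag_fun_le:
  assumes n: "n \<ge> 1" and jk: "j \<le> k"
  shows "has_bochner_integral lborel (\<lambda>x. lag_fun n p j x * lag_fun n p k x) (if j = k then 1 else 0)"
proof -
  let ?\<nu> = "nu n p"
  let ?C = "\<lambda>k. sqrt (fact k / (n powr ?\<nu> * Gamma (?\<nu> + 1 + real k)))"
  let ?a = "\<lambda>i. ((?\<nu> + j) gchoose (j - i)) * (-1) ^ i / fact i"
  have "has_bochner_integral lborel 
     (\<lambda>x. \<Sum>i\<le>j. (-1) ^ j * ?C j * ?a i * (x ^ p * (x ^ (2 * n) / real n) ^ i * exp (- (x ^ (2 * n) / (2 * real n))) * lag_fun n p k x))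
     (\<Sum>i\<le>j. (-1) ^ j * ?C j * ?a i * (?C k * (n powr ?\<nu> * Gamma (?\<nu> + 1 + i) * (i choose k))))"
    by (intro has_bochner_integral_sum has_bochner_integral_mult_right) (rule integral_monomial_lag_fun[OF n])
  also have "(\<lambda>x. \<Sum>i\<le>j. (-1) ^ j * ?C j * ?a i * (x ^ p * (x ^ (2 * n) / real n) ^ i * exp (- (x ^ (2 * n) / (2 * real n))) * lag_fun n p k x)) = 
     (\<lambda>x. lag_fun n p j x * lag_fun n p k x)"
  proof
    fix x :: real
    define y where "y = lag_fun n p k x"
    define u where "u = x ^ (2 * n) / n"
    have "(\<Sum>i\<le>j. (-1) ^ j * ?C j * ?a i * (x ^ p * u ^ i * exp (- (x ^ (2 * n) / (2 * real n))) * y)) =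
      (\<Sum>i\<le>j. (((?\<nu> + j) gchoose (j - i)) * (- u) ^ i / fact i) * ((-1) ^ j * ?C j * x ^ p * exp (- (x ^ (2 * n) / (2 * real n))) * y))"
      by (intro sum.cong) (auto simp: power_minus[of u] mult_ac)
    also have "\<dots> = lag_fun n p j x * y" 
      unfolding sum_distrib_right[symmetric] lag_fun_def laguerre_def u_def by (simp add: mult_ac)
    finally show "(\<Sum>i\<le>j. (-1) ^ j * ?C j * ?a i * (x ^ p * (x ^ (2 * n) / real n) ^ i * exp (- (x ^ (2 * n) / (2 * real n))) * lag_fun n p k x)) = 
       lag_fun n p j x * lag_fun n p k x" by (simp add: y_def u_def)
  qed
  also have "(\<Sum>i\<le>j. (-1) ^ j * ?C j * ?a i * (?C k * (n powr ?\<nu> * Gamma (?\<nu> + 1 + i) * (i choose k)))) = (if j = k then 1 else 0)"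
  proof (cases "j = k")
    case True
    \<comment> \<open>Collects the two signs \<open>s\<close> and the two normalising constants
      \<open>c\<close> into squares; 1 / f is, up to sign, the leading coefficient of the Laguerre
      polynomial.\<close>
    have alg: "s * c * (1 * s / f) * (c * (X * 1)) = (s * s) * ((c * c) * (X / f))" for s c f X :: real
      by simp
    have G: "Gamma (?\<nu> + 1 + real k) > 0" using nu_gt[OF n, of p] by (intro Gamma_real_pos) auto
    have "(\<Sum>i\<le>k. (-1) ^ k * ?C k * (((?\<nu> + k) gchoose (k - i)) * (-1) ^ i / fact i) * (?C k * (n powr ?\<nu> * Gamma (?\<nu> + 1 + i) * (i choose k)))) =
       (\<Sum>i\<in>{k}. (-1) ^ k * ?C k * (((?\<nu> + k) gchoose (k - i)) * (-1) ^ i / fact i) * (?C k * (n powr ?\<nu> * Gamma (?\<nu> + 1 + i) * (i choose k))))"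
      by (rule sum.mono_neutral_right) auto
    also have "\<dots> = ((-1) ^ k * (-1) ^ k) * ((?C k * ?C k) * (n powr ?\<nu> * Gamma (?\<nu> + 1 + k) / fact k))"
      by (subst alg[symmetric]) simp
    also have "\<dots> = (?C k * ?C k) * (n powr ?\<nu> * Gamma (?\<nu> + 1 + k) / fact k)"
      by (simp only: power_add[symmetric] mult_2[symmetric]) simp
    also have "?C k * ?C k = fact k / (n powr ?\<nu> * Gamma (?\<nu> + 1 + real k))"
      using G by simp
    also have "\<dots> * (n powr ?\<nu> * Gamma (?\<nu> + 1 + k) / fact k) = 1" using G n by simp
    finally show ?thesis using True by simp
  next
    case False
    then have "i choose k = 0" if "i \<le> j" for i using jk that by (intro binomial_eq_0) auto
    with False show ?thesis by (simp add: sum.neutral)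
  qed
  finally show ?thesis .
qed

lemma integral_lag_fun:
  assumes n: "n \<ge> 1"
  shows "has_bochner_integral lborel (\<lambda>x. lag_fun n p j x * lag_fun n p k x) (if j = k then 1 else 0)"
  using integral_lag_fun_le[OF n, of j k p] integral_lag_fun_le[OF n, of k j p]
  by (cases "j \<le> k") (auto simp: mult.commute)

text \<open>Reflection turns the integral into its negative; for non-integrable \<open>f\<close>
  both are the default value 0.\<close>

lemma integral_odd:
  fixes f :: "real \<Rightarrow> 'a :: {banach, second_countable_topology}"
  assumes "\<And>x. f (- x) = - f x"
  shows "(LINT x|lborel. f x) = 0"
proof -
  have "(LINT x|lborel. f x) = (LINT x|lborel. f (0 + (-1) * x))"
    by (subst lborel_integral_real_affine[of "-1" f 0]) auto
  also have "\<dots> = - (LINT x|lborel. f x)" by (simp add: assms)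
  finally have "(LINT x|lborel. f x) + (LINT x|lborel. f x) = 0" by (metis add.left_inverse)
  then have "(2::real) *\<^sub>R (LINT x|lborel. f x) = 0" by (simp add: scaleR_2)
  then show ?thesis by simp
qed

section \<open>Laguerre functions: completeness\<close>

text \<open>The positive and the negative part of \<open>R\<close> are densities of two finite
  measures that agree on all rays \<open>{r<..}\<close> and hence coincide; uniqueness of densities
  then equates the two parts.\<close>

lemma AE_zero_if_integral_greaterThan_zero:
  fixes R :: "real \<Rightarrow> real"
  assumes R [measurable]: "integrable lborel R"
    and zero: "\<And>r. (LINT x|lborel. indicator {r<..} x * R x) = 0"
  shows "AE x in lborel. R x = 0"
proof -
  have fin: "(\<integral>\<^sup>+x. ennreal (R x) \<partial>lborel) < \<infinity>" "(\<integral>\<^sup>+x. ennreal (- R x) \<partial>lborel) < \<infinity>"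
    using R by (auto simp: real_integrable_def less_top)
  let ?M = "\<lambda>R. density lborel (\<lambda>x. ennreal (R x))"
  have em: "emeasure (?M S) {r<..} = ennreal (LINT x|lborel. max 0 (S x) * indicator {r<..} x)"
    and em_le: "emeasure (?M S) {r<..} \<le> (\<integral>\<^sup>+x. ennreal (S x) \<partial>lborel)"
    if S [measurable]: "integrable lborel S" for S :: "real \<Rightarrow> real" and r
  proof -
    have "emeasure (?M S) {r<..} = (\<integral>\<^sup>+x. ennreal (S x) * indicator {r<..} x \<partial>lborel)"
      by (rule emeasure_density) auto
    also have "\<dots> = (\<integral>\<^sup>+x. ennreal (max 0 (S x) * indicator {r<..} x) \<partial>lborel)"
      by (intro nn_integral_cong) (auto simp: indicator_def ennreal_neg max_def)
    also have "\<dots> = ennreal (LINT x|lborel. max 0 (S x) * indicator {r<..} x)"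
      by (intro nn_integral_eq_integral integrable_real_mult_indicator integrable_max) (use S in auto)
    finally show "emeasure (?M S) {r<..} = ennreal (LINT x|lborel. max 0 (S x) * indicator {r<..} x)" .
    have "emeasure (?M S) {r<..} = (\<integral>\<^sup>+x. ennreal (S x) * indicator {r<..} x \<partial>lborel)"
      by (rule emeasure_density) auto
    also have "\<dots> \<le> (\<integral>\<^sup>+x. ennreal (S x) \<partial>lborel)"
      by (intro nn_integral_mono) (auto simp: indicator_def)
    finally show "emeasure (?M S) {r<..} \<le> (\<integral>\<^sup>+x. ennreal (S x) \<partial>lborel)" .
  qed
  have "?M R = ?M (\<lambda>x. - R x)"
  proof (rule measure_eqI_lessThan)
    fix r
    have "(LINT x|lborel. max 0 (R x) * indicator {r<..} x) - (LINT x|lborel. max 0 (- R x) * indicator {r<..} x) =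
          (LINT x|lborel. max 0 (R x) * indicator {r<..} x - max 0 (- R x) * indicator {r<..} x)"
      by (intro Bochner_Integration.integral_diff[symmetric] integrable_real_mult_indicator integrable_max) (use R in auto)
    also have "(\<lambda>x. max 0 (R x) * indicator {r<..} x - max 0 (- R x) * indicator {r<..} x) = (\<lambda>x. indicator {r<..} x * R x)"
      by (auto simp: indicator_def max_def)
    finally show "emeasure (?M R) {r<..} = emeasure (?M (\<lambda>x. - R x)) {r<..}"
      using zero[of r] R by (simp add: em)
    show "emeasure (?M R) {r<..} < \<infinity>"
      using em_le[OF R, of r] fin(1) by (rule le_less_trans)
  qed auto
  \<comment> \<open>\<open>ennreal\<close> truncates negative numbers to 0, so this equates the
    positive and the negative part of R x; one of them is 0, hence both are.\<close>
  then have "AE x in lborel. ennreal (R x) = ennreal (- R x)"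
    by (subst (asm) finite_density_unique) (use fin in auto)
  then show ?thesis
  proof eventually_elim
    case (elim x)
    then show ?case by (cases "R x \<ge> 0") (auto simp: ennreal_neg ennreal_eq_0_iff)
  qed
qed

lemma AE_zero_if_integral_greaterThan_zero_complex:
  fixes R :: "real \<Rightarrow> complex"
  assumes R: "integrable lborel R"
    and zero: "\<And>r. (LINT x|lborel. indicator {r<..} x *\<^sub>R R x) = 0"
  shows "AE x in lborel. R x = 0"
proof -
  have int: "integrable lborel (\<lambda>x. indicator {r<..} x *\<^sub>R R x)" for r
    by (rule integrable_mult_indicator) (use R in auto)
  have "AE x in lborel. Re (R x) = 0"
  proof (rule AE_zero_if_integral_greaterThan_zero)
    show "(LINT x|lborel. indicator {r<..} x * Re (R x)) = 0" for r
      using zero[of r] integral_Re[OF int[of r]] by simp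
  qed (use R in auto)
  moreover have "AE x in lborel. Im (R x) = 0"
  proof (rule AE_zero_if_integral_greaterThan_zero)
    show "(LINT x|lborel. indicator {r<..} x * Im (R x)) = 0" for r
      using zero[of r] integral_Im[OF int[of r]] by simp
  qed (use R in auto)
  ultimately show ?thesis by eventually_elim (simp add: complex_eq_iff)
qed

text \<open>By Weierstrass approximation, a function whose moments against the powers of \<open>v\<close> all
  vanish integrates to zero over every set \<open>{x. v x < \<theta>}\<close>.\<close>
lemma integral_sublevel_zero_if_moments_zero:
  fixes G :: "'a \<Rightarrow> complex" and v :: "'a \<Rightarrow> real"
  assumes G [measurable]: "integrable M G" and v [measurable]: "v \<in> borel_measurable M"
    and v01: "\<And>x. v x \<in> {0..1}"
    and moments: "\<And>m. (LINT x|M. of_real (v x ^ m) * G x) = 0"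
  shows "(LINT x|M. of_real (indicator {..<\<theta>} (v x)) * G x) = 0"
proof -
  have int_bdd: "integrable M (\<lambda>x. of_real (q (v x)) * G x)"
    if q [measurable]: "q \<in> borel_measurable borel" and b: "\<And>t. t \<in> {0..1} \<Longrightarrow> \<bar>q t\<bar> \<le> B" for q :: "real \<Rightarrow> real" and B
  proof (rule Bochner_Integration.integrable_bound)
    show "integrable M (\<lambda>x. B * cmod (G x))" using G by auto
    show "AE x in M. norm (of_real (q (v x)) * G x) \<le> norm (B * cmod (G x))"
    proof (rule AE_I2)
      fix x
      have "\<bar>q (v x)\<bar> \<le> \<bar>B\<bar>" using b[OF v01[of x]] by linarith
      then show "norm (of_real (q (v x)) * G x) \<le> norm (B * cmod (G x))"
        by (simp add: norm_mult abs_mult mult_right_mono)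
    qed
  qed measurable
  have cont: "(LINT x|M. of_real (q (v x)) * G x) = 0" if q: "continuous_on UNIV q" for q :: "real \<Rightarrow> real"
  proof -
    have [measurable]: "q \<in> borel_measurable borel" using q by (rule borel_measurable_continuous_onI)
    have "cmod (LINT x|M. of_real (q (v x)) * G x) \<le> e * (LINT x|M. cmod (G x))" if e: "e > 0" for e
    proof -
      have "continuous_on {0..1} q" using q continuous_on_subset by blast
      then obtain g where g: "real_polynomial_function g" "\<And>x. x \<in> {0..1} \<Longrightarrow> \<bar>q x - g x\<bar> < e"
        using Stone_Weierstrass_real_polynomial_function[of "{0..1}" q e] e by auto
      then obtain a N where gN: "g = (\<lambda>x. \<Sum>i\<le>N. a i * x ^ i)"
        unfolding real_polynomial_function_iff_sum by blast
      have int_pow: "integrable M (\<lambda>x. of_real (v x ^ i) * G x)" for i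
        by (rule int_bdd[of "\<lambda>t. t ^ i" 1]) (auto simp: power_le_one power_abs)
      have [measurable]: "g \<in> borel_measurable borel" unfolding gN by measurable
      have int_g: "integrable M (\<lambda>x. of_real (g (v x)) * G x)" 
      proof -
        have "integrable M (\<lambda>x. \<Sum>i\<le>N. of_real (a i) * (of_real (v x ^ i) * G x))"
          using int_pow by (intro Bochner_Integration.integrable_sum integrable_mult_right) auto
        then show ?thesis unfolding gN of_real_sum sum_distrib_right by (simp add: mult_ac)
      qed
      have "(LINT x|M. of_real (g (v x)) * G x) = (LINT x|M. (\<Sum>i\<le>N. of_real (a i) * (of_real (v x ^ i) * G x)))"
        unfolding gN of_real_sum sum_distrib_right by (simp add: mult_ac)
      also have "\<dots> = (\<Sum>i\<le>N. of_real (a i) * (LINT x|M. of_real (v x ^ i) * G x))"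
        using int_pow by (subst Bochner_Integration.integral_sum) (auto intro!: integrable_mult_right simp del: of_real_power)
      also have "\<dots> = 0" by (simp only: moments mult_zero_right sum.neutral_const)
      finally have g0: "(LINT x|M. of_real (g (v x)) * G x) = 0" .
      have int_d: "integrable M (\<lambda>x. of_real (q (v x) - g (v x)) * G x)"
        by (rule int_bdd[of "\<lambda>t. q t - g t" e]) (use g(2) in \<open>auto intro: less_imp_le\<close>)
      have "(LINT x|M. of_real (q (v x)) * G x) = (LINT x|M. of_real (q (v x) - g (v x)) * G x + of_real (g (v x)) * G x)"
        by (simp add: algebra_simps)
      also have "\<dots> = (LINT x|M. of_real (q (v x) - g (v x)) * G x)"
        using int_d int_g g0 by simp
      also have "cmod \<dots> \<le> (LINT x|M. cmod (of_real (q (v x) - g (v x)) * G x))"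
        by (rule integral_norm_bound)
      also have "\<dots> \<le> (LINT x|M. e * cmod (G x))"
      proof (rule integral_mono)
        show "integrable M (\<lambda>x. cmod (of_real (q (v x) - g (v x)) * G x))" using int_d by (rule integrable_norm)
        show "integrable M (\<lambda>x. e * cmod (G x))" using G by auto
        show "cmod (of_real (q (v x) - g (v x)) * G x) \<le> e * cmod (G x)" for x
          using g(2)[OF v01[of x]] by (simp add: norm_mult mult_right_mono del: of_real_diff)
      qed
      finally show ?thesis by simp
    qed
    note * = this
    have "cmod (LINT x|M. of_real (q (v x)) * G x) \<le> 0 + e" if e: "e > 0" for e
    proof -
      \<comment> \<open>The added 1 keeps the divisor positive when \<open>G\<close> vanishes almost
        everywhere.\<close>
      let ?B = "1 + (LINT x|M. cmod (G x))"
      have B: "?B > 0" by (intro add_pos_nonneg Bochner_Integration.integral_nonneg) auto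
      have "cmod (LINT x|M. of_real (q (v x)) * G x) \<le> e / ?B * (LINT x|M. cmod (G x))"
        using *[of "e / ?B"] e B by simp
      also have "\<dots> \<le> e / ?B * ?B" using e B by (intro mult_left_mono) auto
      finally show ?thesis using B by simp
    qed
    then have "cmod (LINT x|M. of_real (q (v x)) * G x) \<le> 0" by (rule field_le_epsilon)
    then show ?thesis by simp
  qed
  \<comment> \<open>Continuous ramps increasing to the indicator of the open half-line: they are 0
    at t = \<theta>, which is why the sublevel set is strict.\<close>
  define q where "q j t = min 1 (real j * max 0 (\<theta> - t))" for j t
  have q_cont: "continuous_on UNIV (q j)" for j unfolding q_def by (intro continuous_intros)
  have q01: "q j t \<ge> 0" "q j t \<le> 1" for j t by (auto simp: q_def)
  have q_lim: "(\<lambda>j. q j t) \<longlonglongrightarrow> indicator {..<\<theta>} t" for t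
  proof (cases "t < \<theta>")
    case True
    have "q j t = 1" if "j \<ge> nat \<lceil>1 / (\<theta> - t)\<rceil>" for j
    proof -
      have "1 / (\<theta> - t) \<le> real j" using that by linarith
      then have "1 \<le> real j * (\<theta> - t)" using True by (simp add: field_simps)
      then show ?thesis using True by (simp add: q_def)
    qed
    then have "\<forall>\<^sub>F j in sequentially. q j t = 1" unfolding eventually_sequentially by blast
    then show ?thesis using True by (simp add: tendsto_eventually)
  qed (auto simp: q_def max_def)
  have [measurable]: "q j \<in> borel_measurable borel" for j by (rule borel_measurable_continuous_onI[OF q_cont])
  have "(\<lambda>j. LINT x|M. of_real (q j (v x)) * G x) \<longlonglongrightarrow> (LINT x|M. of_real (indicator {..<\<theta>} (v x)) * G x)"
  proof (rule integral_dominated_convergence[where w = "\<lambda>x. cmod (G x)"])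
    show "AE x in M. (\<lambda>j. of_real (q j (v x)) * G x) \<longlonglongrightarrow> of_real (indicator {..<\<theta>} (v x)) * G x"
      by (intro AE_I2 tendsto_intros q_lim)
    show "AE x in M. cmod (of_real (q j (v x)) * G x) \<le> cmod (G x)" for j
    proof (rule AE_I2)
      fix x show "cmod (of_real (q j (v x)) * G x) \<le> cmod (G x)"
        using q01[of j "v x"] by (simp add: norm_mult mult_left_le_one_le)
    qed
  qed (use G in auto)
  then have "(\<lambda>j. 0) \<longlonglongrightarrow> (LINT x|M. of_real (indicator {..<\<theta>} (v x)) * G x)"
    by (simp only: cont[OF q_cont])
  then show ?thesis by (simp add: LIMSEQ_const_iff)
qed

section \<open>From vanishing moments to a vanishing symmetrization\<close>

lemma monomial_exp_L2:
  assumes "c > 0" "n \<ge> 1"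
  shows "(\<lambda>x. complex_of_real (x ^ q * exp (- (c * x ^ (2 * n))))) \<in> L2 lborel"
proof -
  have "integrable lborel (\<lambda>x::real. x ^ (2 * q) * exp (- ((2 * c) * x ^ (2 * n))))"
    using integral_power_exp[of "2 * c" n q] assms by (simp add: has_bochner_integral_iff)
  also have "(\<lambda>x::real. x ^ (2 * q) * exp (- ((2 * c) * x ^ (2 * n)))) = 
    (\<lambda>x. (cmod (complex_of_real (x ^ q * exp (- (c * x ^ (2 * n))))))\<^sup>2)"
  proof
    fix x :: real
    have "exp (- ((2 * c) * x ^ (2 * n))) = exp (- (c * x ^ (2 * n))) ^ 2"
      by (simp add: exp_double[symmetric] mult_ac)
    then show "x ^ (2 * q) * exp (- ((2 * c) * x ^ (2 * n))) = (cmod (complex_of_real (x ^ q * exp (- (c * x ^ (2 * n))))))\<^sup>2"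
      by (simp only: norm_of_real power2_abs power_mult_distrib) (simp add: power_mult mult.commute[of 2 q])
  qed
  finally show ?thesis unfolding L2_def by (simp del: of_real_mult of_real_power)
qed

lemma power_sum_le_exp:
  fixes v :: real
  assumes "v \<ge> 0" "finite A"
  shows "(\<Sum>j\<in>A. v ^ j / fact j) \<le> exp v"
proof -
  have "(\<lambda>j. v ^ j / fact j) sums exp v"
    using exp_converges[of v] by (simp add: divide_inverse_commute)
  from sum_le_suminf[OF sums_summable[OF this], of A] sums_unique[OF this] assms
  show ?thesis by simp
qed

text \<open>Each term in the series of exp(-\<delta> x^(2n)) contributes a multiple of a vanishing
  moment. The partial sums are bounded by exp(\<delta> x^(2n)), so \<delta> < c leaves a dominating
  function with decay rate c - \<delta>. As \<open>k\<close> is arbitrary, the conclusion has the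
  form of the hypothesis with c + \<delta>, and the step can be iterated.\<close>

lemma integral_vanish_exp_step:
  fixes f :: "real \<Rightarrow> complex"
  assumes f: "f \<in> L2 lborel" and n: "n \<ge> 1" and \<delta>: "0 < \<delta>" "\<delta> < c"
    and zero: "\<And>k. (LINT x|lborel. f x * of_real (x ^ (p + 2 * n * k) * exp (- (c * x ^ (2 * n))))) = 0"
  shows "(LINT x|lborel. f x * of_real (x ^ (p + 2 * n * k) * exp (- ((c + \<delta>) * x ^ (2 * n))))) = 0"
proof -
  let ?t = "\<lambda>j x. f x * of_real (x ^ (p + 2 * n * (k + j)) * exp (- (c * x ^ (2 * n))))"
  let ?S = "\<lambda>N x. \<Sum>j<N. of_real ((- \<delta>) ^ j / fact j) * ?t j x"
  let ?w = "\<lambda>x. f x * of_real (x ^ (p + 2 * n * k) * exp (- ((c - \<delta>) * x ^ (2 * n))))"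
  have int: "integrable lborel (\<lambda>x. f x * of_real (x ^ q * exp (- (d * x ^ (2 * n)))))" if "d > 0" for d q
    by (rule L2_mult_integrable[OF f monomial_exp_L2]) (use that n in auto)
  have [measurable]: "f \<in> borel_measurable borel" using f by (simp add: L2_def)
  have S_eq: "?S N x = ?t 0 x * of_real (\<Sum>j<N. (- (\<delta> * x ^ (2 * n))) ^ j / fact j)" for N x
    unfolding of_real_sum sum_distrib_left
    by (intro sum.cong refl) (simp add: distrib_left power_add power_mult power_minus[of "\<delta> * _"] power_minus[of \<delta>] power_mult_distrib)
  have "(\<lambda>N. LINT x|lborel. ?S N x) \<longlonglongrightarrow> (LINT x|lborel. f x * of_real (x ^ (p + 2 * n * k) * exp (- ((c + \<delta>) * x ^ (2 * n)))))"
  proof (rule integral_dominated_convergence[where w = "\<lambda>x. cmod (?w x)"])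
    show "integrable lborel (\<lambda>x. cmod (?w x))" using int[of "c - \<delta>"] \<delta> by auto
    show "AE x in lborel. (\<lambda>N. ?S N x) \<longlonglongrightarrow> f x * of_real (x ^ (p + 2 * n * k) * exp (- ((c + \<delta>) * x ^ (2 * n))))"
    proof (rule AE_I2)
      fix x :: real
      have "(\<lambda>j. (- (\<delta> * x ^ (2 * n))) ^ j / fact j) sums exp (- (\<delta> * x ^ (2 * n)))"
        using exp_converges[of "- (\<delta> * x ^ (2 * n))"] by (simp add: field_simps)
      then have "(\<lambda>N. ?S N x) \<longlonglongrightarrow> ?t 0 x * of_real (exp (- (\<delta> * x ^ (2 * n))))"
        unfolding S_eq sums_def by (intro tendsto_intros)
      also have "?t 0 x * of_real (exp (- (\<delta> * x ^ (2 * n)))) = f x * of_real (x ^ (p + 2 * n * k) * (exp (- (c * x ^ (2 * n))) * exp (- (\<delta> * x ^ (2 * n)))))"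
        by simp
      also have "exp (- (c * x ^ (2 * n))) * exp (- (\<delta> * x ^ (2 * n))) = exp (- ((c + \<delta>) * x ^ (2 * n)))"
        by (simp add: exp_add[symmetric] algebra_simps)
      finally show "(\<lambda>N. ?S N x) \<longlonglongrightarrow> f x * of_real (x ^ (p + 2 * n * k) * exp (- ((c + \<delta>) * x ^ (2 * n))))" .
    qed
    show "AE x in lborel. cmod (?S N x) \<le> cmod (?w x)" for N
    proof (rule AE_I2)
      fix x :: real
      let ?y = "\<delta> * x ^ (2 * n)"
      have y: "?y \<ge> 0" using \<delta> by simp
      have "\<bar>\<Sum>j<N. (- ?y) ^ j / fact j\<bar> \<le> (\<Sum>j<N. ?y ^ j / fact j)"
        by (rule order_trans[OF sum_abs])
           (simp only: abs_divide power_abs abs_minus_cancel abs_of_nonneg[OF y] abs_of_nonneg[OF fact_ge_zero] order_refl)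
      also have "\<dots> \<le> exp ?y"
        by (rule power_sum_le_exp) (use y in auto)
      finally have "cmod (?S N x) \<le> cmod (?t 0 x) * exp ?y"
        unfolding S_eq norm_mult norm_of_real by (intro mult_left_mono) auto
      also have "\<dots> = cmod (f x) * \<bar>x ^ (p + 2 * n * k)\<bar> * (exp (- (c * x ^ (2 * n))) * exp ?y)"
        by (simp only: norm_mult norm_of_real abs_mult abs_exp_cancel add_0_right mult_ac)
      also have "exp (- (c * x ^ (2 * n))) * exp ?y = exp (- ((c - \<delta>) * x ^ (2 * n)))"
        by (simp add: exp_add[symmetric] algebra_simps)
      also have "cmod (f x) * \<bar>x ^ (p + 2 * n * k)\<bar> * exp (- ((c - \<delta>) * x ^ (2 * n))) = cmod (?w x)"
        by (simp only: norm_mult norm_of_real abs_mult abs_exp_cancel mult_ac)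
      finally show "cmod (?S N x) \<le> cmod (?w x)" .
    qed
  qed measurable
  moreover have "(LINT x|lborel. ?S N x) = 0" for N
  proof -
    have "(LINT x|lborel. ?S N x) = (\<Sum>j<N. of_real ((- \<delta>) ^ j / fact j) * (LINT x|lborel. ?t j x))"
      using int[of c] \<delta> by (subst Bochner_Integration.integral_sum) (auto intro!: integrable_mult_right simp del: of_real_mult of_real_power)
    also have "\<dots> = 0" by (simp only: zero mult_zero_right sum.neutral_const)
    finally show ?thesis .
  qed
  ultimately have "(\<lambda>N. 0) \<longlonglongrightarrow> (LINT x|lborel. f x * of_real (x ^ (p + 2 * n * k) * exp (- ((c + \<delta>) * x ^ (2 * n)))))"
    by (simp only:)
  then show ?thesis by (simp add: LIMSEQ_const_iff)
qed

text \<open>The test functions are x^p times functions of x^(2n), so they see only the part of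
  \<open>f\<close> with the parity of \<open>p\<close>. Moments against the powers of v =
  exp(-\<delta> x^(2n)) come from iterating \<open>integral_vanish_exp_step\<close>; the sets where
  \<open>v\<close> is small are {|x| > r}, and integrals over all of these determine the
  symmetrization.\<close>

lemma AE_symmetrization_zero:
  fixes f :: "real \<Rightarrow> complex"
  assumes f: "f \<in> L2 lborel" and n: "n \<ge> 1"  and c: "c > 0"
    and zero: "\<And>k. (LINT x|lborel. f x * of_real (x ^ (p + 2 * n * k) * exp (- (c * x ^ (2 * n))))) = 0"
  shows "AE x in lborel. f x + (-1) ^ p * f (- x) = 0"
proof -
  \<comment> \<open>Below c, as the first step requires; it stays fixed while the rate c + m
    \<delta> grows, so the requirement persists in later steps.\<close>
  define \<delta> where "\<delta> = c / 2"
  have \<delta>: "\<delta> > 0" using c by (simp add: \<delta>_def)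
  have zero': "(LINT x|lborel. f x * of_real (x ^ (p + 2 * n * k) * exp (- ((c + real m * \<delta>) * x ^ (2 * n))))) = 0" for m k
  proof (induction m arbitrary: k)
    case 0
    show ?case using zero[of k] by simp
  next
    case (Suc m)
    have "real m * \<delta> \<ge> 0" using \<delta> by simp
    then have "(LINT x|lborel. f x * of_real (x ^ (p + 2 * n * k) * exp (- ((c + real m * \<delta> + \<delta>) * x ^ (2 * n))))) = 0"
      by (intro integral_vanish_exp_step[OF f n \<delta>] Suc.IH) (use c in \<open>auto simp: \<delta>_def intro: add_pos_nonneg\<close>)
    then show ?case by (simp add: algebra_simps)
  qed
  define G where "G x = f x * of_real (x ^ p * exp (- (c * x ^ (2 * n))))" for x
  define v where "v x = exp (- (\<delta> * x ^ (2 * n)))" for x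
  have G: "integrable lborel G" unfolding G_def
    by (rule L2_mult_integrable[OF f monomial_exp_L2]) (use c n in auto)
  have outer: "(LINT x|lborel. indicator {x. \<bar>x\<bar> > r} x *\<^sub>R G x) = 0" if r: "r \<ge> 0" for r
  proof -
    have "(LINT x|lborel. of_real (indicator {..<exp (- (\<delta> * r ^ (2 * n)))} (v x)) * G x) = 0"
    proof (rule integral_sublevel_zero_if_moments_zero[OF G])
      show "v \<in> borel_measurable lborel" unfolding v_def by measurable
      show "v x \<in> {0..1}" for x using \<delta> by (simp add: v_def)
      show "(LINT x|lborel. of_real (v x ^ m) * G x) = 0" for m
      proof -
        have "of_real (v x ^ m) * G x = f x * of_real (x ^ (p + 2 * n * 0) * exp (- ((c + real m * \<delta>) * x ^ (2 * n))))" for x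
        proof -
          have "exp (- ((c + real m * \<delta>) * x ^ (2 * n))) = exp (- (c * x ^ (2 * n))) * v x ^ m"
            by (simp add: v_def exp_of_nat_mult[symmetric] exp_add[symmetric] algebra_simps)
          then show ?thesis by (simp add: G_def)
        qed
        then show ?thesis using zero'[of 0 m] by simp
      qed
    qed
    also have "(\<lambda>x. of_real (indicator {..<exp (- (\<delta> * r ^ (2 * n)))} (v x)) * G x) = (\<lambda>x. indicator {x. \<bar>x\<bar> > r} x *\<^sub>R G x)"
    proof
      fix x :: real
      have "v x < exp (- (\<delta> * r ^ (2 * n))) \<longleftrightarrow> r ^ (2 * n) < \<bar>x\<bar> ^ (2 * n)"
        using \<delta> by (simp add: v_def power_even_abs)
      also have "\<dots> \<longleftrightarrow> r < \<bar>x\<bar>" using r n by (auto intro: power_strict_mono power_less_imp_less_base)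
      finally show "of_real (indicator {..<exp (- (\<delta> * r ^ (2 * n)))} (v x)) * G x = indicator {x. \<bar>x\<bar> > r} x *\<^sub>R G x"
        by (auto simp: indicator_def)
    qed
    finally show ?thesis .
  qed
  \<comment> \<open>The set {|x| > r} is folded onto \<open>{r<..}\<close>, so that integrals over
    rays determine \<open>R\<close>; the cutoff at 0 gives rays with r < 0 the same integral as r =
    0.\<close>
  define R where "R x = indicator {0<..} x *\<^sub>R (G x + G (- x))" for x
  have Gm: "integrable lborel (\<lambda>x. G (- x))"
    using lborel_integrable_real_affine[OF G, of "-1" 0] by simp
  have indG: "integrable lborel (\<lambda>x. indicator A x *\<^sub>R G x)" if "A \<in> sets borel" for A
    by (rule integrable_mult_indicator) (use G that in auto)
  have R0: "(LINT x|lborel. indicator {r<..} x *\<^sub>R R x) = 0" if r: "r \<ge> 0" for r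
  proof -
    have "(LINT x|lborel. indicator {r<..} x *\<^sub>R R x) = 
          (LINT x|lborel. indicator {r<..} x *\<^sub>R G x + indicator {r<..} x *\<^sub>R G (- x))"
      using r by (intro Bochner_Integration.integral_cong) (auto simp: R_def indicator_def)
    also have "\<dots> = (LINT x|lborel. indicator {r<..} x *\<^sub>R G x) + (LINT x|lborel. indicator {r<..} x *\<^sub>R G (- x))"
      by (intro Bochner_Integration.integral_add integrable_mult_indicator) (use G Gm in auto)
    also have "(LINT x|lborel. indicator {r<..} x *\<^sub>R G (- x)) = (LINT x|lborel. indicator {..<-r} x *\<^sub>R G x)"
      by (subst lborel_integral_real_affine[of "-1" _ 0]) 
         (auto intro!: Bochner_Integration.integral_cong simp: indicator_def)
    also have "(LINT x|lborel. indicator {r<..} x *\<^sub>R G x) + (LINT x|lborel. indicator {..<-r} x *\<^sub>R G x) = 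
               (LINT x|lborel. indicator {r<..} x *\<^sub>R G x + indicator {..<-r} x *\<^sub>R G x)"
      by (rule Bochner_Integration.integral_add[symmetric]) (auto intro: indG)
    also have "\<dots> = (LINT x|lborel. indicator {x. \<bar>x\<bar> > r} x *\<^sub>R G x)"
      using r by (intro Bochner_Integration.integral_cong) (auto simp: indicator_def)
    finally show ?thesis using outer[OF r] by simp
  qed
  have "AE x in lborel. R x = 0"
  proof (rule AE_zero_if_integral_greaterThan_zero_complex)
    show "integrable lborel R" unfolding R_def
      by (rule integrable_mult_indicator) (use G Gm in auto)
    show "(LINT x|lborel. indicator {r<..} x *\<^sub>R R x) = 0" for r
    proof (cases "r \<ge> 0")
      case False
      then have "(\<lambda>x. indicator {r<..} x *\<^sub>R R x) = (\<lambda>x. indicator {0<..} x *\<^sub>R R x)"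
        by (auto simp: R_def indicator_def)
      then show ?thesis using R0[of 0] by simp
    qed (rule R0)
  qed
  moreover have "AE x in lborel. R (- x) = 0"
  proof -
    have "AE x in distr lborel borel uminus. R x = 0" using calculation by (subst lborel_distr_uminus)
    then show ?thesis by (subst (asm) AE_distr_iff) (use G Gm in \<open>auto simp: R_def\<close>)
  qed
  \<comment> \<open>The null set {0} is discarded because x^p may vanish there and could not be
    cancelled.\<close>
  ultimately show ?thesis using AE_lborel_singleton[of 0]
  proof eventually_elim
    case (elim x)
    then have "G x + G (- x) = 0" by (cases "x > 0") (auto simp: R_def add.commute)
    moreover have "G x + G (- x) = (f x + (-1) ^ p * f (- x)) * of_real (x ^ p * exp (- (c * x ^ (2 * n))))"
      by (simp add: G_def power_minus[of "x" p] power_minus[of "complex_of_real x" p] algebra_simps)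
    ultimately show ?case using elim by simp
  qed
qed

section \<open>The integral kernels\<close>

definition lag_coeff :: "nat \<Rightarrow> nat \<Rightarrow> nat \<Rightarrow> nat \<Rightarrow> real" where
  "lag_coeff n p k i = (-1) ^ k * sqrt (fact k / (n powr nu n p * Gamma (nu n p + 1 + k))) *
     (((nu n p + k) gchoose (k - i)) * (-1) ^ i / (fact i * real n ^ i))"

lemma lag_fun_expand:
  "lag_fun n p k x = (\<Sum>i\<le>k. lag_coeff n p k i * (x ^ (p + 2 * n * i) * exp (- (1 / (2 * real n) * x ^ (2 * n)))))"
proof -
  have "(\<Sum>i\<le>k. lag_coeff n p k i * (x ^ (p + 2 * n * i) * exp (- (1 / (2 * real n) * x ^ (2 * n))))) = 
    (\<Sum>i\<le>k. (((nu n p + k) gchoose (k - i)) * (- (x ^ (2 * n) / real n)) ^ i / fact i) *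
      ((-1) ^ k * sqrt (fact k / (n powr nu n p * Gamma (nu n p + 1 + k))) * (x ^ p * exp (- (x ^ (2 * n) / (2 * real n))))))"
  proof (intro sum.cong refl)
    fix i
    have "x ^ (p + 2 * n * i) = x ^ p * (x ^ (2 * n)) ^ i" by (simp add: power_add power_mult)
    moreover have "(- (x ^ (2 * n) / real n)) ^ i = (-1) ^ i * ((x ^ (2 * n)) ^ i / real n ^ i)"
      by (simp add: power_minus[of "x ^ (2 * n) / real n"] power_divide)
    ultimately show "lag_coeff n p k i * (x ^ (p + 2 * n * i) * exp (- (1 / (2 * real n) * x ^ (2 * n)))) = 
      (((nu n p + k) gchoose (k - i)) * (- (x ^ (2 * n) / real n)) ^ i / fact i) *
      ((-1) ^ k * sqrt (fact k / (n powr nu n p * Gamma (nu n p + 1 + k))) * (x ^ p * exp (- (x ^ (2 * n) / (2 * real n)))))"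
      by (simp only: lag_coeff_def) (simp add: mult_ac)
  qed
  also have "\<dots> = lag_fun n p k x"
    unfolding sum_distrib_right[symmetric] lag_fun_def laguerre_def by (simp add: mult_ac)
  finally show ?thesis ..
qed

lemma lag_fun_L2:
  assumes n: "n \<ge> 1"
  shows "(\<lambda>x. complex_of_real (lag_fun n p k x)) \<in> L2 lborel"
  unfolding lag_fun_expand of_real_sum of_real_mult[of "lag_coeff n p k _"]
  by (intro L2_sum L2_scale monomial_exp_L2) (use n in auto)

lemma lag_fun_uminus: "lag_fun n p k (- x) = (-1) ^ p * lag_fun n p k x"
  by (simp add: lag_fun_def power_minus[of x p])

text \<open>Triangularity: the k-th Laguerre function combines the monomials with i \<le> k and has
  a nonzero coefficient at i = k, so strong induction isolates the k-th moment.\<close>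

lemma integral_monomials_zero_if_lag_fun:
  fixes f :: "real \<Rightarrow> complex"
  assumes f: "f \<in> L2 lborel" and n: "n \<ge> 1"
    and zero: "\<And>k. (LINT x|lborel. f x * of_real (lag_fun n p k x)) = 0"
  shows "(LINT x|lborel. f x * of_real (x ^ (p + 2 * n * k) * exp (- (1 / (2 * real n) * x ^ (2 * n))))) = 0"
proof (induction k rule: less_induct)
  case (less k)
  define m where "m i = (LINT x|lborel. f x * of_real (x ^ (p + 2 * n * i) * exp (- (1 / (2 * real n) * x ^ (2 * n)))))" for i
  have int: "integrable lborel (\<lambda>x. f x * of_real (x ^ (p + 2 * n * i) * exp (- (1 / (2 * real n) * x ^ (2 * n)))))" for i
    by (rule L2_mult_integrable[OF f monomial_exp_L2]) (use n in auto)
  have G: "Gamma (nu n p + 1 + real k) > 0" using nu_gt[OF n, of p] by (intro Gamma_real_pos) auto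
  have "0 = (LINT x|lborel. f x * of_real (lag_fun n p k x))" by (simp add: zero)
  also have "\<dots> = (LINT x|lborel. (\<Sum>i\<le>k. of_real (lag_coeff n p k i) * (f x * of_real (x ^ (p + 2 * n * i) * exp (- (1 / (2 * real n) * x ^ (2 * n)))))))"
    unfolding lag_fun_expand of_real_sum sum_distrib_left of_real_mult[of "lag_coeff n p k _"] 
    by (simp only: mult.left_commute)
  also have "\<dots> = (\<Sum>i\<le>k. of_real (lag_coeff n p k i) * m i)"
    unfolding m_def using int by (subst Bochner_Integration.integral_sum) (auto intro!: integrable_mult_right simp del: of_real_mult of_real_power)
  also have "\<dots> = (\<Sum>i\<in>{k}. of_real (lag_coeff n p k i) * m i)"
    by (rule sum.mono_neutral_right) (use less.IH in \<open>auto simp: m_def simp del: of_real_mult of_real_power\<close>)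
  finally have "of_real (lag_coeff n p k k) * m k = 0" by simp
  moreover have "lag_coeff n p k k \<noteq> 0" using G n by (simp add: lag_coeff_def)
  ultimately show ?case by (simp add: m_def del: of_real_mult of_real_power)
qed

section \<open>Convergence and growth of the kernel series\<close>

lemma summable_power_over_Gamma:
  fixes s \<nu> :: real
  assumes s: "s \<ge> 0" and \<nu>: "\<nu> > -1"
  shows "summable (\<lambda>l. s ^ l / Gamma (\<nu> + 1 + real l))"
proof (rule summable_ratio_test[where c = "1/2"])
  fix l :: nat assume l: "l \<ge> nat \<lceil>2 * s\<rceil>"
  have "\<nu> + 1 + real l > 0" using \<nu> by simp
  then have pos: "Gamma (\<nu> + 1 + real l) > 0" "\<nu> + 1 + real l > 0" by (auto intro: Gamma_real_pos)
  have G: "Gamma (\<nu> + 1 + real (Suc l)) = (\<nu> + 1 + real l) * Gamma (\<nu> + 1 + real l)"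
    using Gamma_plus1[of "\<nu> + 1 + real l"] pos by (simp add: add_ac nonpos_Ints_def)
  have "2 * s \<le> \<nu> + 1 + real l" using l \<nu> by linarith
  then have "s / (\<nu> + 1 + real l) \<le> 1 / 2" using pos by (simp add: field_simps)
  then have "s / (\<nu> + 1 + real l) * (s ^ l / Gamma (\<nu> + 1 + real l)) \<le> 1 / 2 * (s ^ l / Gamma (\<nu> + 1 + real l))"
    using s pos by (intro mult_right_mono) auto
  then show "norm (s ^ Suc l / Gamma (\<nu> + 1 + real (Suc l))) \<le> 1 / 2 * norm (s ^ l / Gamma (\<nu> + 1 + real l))"
    unfolding G using s pos by (simp add: abs_mult)
qed simp

text \<open>A term of the series in \<open>B\<^sub>1\<close> and \<open>B\<^sub>2\<close>, regrouped
  by 2^l / (2n)^(2l) = (2n)^(-l) n^(-l) into z^p w^l and x^p u^l.\<close>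

definition kterm :: "nat \<Rightarrow> nat \<Rightarrow> complex \<Rightarrow> real \<Rightarrow> nat \<Rightarrow> complex" where
  "kterm n p z x l = z ^ (2 * n * l + p) / of_real ((2 * real n) ^ l * Gamma (nu n p + 1 + l) * fact l) *
     of_real (x ^ p * (x ^ (2 * n) / real n) ^ l)"

text \<open>Up to powers of its arguments, the modified Bessel function I of index \<nu> at 2 sqrt(u
  w).\<close>

definition kpart :: "nat \<Rightarrow> nat \<Rightarrow> complex \<Rightarrow> real \<Rightarrow> complex" where
  "kpart n p z x = (\<Sum>l. kterm n p z x l)"

text \<open>Writing u^l = 4^l (u/4)^l, the factor (u/4)^l / l! is at most exp(u/4), and the
  remaining series \<open>a\<close> converges and does not involve \<open>x\<close>. The exponent
  u/4 is half of that in the decay exp(-u/2) of the kernel, so exp(-u/4) survives.\<close>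

lemma kterm_bound:
  assumes n: "n \<ge> 1"
  obtains D where "\<And>x. summable (\<lambda>l. norm (kterm n p z x l))"
    "\<And>x. (\<Sum>l. norm (kterm n p z x l)) \<le> D * (\<bar>x\<bar> ^ p * exp (x ^ (2 * n) / (4 * real n)))" "D \<ge> 0"
proof -
  define s where "s = 4 * (cmod z ^ (2 * n) / (2 * real n))"
  define a where "a l = s ^ l / Gamma (nu n p + 1 + real l)" for l
  have s: "s \<ge> 0" by (simp add: s_def)
  have a: "summable a" unfolding a_def by (rule summable_power_over_Gamma[OF s nu_gt[OF n]])
  have G: "Gamma (nu n p + 1 + real l) > 0" for l using nu_gt[OF n, of p] by (intro Gamma_real_pos) auto
  have a0: "a l \<ge> 0" for l unfolding a_def using s G[of l] by simp
  define D where "D = cmod z ^ p * suminf a"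
  have bound: "norm (kterm n p z x l) \<le> cmod z ^ p * (\<bar>x\<bar> ^ p * exp (x ^ (2 * n) / (4 * real n))) * a l" for x l
  proof -
    let ?v = "x ^ (2 * n) / (4 * real n)"
    have v: "?v \<ge> 0" by simp
    have e: "?v ^ l / fact l \<le> exp ?v" using power_sum_le_exp[OF v, of "{l}"] by simp
    define u where "u = x ^ (2 * n) / real n"
    define Z where "Z = z ^ (2 * n)"
    define g where "g = Gamma (nu n p + 1 + real l)"
    have u: "u \<ge> 0" "?v = u / 4" by (simp_all add: u_def)
    have g: "g > 0" "g \<noteq> 0" using G[of l] by (simp_all add: g_def)
    have m: "(2 * real n) ^ l > 0" using n by simp
    have "z ^ (2 * n * l + p) = z ^ p * Z ^ l" by (simp add: Z_def power_add power_mult)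
    then have "kterm n p z x l = z ^ p * Z ^ l / of_real ((2 * real n) ^ l * g * fact l) * of_real (x ^ p * u ^ l)"
      unfolding kterm_def g_def u_def by simp
    then have "norm (kterm n p z x l) = cmod z ^ p * cmod Z ^ l / ((2 * real n) ^ l * g * fact l) * (\<bar>x\<bar> ^ p * u ^ l)"
      using g u m by (simp add: norm_mult norm_divide norm_power abs_mult power_abs del: of_real_mult of_real_power)
    also have "\<dots> = cmod z ^ p * \<bar>x\<bar> ^ p * (((4 * (cmod Z / (2 * real n))) ^ l * (u / 4) ^ l) / g / fact l)"
      unfolding power_mult_distrib[symmetric] power_divide[symmetric] 
      using g m by (simp add: power_divide power_mult_distrib)
    also have "\<dots> = cmod z ^ p * \<bar>x\<bar> ^ p * (a l * (?v ^ l / fact l))"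
      by (simp add: a_def s_def g_def u(2) Z_def norm_power)
    also have "\<dots> \<le> cmod z ^ p * \<bar>x\<bar> ^ p * (a l * exp ?v)"
      using e a0 by (intro mult_left_mono) auto
    finally show ?thesis by (simp add: mult_ac)
  qed
  have sb: "summable (\<lambda>l. cmod z ^ p * (\<bar>x\<bar> ^ p * exp (x ^ (2 * n) / (4 * real n))) * a l)" for x
    by (intro summable_mult a)
  have sk: "summable (\<lambda>l. norm (kterm n p z x l))" for x
    by (rule summable_comparison_test'[OF sb[of x], of 0]) (use bound in auto)
  moreover have "(\<Sum>l. norm (kterm n p z x l)) \<le> D * (\<bar>x\<bar> ^ p * exp (x ^ (2 * n) / (4 * real n)))" for x
  proof -
    let ?Q = "cmod z ^ p * (\<bar>x\<bar> ^ p * exp (x ^ (2 * n) / (4 * real n)))"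
    have "(\<Sum>l. norm (kterm n p z x l)) \<le> (\<Sum>l. ?Q * a l)" by (rule suminf_le[OF bound sk sb])
    also have "\<dots> = ?Q * suminf a" by (rule suminf_mult[OF a])
    finally show ?thesis by (simp add: D_def mult_ac)
  qed
  moreover have "D \<ge> 0" unfolding D_def using a0 a by (intro mult_nonneg_nonneg suminf_nonneg) auto
  ultimately show ?thesis by (rule that)
qed

text \<open>The factor exp(-z^(2n) / (2n)) of the kernel is left out: it is constant in
  \<open>x\<close>, and later it cancels the exponential produced by
  \<open>integral_kfun_lag_fun\<close>.\<close>

definition kfun :: "nat \<Rightarrow> nat \<Rightarrow> complex \<Rightarrow> real \<Rightarrow> complex" where
  "kfun n p z x = kpart n p z x * of_real (exp (- (x ^ (2 * n) / (2 * real n))))"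

lemma kfun_measurable [measurable]: 
  assumes "n \<ge> 1"
  shows "kfun n p z \<in> borel_measurable borel"
proof -
  have "kpart n p z \<in> borel_measurable borel"
  proof (rule borel_measurable_LIMSEQ_metric)
    show "(\<lambda>x. \<Sum>l<N. kterm n p z x l) \<in> borel_measurable borel" for N
      unfolding kterm_def by measurable
    show "(\<lambda>N. \<Sum>l<N. kterm n p z x l) \<longlonglongrightarrow> kpart n p z x" for x
      unfolding kpart_def using kterm_bound[OF assms] summable_norm_cancel summable_LIMSEQ by metis
  qed
  then show ?thesis unfolding kfun_def by measurable
qed

lemma exp_quarter:
  "exp (x / (4 * real n)) * exp (- (x / (2 * real n))) = exp (- (1 / (4 * real n) * x))"
  by (cases "n = 0") (simp_all add: exp_add[symmetric] field_simps)

lemma kfun_L2: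
  assumes n: "n \<ge> 1"
  shows "kfun n p z \<in> L2 lborel"
proof -
  obtain D where D: "\<And>x. summable (\<lambda>l. norm (kterm n p z x l))"
    "\<And>x. (\<Sum>l. norm (kterm n p z x l)) \<le> D * (\<bar>x\<bar> ^ p * exp (x ^ (2 * n) / (4 * real n)))" "D \<ge> 0"
    by (rule kterm_bound[OF n]) auto
  let ?w = "\<lambda>x. of_real D * complex_of_real (x ^ p * exp (- (1 / (4 * real n) * x ^ (2 * n))))"
  have w: "?w \<in> L2 lborel" by (intro L2_scale monomial_exp_L2) (use n in auto)
  have le: "cmod (kfun n p z x) \<le> cmod (?w x)" for x
  proof -
    have "cmod (kfun n p z x) = cmod (kpart n p z x) * exp (- (x ^ (2 * n) / (2 * real n)))"
      by (simp add: kfun_def norm_mult)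
    also have "\<dots> \<le> (D * (\<bar>x\<bar> ^ p * exp (x ^ (2 * n) / (4 * real n)))) * exp (- (x ^ (2 * n) / (2 * real n)))"
      unfolding kpart_def using order_trans[OF summable_norm[OF D(1)] D(2)] by (intro mult_right_mono) auto
    also have "\<dots> = D * \<bar>x\<bar> ^ p * exp (- (1 / (4 * real n) * x ^ (2 * n)))"
      unfolding exp_quarter[symmetric] by simp
    finally show ?thesis using D(3) by (simp add: norm_mult power_abs abs_mult norm_power)
  qed
  have "integrable lborel (\<lambda>x. (cmod (kfun n p z x))\<^sup>2)"
  proof (rule Bochner_Integration.integrable_bound[OF L2_integrable[OF w]])
    show "(\<lambda>x. (cmod (kfun n p z x))\<^sup>2) \<in> borel_measurable lborel" using n by measurable
    show "AE x in lborel. norm ((cmod (kfun n p z x))\<^sup>2) \<le> norm ((cmod (?w x))\<^sup>2)"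
      unfolding real_norm_def abs_power2 by (intro AE_I2 power_mono le norm_ge_zero)
  qed
  then show ?thesis using kfun_measurable[OF n] by (simp add: L2_def)
qed

text \<open>For l \<ge> k the term is w^k / k! times w^(l-k) / (l-k)!, and for l < k the binomial
  coefficient is 0: the exponential series shifted by k.\<close>

lemma sums_binomial_exp:
  fixes w :: complex
  shows "(\<lambda>l. w ^ l / fact l * of_nat (l choose k)) sums (w ^ k / fact k * exp w)"
proof -
  have "(\<lambda>l. w ^ k / fact k * (w ^ l / fact l)) sums (w ^ k / fact k * exp w)"
    using exp_converges[of w] by (intro sums_mult) (simp add: scaleR_conv_of_real field_simps)
  also have "(\<lambda>l. w ^ k / fact k * (w ^ l / fact l)) = (\<lambda>l. w ^ (l + k) / fact (l + k) * of_nat ((l + k) choose k))"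
  proof
    fix l
    have "of_nat ((l + k) choose k) = (fact (l + k) / (fact k * fact l) :: complex)"
      using binomial_fact[of k "l + k"] by simp
    then show "w ^ k / fact k * (w ^ l / fact l) = w ^ (l + k) / fact (l + k) * of_nat ((l + k) choose k)"
      by (simp add: power_add mult_ac)
  qed
  finally have "(\<lambda>l. w ^ (l + k) / fact (l + k) * of_nat ((l + k) choose k)) sums (w ^ k / fact k * exp w)" .
  then have "(\<lambda>l. w ^ l / fact l * of_nat (l choose k)) sums 
      (w ^ k / fact k * exp w + (\<Sum>i<k. w ^ i / fact i * of_nat (i choose k)))"
    by (subst (asm) sums_iff_shift)
  moreover have "(\<Sum>i<k. w ^ i / fact i * of_nat (i choose k)) = 0" by (intro sum.neutral) auto
  ultimately show ?thesis by simp
qed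

text \<open>What integration against \<open>lag_fun\<close> produces: its normalising constant times
  n^\<nu> / (k! (2n)^k), simplified under the root.\<close>

definition ecoeff :: "nat \<Rightarrow> nat \<Rightarrow> nat \<Rightarrow> real" where
  "ecoeff n p k = sqrt (n powr nu n p / (Gamma (nu n p + 1 + k) * fact k)) / (2 * real n) ^ k"

text \<open>Termwise integration replaces u^l by a Gamma factor times \<open>l choose k\<close>; the
  Gamma factor cancels the one in \<open>kterm\<close>, and \<open>sums_binomial_exp\<close> sums
  the rest. The estimate of \<open>kterm_bound\<close> dominates the partial sums.\<close>

lemma integral_kfun_lag_fun:
  assumes n: "n \<ge> 1"
  shows "(LINT x|lborel. kfun n p z x * of_real (lag_fun n p k x)) = 
         exp (z ^ (2 * n) / of_nat (2 * n)) * (of_real (ecoeff n p k) * z ^ (2 * n * k + p))"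
proof -
  define w where "w = z ^ (2 * n) / of_nat (2 * n)"
  define C where "C = sqrt (fact k / (n powr nu n p * Gamma (nu n p + 1 + k)))"
  obtain D where D: "\<And>x. summable (\<lambda>l. norm (kterm n p z x l))"
    "\<And>x. (\<Sum>l. norm (kterm n p z x l)) \<le> D * (\<bar>x\<bar> ^ p * exp (x ^ (2 * n) / (4 * real n)))" "D \<ge> 0"
    by (rule kterm_bound[OF n]) auto
  have G: "Gamma (nu n p + 1 + real l) > 0" for l using nu_gt[OF n, of p] by (intro Gamma_real_pos) auto
  let ?E = "\<lambda>x::real. exp (- (x ^ (2 * n) / (2 * real n)))"
  let ?T = "\<lambda>l x. kterm n p z x l * of_real (?E x) * of_real (lag_fun n p k x)"
  let ?b = "\<lambda>l. z ^ (2 * n * l + p) / of_real ((2 * real n) ^ l * Gamma (nu n p + 1 + l) * fact l)"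
  let ?W = "\<lambda>x. of_real D * complex_of_real (x ^ p * exp (- (1 / (4 * real n) * x ^ (2 * n)))) * of_real (lag_fun n p k x)"
  have T: "has_bochner_integral lborel (?T l) (of_real (C * n powr nu n p) * z ^ p * (w ^ l / fact l * of_nat (l choose k)))" for l
  proof -
    have "has_bochner_integral lborel (\<lambda>x. ?b l * complex_of_real (x ^ p * (x ^ (2 * n) / real n) ^ l * exp (- (x ^ (2 * n) / (2 * real n))) * lag_fun n p k x))
       (?b l * of_real (C * (n powr nu n p * Gamma (nu n p + 1 + l) * (l choose k))))"
      unfolding C_def by (intro has_bochner_integral_mult_right has_bochner_integral_of_real integral_monomial_lag_fun n)
    also have "(\<lambda>x. ?b l * complex_of_real (x ^ p * (x ^ (2 * n) / real n) ^ l * exp (- (x ^ (2 * n) / (2 * real n))) * lag_fun n p k x)) = ?T l"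
      by (simp add: kterm_def mult_ac)
    also have "?b l * of_real (C * (n powr nu n p * Gamma (nu n p + 1 + l) * (l choose k))) = 
       of_real (C * n powr nu n p) * z ^ p * (w ^ l / fact l * of_nat (l choose k))"
    proof -
      have "z ^ (2 * n * l + p) = (z ^ (2 * n)) ^ l * z ^ p" by (simp add: power_add power_mult)
      then show ?thesis using G[of l] n by (simp add: w_def power_divide) (simp add: mult_ac)
    qed
    finally show ?thesis .
  qed
  have Wint: "integrable lborel ?W"
    by (intro L2_mult_integrable L2_scale monomial_exp_L2 lag_fun_L2) (use n in auto)
  have [measurable]: "lag_fun n p k \<in> borel_measurable borel" unfolding lag_fun_expand[abs_def] by measurable
  have "(\<lambda>N. LINT x|lborel. (\<Sum>l<N. ?T l x)) \<longlonglongrightarrow> (LINT x|lborel. kfun n p z x * of_real (lag_fun n p k x))"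
  proof (rule integral_dominated_convergence[where w = "\<lambda>x. cmod (?W x)"])
    show "integrable lborel (\<lambda>x. cmod (?W x))" using Wint by (rule integrable_norm)
    show "AE x in lborel. (\<lambda>N. \<Sum>l<N. ?T l x) \<longlonglongrightarrow> kfun n p z x * of_real (lag_fun n p k x)"
    proof (rule AE_I2)
      fix x
      have "(\<lambda>N. \<Sum>l<N. kterm n p z x l) \<longlonglongrightarrow> kpart n p z x"
        unfolding kpart_def by (rule summable_LIMSEQ[OF summable_norm_cancel[OF D(1)]])
      then show "(\<lambda>N. \<Sum>l<N. ?T l x) \<longlonglongrightarrow> kfun n p z x * of_real (lag_fun n p k x)"
        unfolding kfun_def sum_distrib_right[symmetric] by (intro tendsto_intros)
    qed
    show "AE x in lborel. cmod (\<Sum>l<N. ?T l x) \<le> cmod (?W x)" for N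
    proof (rule AE_I2)
      fix x
      have "cmod (\<Sum>l<N. kterm n p z x l) \<le> (\<Sum>l<N. cmod (kterm n p z x l))" by (rule norm_sum)
      also have "\<dots> \<le> (\<Sum>l. norm (kterm n p z x l))" by (rule sum_le_suminf) (use D(1) in auto)
      also note D(2)
      finally have *: "cmod (\<Sum>l<N. kterm n p z x l) \<le> D * (\<bar>x\<bar> ^ p * exp (x ^ (2 * n) / (4 * real n)))" .
      have "cmod (\<Sum>l<N. ?T l x) = cmod (\<Sum>l<N. kterm n p z x l) * ?E x * \<bar>lag_fun n p k x\<bar>"
        unfolding sum_distrib_right[symmetric] by (simp add: norm_mult)
      also have "\<dots> \<le> (D * (\<bar>x\<bar> ^ p * exp (x ^ (2 * n) / (4 * real n)))) * ?E x * \<bar>lag_fun n p k x\<bar>"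
        using * by (intro mult_right_mono) auto
      also have "\<dots> = D * \<bar>x\<bar> ^ p * exp (- (1 / (4 * real n) * x ^ (2 * n))) * \<bar>lag_fun n p k x\<bar>"
        unfolding exp_quarter[symmetric] by simp
      also have "\<dots> = cmod (?W x)" using D(3) by (simp add: norm_mult power_abs abs_mult norm_power)
      finally show "cmod (\<Sum>l<N. ?T l x) \<le> cmod (?W x)" .
    qed
    show "(\<lambda>x. kfun n p z x * of_real (lag_fun n p k x)) \<in> borel_measurable lborel" using n by measurable
    show "(\<lambda>x. \<Sum>l<N. ?T l x) \<in> borel_measurable lborel" for N unfolding kterm_def by measurable
  qed
  moreover have "(LINT x|lborel. (\<Sum>l<N. ?T l x)) = (\<Sum>l<N. of_real (C * n powr nu n p) * z ^ p * (w ^ l / fact l * of_nat (l choose k)))" for N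
    by (rule has_bochner_integral_integral_eq) (intro has_bochner_integral_sum T)
  ultimately have "(\<lambda>l. of_real (C * n powr nu n p) * z ^ p * (w ^ l / fact l * of_nat (l choose k))) sums (LINT x|lborel. kfun n p z x * of_real (lag_fun n p k x))"
    by (simp only: sums_def)
  moreover have "(\<lambda>l. of_real (C * n powr nu n p) * z ^ p * (w ^ l / fact l * of_nat (l choose k))) sums (of_real (C * n powr nu n p) * z ^ p * (w ^ k / fact k * exp w))"
    by (intro sums_mult sums_binomial_exp)
  ultimately have "(LINT x|lborel. kfun n p z x * of_real (lag_fun n p k x)) = of_real (C * n powr nu n p) * z ^ p * (w ^ k / fact k * exp w)"
    by (rule sums_unique2)
  also have "\<dots> = exp w * (of_real (C * n powr nu n p / (fact k * (2 * real n) ^ k)) * z ^ (2 * n * k + p))"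
    using n by (simp add: w_def power_add power_mult power_divide) (simp add: mult_ac)
  also have "C * n powr nu n p / (fact k * (2 * real n) ^ k) = ecoeff n p k"
  proof -
    define P where "P = real n powr nu n p"
    have P: "P > 0" using n by (simp add: P_def)
    have sq: "sqrt P * sqrt P = P" "sqrt (fact k) * sqrt (fact k) = fact k" using P by auto
    then have "C * P / fact k = sqrt (P / (Gamma (nu n p + 1 + k) * fact k))"
      using G[of k] P unfolding C_def P_def[symmetric] real_sqrt_divide real_sqrt_mult 
      by (simp add: field_simps)
    then show ?thesis by (simp add: ecoeff_def P_def field_simps)
  qed
  finally show ?thesis by (simp add: w_def)
qed

lemma kfun_uminus:
  assumes n: "n \<ge> 1"
  shows "kfun n p z (- x) = (-1) ^ p * kfun n p z x"
proof -
  have "summable (kterm n p z x)"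
    by (rule kterm_bound[OF n, of p z]) (rule summable_norm_cancel)
  have "kterm n p z (- x) = (\<lambda>l. (-1) ^ p * kterm n p z x l)"
    by (auto simp: kterm_def power_minus[of x p])
  then have "kpart n p z (- x) = (-1) ^ p * kpart n p z x"
    by (cases "even p") (auto simp: kpart_def suminf_minus \<open>summable (kterm n p z x)\<close>)
  then show ?thesis by (simp add: kfun_def)
qed

section \<open>Mellin transform of \<open>K\<^sub>\<nu>\<close> and radial integration\<close>

lemma Beta_real_nonneg: "x > 0 \<Longrightarrow> y > 0 \<Longrightarrow> Beta x (y :: real) \<ge> 0"
  by (simp add: Beta_def Gamma_real_pos less_imp_le add_pos_pos)

text \<open>The substitution g(t) = 1 / (1 + exp(-2t)) = exp(t) / (2 cosh t) maps the line onto (0,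
  1), with 1 - g(t) = exp(-t) / (2 cosh t) and g' = 2 g (1 - g). Choosing A + B = \<mu> and A - B =
  \<nu> makes the integrand 2^\<mu> g^A (1 - g)^B, so a Beta integral arises.\<close>

lemma nn_integral_exp_cosh:
  fixes \<mu> \<nu> :: real
  assumes "\<bar>\<nu>\<bar> < \<mu>"
  shows "(\<integral>\<^sup>+t. ennreal (exp (\<nu> * t) * cosh t powr (- \<mu>)) \<partial>lborel) = ennreal (2 powr (\<mu> - 1) * Beta ((\<mu> + \<nu>) / 2) ((\<mu> - \<nu>) / 2))"
proof -
  define A where "A = (\<mu> + \<nu>) / 2"
  define B where "B = (\<mu> - \<nu>) / 2"
  have AB: "A > 0" "B > 0" using assms by (auto simp: A_def B_def)
  define g :: "real \<Rightarrow> real" where "g t = 1 / (1 + exp (- 2 * t))" for t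
  define g' where "g' t = 2 * g t * (1 - g t)" for t
  define f :: "real \<Rightarrow> real" where "f x = 2 powr (\<mu> - 1) * (x powr (A - 1) * (1 - x) powr (B - 1))" for x
  have pos: "1 + exp x > 0" for x :: real by (simp add: add_pos_pos)
  have ne: "1 + exp x \<noteq> 0" for x :: real using pos[of x] by simp
  have g01: "0 < g t" "g t < 1" for t using pos[of "- 2 * t"] by (auto simp: g_def)
  have deriv: "(g has_real_derivative g' t) (at t)" for t
    unfolding g_def g'_def by (rule derivative_eq_intros refl ne)+ (use ne in \<open>simp add: field_simps power2_eq_square\<close>)
  have mono: "g s \<le> g t" if "s \<le> t" for s t
    using that pos by (auto simp: g_def intro!: divide_left_mono)
  have U: "(\<Union>i. {g (- real (Suc i))..g (real (Suc i))}) = {0<..<1}"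
  proof (intro equalityI subsetI)
    fix x :: real assume x: "x \<in> {0<..<1}"
    define t where "t = ln (x / (1 - x)) / 2"
    have "exp (- 2 * t) = (1 - x) / x" using x by (simp add: t_def exp_minus)
    then have "1 + exp (- 2 * t) = 1 / x" using x by (simp add: field_simps)
    then have gt: "g t = x" unfolding g_def by simp
    obtain i :: nat where "\<bar>t\<bar> \<le> real i" using real_arch_simple by blast
    then have "g (- real (Suc i)) \<le> x" "x \<le> g (real (Suc i))" unfolding gt[symmetric] by (auto intro!: mono)
    then show "x \<in> (\<Union>i. {g (- real (Suc i))..g (real (Suc i))})" by auto
  next
    fix x assume "x \<in> (\<Union>i. {g (- real (Suc i))..g (real (Suc i))})"
    then obtain i where "g (- real (Suc i)) \<le> x" "x \<le> g (real (Suc i))" by auto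
    with g01[of "- real (Suc i)"] g01[of "real (Suc i)"] show "x \<in> {0<..<1}" by auto
  qed
  have U2: "(\<Union>i. {- real (Suc i)..real (Suc i)}) = UNIV"
  proof -
    have "x \<in> (\<Union>i. {- real (Suc i)..real (Suc i)})" for x
    proof -
      obtain i :: nat where "\<bar>x\<bar> \<le> real i" using real_arch_simple by blast
      then have "x \<in> {- real (Suc i)..real (Suc i)}" by auto
      then show ?thesis by blast
    qed
    then show ?thesis by blast
  qed
  have point: "f (g t) * g' t = exp (\<nu> * t) * cosh t powr (- \<mu>)" for t
  proof -
    have ch: "2 * cosh t > 0" using cosh_real_pos[of t] by simp
    have "exp t * exp (- 2 * t) = exp (- t)" by (simp add: exp_add[symmetric])
    then have "exp t * (1 + exp (- 2 * t)) = 2 * cosh t"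
      by (simp add: cosh_def distrib_left)
    then have g: "g t = exp t / (2 * cosh t)"
      unfolding g_def using pos[of "- 2 * t"] ch by (simp add: field_simps)
    have "2 * cosh t - exp t = exp (- t)" by (simp add: cosh_def field_simps)
    then have g1: "1 - g t = exp (- t) / (2 * cosh t)"
      unfolding g using ch by (simp add: field_simps)
    have "f (g t) * g' t = 2 powr (\<mu> - 1) * 2 * ((g t powr (A - 1) * g t powr 1) * ((1 - g t) powr (B - 1) * (1 - g t) powr 1))"
      unfolding f_def g'_def using g01[of t] by simp
    also have "\<dots> = 2 powr \<mu> * (g t powr A * (1 - g t) powr B)"
      by (simp only: powr_add[symmetric]) (simp add: powr_diff)
    also have "g t powr A * (1 - g t) powr B = exp (t * A) * exp (- t * B) / ((2 * cosh t) powr A * (2 * cosh t) powr B)"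
      unfolding g1 unfolding g using ch by (simp only: powr_divide exp_ge_zero less_imp_le) (simp add: exp_powr_real)
    also have "exp (t * A) * exp (- t * B) = exp (\<nu> * t)"
      by (simp add: exp_add[symmetric] A_def B_def field_simps)
    also have "(2 * cosh t) powr A * (2 * cosh t) powr B = 2 powr \<mu> * cosh t powr \<mu>"
      using ch by (simp add: powr_add[symmetric] powr_mult A_def B_def field_simps)
    finally show ?thesis by (simp add: powr_minus field_simps)
  qed
  have [measurable]: "f \<in> borel_measurable borel" unfolding f_def by measurable
  have "(\<integral>\<^sup>+t. ennreal (exp (\<nu> * t) * cosh t powr (- \<mu>)) \<partial>lborel) = 
        (\<integral>\<^sup>+t. ennreal (f (g t)) * ennreal (g' t) * indicator (\<Union>i. {- real (Suc i)..real (Suc i)}) t \<partial>lborel)"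
    unfolding U2
  proof (rule nn_integral_cong)
    fix t
    have "f (g t) \<ge> 0" "g' t \<ge> 0" using g01[of t] by (auto simp: f_def g'_def)
    then show "ennreal (exp (\<nu> * t) * cosh t powr (- \<mu>)) = ennreal (f (g t)) * ennreal (g' t) * indicator UNIV t"
      by (simp add: ennreal_mult[symmetric] point)
  qed
  also have "\<dots> = (\<integral>\<^sup>+x. ennreal (f x) * indicator (\<Union>i. {g (- real (Suc i))..g (real (Suc i))}) x \<partial>lborel)"
  proof (rule nn_integral_substitution_UN[symmetric])
    have "continuous_on A g" for A
      using deriv by (intro continuous_at_imp_continuous_on ballI) (auto intro: DERIV_isCont)
    then show "continuous_on {- real (Suc i)..real (Suc i)} g'" for i
      unfolding g'_def by (intro continuous_intros) 
    show "0 \<le> g' x" for x using g01[of x] by (simp add: g'_def)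
  qed (use deriv in \<open>auto simp: decseq_def incseq_def\<close>)
  also have "\<dots> = (\<integral>\<^sup>+x. ennreal (2 powr (\<mu> - 1)) * ennreal (indicator {0..1} x * (x powr (A - 1) * (1 - x) powr (B - 1))) \<partial>lborel)"
    unfolding U f_def by (rule nn_integral_cong) (auto simp: indicator_def ennreal_mult)
  also have "\<dots> = ennreal (2 powr (\<mu> - 1)) * ennreal (Beta A B)"
    using nn_integral_has_integral_lebesgue[OF _ has_integral_Beta_real[OF AB]]
    by (subst nn_integral_cmult) (auto simp: mult.commute)
  also have "\<dots> = ennreal (2 powr (\<mu> - 1) * Beta A B)"
    using AB by (intro ennreal_mult[symmetric] Beta_real_nonneg) auto
  finally show ?thesis by (simp add: A_def B_def)
qed

lemma nn_integral_cosh_cosh: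
  fixes \<mu> \<nu> :: real
  assumes "\<bar>\<nu>\<bar> < \<mu>"
  shows "(\<integral>\<^sup>+t. ennreal (cosh (\<nu> * t) * cosh t powr (- \<mu>)) * indicator {0<..} t \<partial>lborel) =
         ennreal (2 powr (\<mu> - 2) * Beta ((\<mu> + \<nu>) / 2) ((\<mu> - \<nu>) / 2))"
proof -
  let ?I = "\<integral>\<^sup>+t. ennreal (cosh (\<nu> * t) * cosh t powr (- \<mu>)) * indicator {0<..} t \<partial>lborel"
  let ?w = "\<lambda>\<nu> t. ennreal (exp (\<nu> * t) * cosh t powr (- \<mu>))"
  have Beta_sym: "Beta x y = Beta y x" for x y :: real by (rule Beta_commute)
  have B_nonneg: "Beta ((\<mu> + \<nu>) / 2) ((\<mu> - \<nu>) / 2) \<ge> 0"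
    using assms by (intro Beta_real_nonneg) auto
  \<comment> \<open>Evenness and the two exponentials in cosh each contribute a factor 2; they are
    kept as a factor 4 on the left and cancelled at the end.\<close>
  have "4 * ?I = 2 * (2 * ?I)" by (simp add: mult.assoc[symmetric])
  also have "2 * ?I = (\<integral>\<^sup>+t. ennreal (cosh (\<nu> * t) * cosh t powr (- \<mu>)) \<partial>lborel)"
    by (rule nn_integral_even[symmetric]) (auto simp: cosh_def add.commute)
  also have "2 * \<dots> = (\<integral>\<^sup>+t. 2 * ennreal (cosh (\<nu> * t) * cosh t powr (- \<mu>)) \<partial>lborel)"
    by (rule nn_integral_cmult[symmetric]) (auto simp: cosh_def)
  also have "\<dots> = (\<integral>\<^sup>+t. ?w \<nu> t + ?w (- \<nu>) t \<partial>lborel)"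
  proof (rule nn_integral_cong)
    fix t
    have "2 * ennreal (cosh (\<nu> * t) * cosh t powr (- \<mu>)) = ennreal (2 * (cosh (\<nu> * t) * cosh t powr (- \<mu>)))"
      using ennreal_mult[of 2 "cosh (\<nu> * t) * cosh t powr (- \<mu>)"] by (simp add: cosh_real_nonneg)
    also have "2 * (cosh (\<nu> * t) * cosh t powr (- \<mu>)) = exp (\<nu> * t) * cosh t powr (- \<mu>) + exp (- \<nu> * t) * cosh t powr (- \<mu>)"
      by (simp add: cosh_def[of "\<nu> * t"] field_simps)
    finally show "2 * ennreal (cosh (\<nu> * t) * cosh t powr (- \<mu>)) = ?w \<nu> t + ?w (- \<nu>) t"
      by (simp add: ennreal_plus)
  qed
  also have "\<dots> = (\<integral>\<^sup>+t. ?w \<nu> t \<partial>lborel) + (\<integral>\<^sup>+t. ?w (- \<nu>) t \<partial>lborel)"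
    by (rule nn_integral_add) (auto simp: cosh_def)
  also have "\<dots> = ennreal (2 * (2 powr (\<mu> - 1) * Beta ((\<mu> + \<nu>) / 2) ((\<mu> - \<nu>) / 2)))"
    using assms B_nonneg nn_integral_exp_cosh[of \<nu> \<mu>] nn_integral_exp_cosh[of "- \<nu>" \<mu>] Beta_sym[of "(\<mu> - \<nu>) / 2"]
    by (simp add: ennreal_plus[symmetric] del: ennreal_plus)
  also have "2 * (2 powr (\<mu> - 1) * Beta ((\<mu> + \<nu>) / 2) ((\<mu> - \<nu>) / 2)) = 4 * (2 powr (\<mu> - 2) * Beta ((\<mu> + \<nu>) / 2) ((\<mu> - \<nu>) / 2))"
    by (simp add: powr_diff)
  also have "ennreal \<dots> = 4 * ennreal (2 powr (\<mu> - 2) * Beta ((\<mu> + \<nu>) / 2) ((\<mu> - \<nu>) / 2))"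
    using B_nonneg ennreal_mult[of 4 "2 powr (\<mu> - 2) * Beta ((\<mu> + \<nu>) / 2) ((\<mu> - \<nu>) / 2)"] by simp
  finally show ?thesis by (simp add: ennreal_mult_cancel_left)
qed

lemma borel_measurable_bessel_K [measurable]: "bessel_K \<nu> \<in> borel_measurable borel"
proof -
  have [measurable]: "cosh \<in> borel_measurable (borel :: real measure)" unfolding cosh_def[abs_def] by measurable
  show ?thesis unfolding bessel_K_def[abs_def] set_lebesgue_integral_def by measurable
qed

lemma bessel_K_nonneg: "bessel_K \<nu> x \<ge> 0"
  unfolding bessel_K_def set_lebesgue_integral_def
  by (rule Bochner_Integration.integral_nonneg) (auto simp: cosh_real_nonneg)

text \<open>Tonelli: the integral of y^(\<mu>-1) exp(-y cosh t) over y is \<Gamma>(\<mu>) (cosh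
  t)^(-\<mu>), the integral over t is then a Beta value, and \<Gamma>(\<mu>) cancels its
  denominator.\<close>

lemma nn_integral_mellin_bessel_K:
  fixes \<mu> \<nu> :: real
  assumes "\<bar>\<nu>\<bar> < \<mu>"
  shows "(\<integral>\<^sup>+y. ennreal (y powr (\<mu> - 1)) * ennreal (bessel_K \<nu> y) * indicator {0<..} y \<partial>lborel) =
         ennreal (2 powr (\<mu> - 2) * Gamma ((\<mu> + \<nu>) / 2) * Gamma ((\<mu> - \<nu>) / 2))"
proof -
  have [measurable]: "cosh \<in> borel_measurable (borel :: real measure)" unfolding cosh_def[abs_def] by measurable
  \<comment> \<open>The integral of \<open>bessel_K\<close> with values in \<open>ennreal\<close>,
    where Tonelli applies and divergence shows as infinity rather than as a default value.\<close>
  define k :: "real \<Rightarrow> ennreal" where 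
    "k y = (\<integral>\<^sup>+t. ennreal (indicator {0<..} t * (exp (- y * cosh t) * cosh (\<nu> * t))) \<partial>lborel)" for y
  have [measurable]: "k \<in> borel_measurable borel" unfolding k_def[abs_def] by measurable
  have G: "Gamma \<mu> > 0" using assms by (intro Gamma_real_pos) auto
  have "(\<integral>\<^sup>+y. ennreal (y powr (\<mu> - 1)) * k y * indicator {0<..} y \<partial>lborel) =
        (\<integral>\<^sup>+y. \<integral>\<^sup>+t. ennreal (y powr (\<mu> - 1)) * ennreal (indicator {0<..} t * (exp (- y * cosh t) * cosh (\<nu> * t))) * indicator {0<..} y \<partial>lborel \<partial>lborel)"
    unfolding k_def by (simp add: nn_integral_cmult nn_integral_multc)
  also have "\<dots> = (\<integral>\<^sup>+t. \<integral>\<^sup>+y. ennreal (y powr (\<mu> - 1)) * ennreal (indicator {0<..} t * (exp (- y * cosh t) * cosh (\<nu> * t))) * indicator {0<..} y \<partial>lborel \<partial>lborel)"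
    by (rule lborel_pair.Fubini') measurable
  also have "\<dots> = (\<integral>\<^sup>+t. ennreal (Gamma \<mu>) * (ennreal (cosh (\<nu> * t) * cosh t powr (- \<mu>)) * indicator {0<..} t) \<partial>lborel)"
  proof (rule nn_integral_cong)
    fix t :: real
    have "(\<integral>\<^sup>+y. ennreal (y powr (\<mu> - 1)) * ennreal (indicator {0<..} t * (exp (- y * cosh t) * cosh (\<nu> * t))) * indicator {0<..} y \<partial>lborel) =
       (\<integral>\<^sup>+y. ennreal (cosh (\<nu> * t)) * indicator {0<..} t * (ennreal (y powr (\<mu> - 1)) * ennreal (exp (- (cosh t * y powr 1))) * indicator {0<..} y) \<partial>lborel)"
      by (rule nn_integral_cong) (auto simp: indicator_def ennreal_mult cosh_real_nonneg mult_ac)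
    also have "\<dots> = ennreal (cosh (\<nu> * t)) * indicator {0<..} t * (\<integral>\<^sup>+y. ennreal (y powr (\<mu> - 1)) * ennreal (exp (- (cosh t * y powr 1))) * indicator {0<..} y \<partial>lborel)"
      by (rule nn_integral_cmult) measurable
    also have "(\<integral>\<^sup>+y. ennreal (y powr (\<mu> - 1)) * ennreal (exp (- (cosh t * y powr 1))) * indicator {0<..} y \<partial>lborel) =
       ennreal (cosh t powr (- \<mu> / 1) / 1) * (\<integral>\<^sup>+y. ennreal (y powr (\<mu> / 1 - 1)) * ennreal (exp (- y)) * indicator {0<..} y \<partial>lborel)"
      by (rule nn_integral_mellin_powr) (auto simp: cosh_real_pos)
    also have "(\<integral>\<^sup>+y. ennreal (y powr (\<mu> / 1 - 1)) * ennreal (exp (- y)) * indicator {0<..} y \<partial>lborel) = ennreal (Gamma \<mu>)"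
      using nn_integral_Gamma[of \<mu>] assms by simp
    finally show "(\<integral>\<^sup>+y. ennreal (y powr (\<mu> - 1)) * ennreal (indicator {0<..} t * (exp (- y * cosh t) * cosh (\<nu> * t))) * indicator {0<..} y \<partial>lborel) = 
      ennreal (Gamma \<mu>) * (ennreal (cosh (\<nu> * t) * cosh t powr (- \<mu>)) * indicator {0<..} t)"
      by (simp add: ennreal_mult cosh_real_nonneg mult_ac)
  qed
  also have "\<dots> = ennreal (Gamma \<mu>) * ennreal (2 powr (\<mu> - 2) * Beta ((\<mu> + \<nu>) / 2) ((\<mu> - \<nu>) / 2))"
    using nn_integral_cosh_cosh[OF assms] by (subst nn_integral_cmult) auto
  also have "\<dots> = ennreal (Gamma \<mu> * (2 powr (\<mu> - 2) * Beta ((\<mu> + \<nu>) / 2) ((\<mu> - \<nu>) / 2)))"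
    using G assms by (intro ennreal_mult[symmetric] mult_nonneg_nonneg Beta_real_nonneg) auto
  also have "Gamma \<mu> * (2 powr (\<mu> - 2) * Beta ((\<mu> + \<nu>) / 2) ((\<mu> - \<nu>) / 2)) = 2 powr (\<mu> - 2) * Gamma ((\<mu> + \<nu>) / 2) * Gamma ((\<mu> - \<nu>) / 2)"
  proof -
    have "(\<mu> + \<nu>) / 2 + (\<mu> - \<nu>) / 2 = \<mu>" by (simp add: field_simps)
    then show ?thesis using G by (simp add: Beta_def)
  qed
  finally have mellin: "(\<integral>\<^sup>+y. ennreal (y powr (\<mu> - 1)) * k y * indicator {0<..} y \<partial>lborel) =
     ennreal (2 powr (\<mu> - 2) * Gamma ((\<mu> + \<nu>) / 2) * Gamma ((\<mu> - \<nu>) / 2))" .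
  \<comment> \<open>Finiteness of the Mellin integral makes \<open>k y\<close> finite for almost
    every y > 0; there the Bochner integral in \<open>bessel_K\<close> converges and equals
    \<open>k y\<close>.\<close>
  have "AE y in lborel. ennreal (y powr (\<mu> - 1)) * k y * indicator {0<..} y \<noteq> \<infinity>"
    by (rule nn_integral_PInf_AE) (auto simp: mellin)
  then have "AE y in lborel. ennreal (y powr (\<mu> - 1)) * ennreal (bessel_K \<nu> y) * indicator {0<..} y = 
     ennreal (y powr (\<mu> - 1)) * k y * indicator {0<..} y"
  proof eventually_elim
    case (elim y)
    show ?case
    proof (cases "y > 0")
      case True
      with elim have fin: "k y \<noteq> \<infinity>" by (auto simp: ennreal_mult_eq_top_iff)
      have "bessel_K \<nu> y = (LINT t|lborel. indicator {0<..} t * (exp (- y * cosh t) * cosh (\<nu> * t)))"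
        by (simp add: bessel_K_def set_lebesgue_integral_def)
      moreover have "k y = ennreal (LINT t|lborel. indicator {0<..} t * (exp (- y * cosh t) * cosh (\<nu> * t)))"
        unfolding k_def
        by (intro nn_integral_eq_integral integrableI_nonneg)
           (use fin in \<open>auto simp: k_def cosh_real_nonneg less_top\<close>)
      ultimately show ?thesis by simp
    qed auto
  qed
  then show ?thesis unfolding mellin[symmetric] by (rule nn_integral_cong_AE)
qed

text \<open>The disc |z|^2 < s has area \<pi> s, so the image of Lebesgue measure under |z|^2 is
  \<pi> ds on the half-line.\<close>

lemma nn_integral_radial:
  fixes \<phi> :: "real \<Rightarrow> ennreal"
  assumes [measurable]: "\<phi> \<in> borel_measurable borel"
  shows "(\<integral>\<^sup>+z. \<phi> ((cmod z)\<^sup>2) \<partial>lborel) = ennreal pi * (\<integral>\<^sup>+s. \<phi> s * indicator {0<..} s \<partial>lborel)"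
proof -
  \<comment> \<open>The sign is reversed because the measures are compared on upper rays, which must
    have finite measure: the preimage of \<open>{x<..}\<close> under -|z|^2 is a disc or
    empty.\<close>
  have "distr lborel borel (\<lambda>z::complex. - (cmod z)\<^sup>2) = density lborel (\<lambda>s. ennreal pi * indicator {..0} s)"
  proof (rule measure_eqI_lessThan)
    fix x :: real
    have vim: "(\<lambda>z::complex. - (cmod z)\<^sup>2) -` {x<..} = (if x < 0 then ball 0 (sqrt (- x)) else {})"
    proof (cases "x < 0")
      case True
      have "- (cmod z)\<^sup>2 > x \<longleftrightarrow> cmod z < sqrt (- x)" for z
        using power_strict_mono[of "cmod z" "sqrt (- x)" 2] real_sqrt_less_mono[of "(cmod z)\<^sup>2" "-x"] True by auto
      then show ?thesis using True by (auto simp: dist_norm)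
    next
      case False
      have "\<not> x < - (cmod z)\<^sup>2" for z using False zero_le_power2[of "cmod z"] by linarith
      then show ?thesis using False by auto
    qed
    have L: "emeasure (distr lborel borel (\<lambda>z::complex. - (cmod z)\<^sup>2)) {x<..} = ennreal (pi * max 0 (- x))"
      by (subst emeasure_distr) (auto simp: vim emeasure_ball eval_unit_ball_vol)
    have "emeasure (density lborel (\<lambda>s. ennreal pi * indicator {..0} s)) {x<..} = 
          (\<integral>\<^sup>+s. ennreal pi * indicator {x<..0} s \<partial>lborel)"
      by (subst emeasure_density) (auto intro!: nn_integral_cong simp: indicator_def)
    also have "\<dots> = ennreal (pi * max 0 (- x))"
      by (subst nn_integral_cmult_indicator) (auto simp: ennreal_mult max_def)
    finally show "emeasure (distr lborel borel (\<lambda>z::complex. - (cmod z)\<^sup>2)) {x<..} = 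
       emeasure (density lborel (\<lambda>s. ennreal pi * indicator {..0} s)) {x<..}" using L by simp
    show "emeasure (distr lborel borel (\<lambda>z::complex. - (cmod z)\<^sup>2)) {x<..} < \<infinity>" using L by simp
  qed auto
  then have "(\<integral>\<^sup>+s. \<phi> (- s) \<partial>distr lborel borel (\<lambda>z::complex. - (cmod z)\<^sup>2)) = 
     (\<integral>\<^sup>+s. \<phi> (- s) \<partial>density lborel (\<lambda>s. ennreal pi * indicator {..0} s))" by simp
  then have "(\<integral>\<^sup>+z. \<phi> ((cmod z)\<^sup>2) \<partial>lborel) = (\<integral>\<^sup>+s. ennreal pi * indicator {..0} s * \<phi> (- s) \<partial>lborel)"
    by (simp add: nn_integral_distr nn_integral_density)
  also have "\<dots> = (\<integral>\<^sup>+s. ennreal pi * indicator {0..} s * \<phi> s \<partial>lborel)"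
    by (subst nn_integral_real_affine[of _ "-1" 0]) (auto intro!: nn_integral_cong simp: indicator_def)
  also have "\<dots> = (\<integral>\<^sup>+s. ennreal pi * (\<phi> s * indicator {0<..} s) \<partial>lborel)"
    by (rule nn_integral_cong_AE, rule eventually_mono[OF AE_lborel_singleton[of 0]]) (auto simp: indicator_def)
  also have "\<dots> = ennreal pi * (\<integral>\<^sup>+s. \<phi> s * indicator {0<..} s \<partial>lborel)"
    by (rule nn_integral_cmult) auto
  finally show ?thesis .
qed

section \<open>Rotation invariance of area and orthogonality of monomials\<close>

lemma nn_integral_lborel_shift:
  fixes f :: "complex \<Rightarrow> ennreal"
  assumes [measurable]: "f \<in> borel_measurable borel"
  shows "(\<integral>\<^sup>+x. f (x + c) \<partial>lborel) = (\<integral>\<^sup>+x. f x \<partial>lborel)"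
proof -
  have "(\<integral>\<^sup>+x. f x \<partial>distr lborel borel ((+) c)) = (\<integral>\<^sup>+x. f (x + c) \<partial>lborel)"
    by (subst nn_integral_distr) (auto simp: add.commute)
  then show ?thesis unfolding lborel_distr_plus by simp
qed

lemma nn_integral_lborel_reflect:
  fixes f :: "complex \<Rightarrow> ennreal"
  assumes [measurable]: "f \<in> borel_measurable borel"
  shows "(\<integral>\<^sup>+x. f (c - x) \<partial>lborel) = (\<integral>\<^sup>+x. f x \<partial>lborel)"
proof -
  have "(\<integral>\<^sup>+x. f x \<partial>lborel) = (\<integral>\<^sup>+x. f x \<partial>density (distr lborel borel (\<lambda>x. c + (-1) *\<^sub>R x)) (\<lambda>_. ennreal (\<bar>-1::real\<bar> ^ DIM(complex))))"
    by (subst lborel_affine[of "-1" c]) auto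
  then show ?thesis by (simp add: nn_integral_density nn_integral_distr)
qed

text \<open>Any translation-invariant Borel measure giving the unit disc its usual area is Lebesgue
  measure; the proof compares the two by Fubini and applies this to the rotated measure.\<close>
lemma lborel_distr_rotate:
  fixes \<omega> :: complex
  assumes \<omega>: "cmod \<omega> = 1"
  shows "distr lborel borel ((*) \<omega>) = lborel"
proof (rule measure_eqI)
  fix A :: "complex set" assume "A \<in> sets (distr lborel borel ((*) \<omega>))"
  then have [measurable]: "A \<in> sets borel" by simp
  define f :: "complex \<Rightarrow> ennreal" where "f = indicator A"
  \<comment> \<open>The unit disc is the comparison set: it is invariant under rotation, and its
    area is positive and finite, so it can be cancelled.\<close>
  define g :: "complex \<Rightarrow> ennreal" where "g = indicator (ball 0 1)"
  have [measurable]: "f \<in> borel_measurable borel" "g \<in> borel_measurable borel"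
    by (auto simp: f_def g_def intro!: borel_measurable_indicator)
  have \<omega>0: "\<omega> * cnj \<omega> = 1" using complex_norm_square[of \<omega>] \<omega> by simp
  have g\<omega>: "g (\<omega> * x) = g x" for x by (simp add: g_def indicator_def norm_mult \<omega>)
  let ?g = "\<integral>\<^sup>+y. g y \<partial>lborel"
  have g_val: "?g = ennreal pi" by (simp add: g_def emeasure_ball eval_unit_ball_vol)
  have "(\<integral>\<^sup>+x. f (\<omega> * x) \<partial>lborel) * ?g = (\<integral>\<^sup>+x. \<integral>\<^sup>+y. f (\<omega> * x) * g (y + \<omega> * x) \<partial>lborel \<partial>lborel)"
    by (simp add: nn_integral_cmult nn_integral_multc nn_integral_lborel_shift)
  also have "\<dots> = (\<integral>\<^sup>+y. \<integral>\<^sup>+x. f (\<omega> * x) * g (y + \<omega> * x) \<partial>lborel \<partial>lborel)"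
    by (rule lborel_pair.Fubini') measurable
  also have "\<dots> = (\<integral>\<^sup>+y. \<integral>\<^sup>+x. f (\<omega> * x - y) * g x \<partial>lborel \<partial>lborel)"
  proof (rule nn_integral_cong)
    \<comment> \<open>Translating by cnj \<omega> y moves \<open>y\<close> from \<open>g\<close> to
      \<open>f\<close>, since \<omega> cnj \<omega> = 1; rotation invariance of \<open>g\<close>
      then removes \<omega> from it.\<close>
    fix y
    have "(\<integral>\<^sup>+x. f (\<omega> * x) * g (y + \<omega> * x) \<partial>lborel) = (\<integral>\<^sup>+x. f (\<omega> * (x + - (cnj \<omega> * y))) * g (y + \<omega> * (x + - (cnj \<omega> * y))) \<partial>lborel)"
      by (rule nn_integral_lborel_shift[symmetric]) measurable
    also have "\<dots> = (\<integral>\<^sup>+x. f (\<omega> * x - y) * g x \<partial>lborel)"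
    proof (rule nn_integral_cong)
      fix x
      have "\<omega> * (x + - (cnj \<omega> * y)) = \<omega> * x - (\<omega> * cnj \<omega>) * y" by (simp add: algebra_simps)
      then have "\<omega> * (x + - (cnj \<omega> * y)) = \<omega> * x - y" using \<omega>0 by simp
      then show "f (\<omega> * (x + - (cnj \<omega> * y))) * g (y + \<omega> * (x + - (cnj \<omega> * y))) = f (\<omega> * x - y) * g x"
        by (simp add: g\<omega>)
    qed
    finally show "(\<integral>\<^sup>+x. f (\<omega> * x) * g (y + \<omega> * x) \<partial>lborel) = (\<integral>\<^sup>+x. f (\<omega> * x - y) * g x \<partial>lborel)" .
  qed
  also have "\<dots> = (\<integral>\<^sup>+x. \<integral>\<^sup>+y. f (\<omega> * x - y) * g x \<partial>lborel \<partial>lborel)"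
    by (rule lborel_pair.Fubini') measurable
  also have "\<dots> = (\<integral>\<^sup>+x. f x \<partial>lborel) * ?g"
    by (simp add: nn_integral_cmult nn_integral_multc nn_integral_lborel_reflect)
  finally have "(\<integral>\<^sup>+x. f (\<omega> * x) \<partial>lborel) * ennreal pi = (\<integral>\<^sup>+x. f x \<partial>lborel) * ennreal pi" 
    unfolding g_val .
  then have eq: "(\<integral>\<^sup>+x. f (\<omega> * x) \<partial>lborel) = (\<integral>\<^sup>+x. f x \<partial>lborel)"
    by (simp add: mult.commute[of _ "ennreal pi"] ennreal_mult_cancel_left)
  have "emeasure (distr lborel borel ((*) \<omega>)) A = (\<integral>\<^sup>+x. f x \<partial>distr lborel borel ((*) \<omega>))" by (simp add: f_def)
  also have "\<dots> = (\<integral>\<^sup>+x. f (\<omega> * x) \<partial>lborel)" by (rule nn_integral_distr) auto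
  also have "\<dots> = emeasure lborel A" unfolding eq by (simp add: f_def)
  finally show "emeasure (distr lborel borel ((*) \<omega>)) A = emeasure lborel A" .
qed auto

text \<open>With (i - j) t = \<pi>, rotation by the angle \<open>t\<close> preserves area and the
  radial factor and multiplies the product of the monomials by -1, so the integral equals its
  negative.\<close>

lemma integral_monomials_radial_orthogonal:
  fixes r :: "real \<Rightarrow> real"
  assumes [measurable]: "r \<in> borel_measurable borel" and ij: "i \<noteq> j"
  shows "(LINT z|lborel. z ^ i * cnj (z ^ j) * of_real (r (cmod z))) = 0"
proof -
  define F where "F z = z ^ i * cnj (z ^ j) * of_real (r (cmod z))" for z
  have [measurable]: "F \<in> borel_measurable borel" unfolding F_def by measurable
  define t where "t = pi / (real i - real j)"
  have t: "(real i - real j) * t = pi" using ij by (simp add: t_def)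
  have "cis t ^ i * cnj (cis t ^ j) = cis (real i * t + - (real j * t))"
    by (simp only: Complex.DeMoivre cis_cnj cis_mult)
  also have "real i * t + - (real j * t) = pi" using t by (simp add: left_diff_distrib)
  finally have c: "cis t ^ i * cnj (cis t ^ j) = -1" by simp
  have "(LINT z|lborel. F z) = (LINT z|distr lborel borel ((*) (cis t)). F z)"
    by (simp add: lborel_distr_rotate)
  also have "\<dots> = (LINT z|lborel. F (cis t * z))" by (rule integral_distr) auto
  also have "\<dots> = (LINT z|lborel. (cis t ^ i * cnj (cis t ^ j)) * F z)"
    by (simp add: F_def norm_mult power_mult_distrib mult_ac)
  also have "\<dots> = - (LINT z|lborel. F z)" by (simp add: c del: complex_cnj_power)
  finally have "(LINT z|lborel. F z) = - (LINT z|lborel. F z)" .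
  then have "2 * (LINT z|lborel. F z) = 0" by (metis add.left_inverse mult_2)
  then show ?thesis by (simp add: F_def)
qed

section \<open>Unitarity\<close>

text \<open>The moments are prescribed as nonnegative integrals with finite values, so they yield
  square-integrability and unit norm at once.\<close>

lemma orthonormal_monomials:
  fixes r :: "real \<Rightarrow> real" and d :: "nat \<Rightarrow> nat" and \<kappa> :: "nat \<Rightarrow> real"
  assumes r [measurable]: "r \<in> borel_measurable borel" and nonneg: "\<And>t. r t \<ge> 0"
    and d: "inj d" and \<kappa>: "\<And>l. \<kappa> l \<noteq> 0"
    and moment: "\<And>l. (\<integral>\<^sup>+z. ennreal ((cmod z) ^ (2 * d l) * r (cmod z)) \<partial>lborel) = ennreal (1 / (\<kappa> l)\<^sup>2)"
  shows "orthonormal_seq (density lborel (\<lambda>z. ennreal (r (cmod z)))) (\<lambda>l z. of_real (\<kappa> l) * z ^ d l)"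
  unfolding orthonormal_seq_def
proof (intro conjI allI)
  let ?D = "density lborel (\<lambda>z. ennreal (r (cmod z)))"
  let ?e = "\<lambda>l z. complex_of_real (\<kappa> l) * z ^ d l"
  have nn: "(\<integral>\<^sup>+z. ennreal ((cmod (?e l z))\<^sup>2) \<partial>?D) = 1" for l
  proof -
    have "(\<integral>\<^sup>+z. ennreal ((cmod (?e l z))\<^sup>2) \<partial>?D) = (\<integral>\<^sup>+z. ennreal ((\<kappa> l)\<^sup>2) * ennreal ((cmod z) ^ (2 * d l) * r (cmod z)) \<partial>lborel)"
    proof (subst nn_integral_density)
      show "(\<integral>\<^sup>+z. ennreal (r (cmod z)) * ennreal ((cmod (?e l z))\<^sup>2) \<partial>lborel) =
        (\<integral>\<^sup>+z. ennreal ((\<kappa> l)\<^sup>2) * ennreal ((cmod z) ^ (2 * d l) * r (cmod z)) \<partial>lborel)"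
      proof (rule nn_integral_cong)
        fix z
        have "(cmod (?e l z))\<^sup>2 = (\<kappa> l)\<^sup>2 * (cmod z) ^ (2 * d l)"
          by (simp add: norm_mult norm_power power_mult_distrib power_mult[symmetric] mult.commute)
        then show "ennreal (r (cmod z)) * ennreal ((cmod (?e l z))\<^sup>2) = ennreal ((\<kappa> l)\<^sup>2) * ennreal ((cmod z) ^ (2 * d l) * r (cmod z))"
          using nonneg by (simp add: ennreal_mult[symmetric] mult_ac)
      qed
    qed auto
    also have "\<dots> = ennreal ((\<kappa> l)\<^sup>2) * ennreal (1 / (\<kappa> l)\<^sup>2)"
      by (subst nn_integral_cmult) (simp_all add: moment)
    also have "\<dots> = 1" using \<kappa>[of l] by (simp add: ennreal_mult[symmetric])
    finally show ?thesis .
  qed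
  show L2: "?e l \<in> L2 ?D" for l
    by (rule L2_I_nn) (auto simp: nn)
  show "ip ?D (?e i) (?e j) = (if i = j then 1 else 0)" for i j
  proof (cases "i = j")
    case True
    have "ennreal (nsq ?D (?e i)) = ennreal 1"
      using nn[of i] unfolding nsq_nn_integral[OF L2] by simp
    then have "nsq ?D (?e i) = 1" by (subst (asm) ennreal_inj) auto
    then show ?thesis using True by (simp add: ip_self)
  next
    case False
    then have "d i \<noteq> d j" using d by (auto dest: injD)
    have "ip ?D (?e i) (?e j) = (LINT z|lborel. r (cmod z) *\<^sub>R (?e i z * cnj (?e j z)))"
      unfolding ip_def by (rule integral_density) (auto simp: nonneg)
    also have "\<dots> = (LINT z|lborel. of_real (\<kappa> i * \<kappa> j) * (z ^ d i * cnj (z ^ d j) * of_real (r (cmod z))))"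
      by (simp add: scaleR_conv_of_real mult_ac)
    also have "\<dots> = of_real (\<kappa> i * \<kappa> j) * (LINT z|lborel. z ^ d i * cnj (z ^ d j) * of_real (r (cmod z)))"
      by (rule integral_mult_right_zero)
    also have "\<dots> = 0" using integral_monomials_radial_orthogonal[OF r \<open>d i \<noteq> d j\<close>] by simp
    finally show ?thesis using False by simp
  qed
qed

lemma integral_kfun_lag_fun_opposite:
  assumes "n \<ge> 1" "odd (p + q)"
  shows "(LINT x|lborel. kfun n p z x * of_real (lag_fun n q k x)) = 0"
proof (rule integral_odd)
  fix x
  have "(-1) ^ p * ((-1) ^ q * y) = - y" for y :: complex
    using assms(2) by (cases "even p") auto
  then show "kfun n p z (- x) * of_real (lag_fun n q k (- x)) = - (kfun n p z x * of_real (lag_fun n q k x))"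
    unfolding kfun_uminus[OF assms(1)] lag_fun_uminus using assms(2) by (cases "even p") auto
qed

text \<open>Indices of equal parity share an exponent and fall under Laguerre orthogonality; for
  unequal parity the product is an odd function because \<open>p + q\<close> is odd.\<close>

lemma orthonormal_lag_fun:
  assumes n: "n \<ge> 1" and pq: "odd (p + q)"
  shows "orthonormal_seq lborel (\<lambda>l x. complex_of_real (lag_fun n (if even l then p else q) (l div 2) x))"
  unfolding orthonormal_seq_def
proof (intro conjI allI)
  let ?p = "\<lambda>l::nat. if even l then p else q"
  let ?h = "\<lambda>l x. complex_of_real (lag_fun n (?p l) (l div 2) x)"
  show "?h l \<in> L2 lborel" for l by (rule lag_fun_L2[OF n])
  show "ip lborel (?h i) (?h j) = (if i = j then 1 else 0)" for i j
  proof -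
    have "ip lborel (?h i) (?h j) = of_real (LINT x|lborel. lag_fun n (?p i) (i div 2) x * lag_fun n (?p j) (j div 2) x)"
      unfolding ip_def by (simp flip: integral_complex_of_real of_real_mult)
    also have "(LINT x|lborel. lag_fun n (?p i) (i div 2) x * lag_fun n (?p j) (j div 2) x) = (if i = j then 1 else 0)"
    proof (cases "even i = even j")
      case True
      then have "i div 2 = j div 2 \<longleftrightarrow> i = j" by (metis dvd_mult_div_cancel odd_two_times_div_two_succ)
      then show ?thesis
        using has_bochner_integral_integral_eq[OF integral_lag_fun[OF n, of "?p i" "i div 2" "j div 2"]] True by simp
    next
      case False
      have "(LINT x|lborel. lag_fun n (?p i) (i div 2) x * lag_fun n (?p j) (j div 2) x) = 0"
      proof (rule integral_odd)
        fix x show "lag_fun n (?p i) (i div 2) (- x) * lag_fun n (?p j) (j div 2) (- x) = 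
           - (lag_fun n (?p i) (i div 2) x * lag_fun n (?p j) (j div 2) x)"
          unfolding lag_fun_uminus using False pq by (cases "even p"; cases "even i") auto
      qed
      with False show ?thesis by auto
    qed
    finally show ?thesis by simp
  qed
qed

lemma lag_fun_complete:
  fixes f :: "real \<Rightarrow> complex"
  assumes n: "n \<ge> 1" and pq: "odd (p + q)" and f: "f \<in> L2 lborel"
    and zero: "\<And>k. (LINT x|lborel. f x * of_real (lag_fun n p k x)) = 0"
      "\<And>k. (LINT x|lborel. f x * of_real (lag_fun n q k x)) = 0"
  shows "AE x in lborel. f x = 0"
proof -
  have "AE x in lborel. f x + (-1) ^ p * f (- x) = 0"
    by (rule AE_symmetrization_zero[OF f n _ integral_monomials_zero_if_lag_fun[OF f n zero(1)]]) (use n in auto)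
  moreover have "AE x in lborel. f x + (-1) ^ q * f (- x) = 0"
    by (rule AE_symmetrization_zero[OF f n _ integral_monomials_zero_if_lag_fun[OF f n zero(2)]]) (use n in auto)
  ultimately show ?thesis
  proof eventually_elim
    case (elim x)
    then have "f x + f (- x) = 0" "f x - f (- x) = 0" using pq by (cases "even p"; auto)+
    then have "2 * f x = 0" by (simp add: algebra_simps)
    then show ?case by simp
  qed
qed

text \<open>Isolates what distinguishes the two transforms: the exponents, the scalars of the
  kernel, the coefficients of the basis and the radial profile of the weight. For each half of the
  basis two numerical identities remain: kernel scalar times \<open>ecoeff\<close> is the basis
  coefficient, and the moment of the weight is the inverse square of that coefficient.\<close>

lemma unitary_SB_transform:
  fixes n p q :: nat and \<gamma> \<delta> :: real and \<kappa> \<kappa>' :: "nat \<Rightarrow> real" and r :: "real \<Rightarrow> real"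
  assumes n: "n \<ge> 1" and pq: "odd (p + q)"
    and B: "\<And>z x. B z x = of_real \<gamma> * kpart n p z x + of_real \<delta> * kpart n q z x"
    and e: "\<And>l z. e l z = (if even l then of_real (\<kappa> (l div 2)) * z ^ (2 * n * (l div 2) + p)
                     else of_real (\<kappa>' (l div 2)) * z ^ (2 * n * (l div 2) + q))"
    and \<kappa>: "\<And>k. \<gamma> * ecoeff n p k = \<kappa> k" "\<And>k. \<delta> * ecoeff n q k = \<kappa>' k"
    and \<kappa>0: "\<And>k. \<kappa> k \<noteq> 0" "\<And>k. \<kappa>' k \<noteq> 0"
    and r [measurable]: "r \<in> borel_measurable borel" and nonneg: "\<And>t. r t \<ge> 0"
    and \<rho>: "\<And>z. \<rho> z = r (cmod z)"
    and moment: "\<And>k. (\<integral>\<^sup>+z. ennreal ((cmod z) ^ (2 * (2 * n * k + p)) * \<rho> z) \<partial>lborel) = ennreal (1 / (\<kappa> k)\<^sup>2)"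
      "\<And>k. (\<integral>\<^sup>+z. ennreal ((cmod z) ^ (2 * (2 * n * k + q)) * \<rho> z) \<partial>lborel) = ennreal (1 / (\<kappa>' k)\<^sup>2)"
  shows "unitary_from_L2R (\<lambda>f z. LINT x|lborel. SB_kernel n B z x * f x) (l2_span e) (weighted_inner \<rho>)"
proof -
  define pp where "pp l = (if even l then p else q)" for l :: nat
  define \<kappa>\<kappa> where "\<kappa>\<kappa> l = (if even l then \<kappa> (l div 2) else \<kappa>' (l div 2))" for l
  define d where "d l = 2 * n * (l div 2) + pp l" for l
  have e_eq: "e = (\<lambda>l z. of_real (\<kappa>\<kappa> l) * z ^ d l)"
    by (intro ext) (simp add: e \<kappa>\<kappa>_def d_def pp_def)
  have \<rho>_eq: "\<rho> = (\<lambda>z. r (cmod z))" by (intro ext) (rule \<rho>)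
  \<comment> \<open>The number 2n (l div 2) is even, so the parity of the degree tells
    \<open>p\<close> from \<open>q\<close>; this makes the degrees distinct.\<close>
  have d_par: "even (d l) \<longleftrightarrow> even (pp l)" for l by (simp add: d_def)
  have "inj d"
  proof (rule injI)
    fix i j assume eq: "d i = d j"
    then have "even (pp i) = even (pp j)" using d_par[of i] d_par[of j] by simp
    then have par: "even i = even j" using pq by (auto simp: pp_def split: if_splits)
    then have "pp i = pp j" by (simp add: pp_def)
    then have "i div 2 = j div 2" using eq n by (simp add: d_def)
    with par show "i = j" by (metis dvd_mult_div_cancel odd_two_times_div_two_succ)
  qed
  have K_eq: "SB_kernel n B z = (\<lambda>x. exp (- (z ^ (2 * n)) / of_nat (2 * n)) * (of_real \<gamma> * kfun n p z x + of_real \<delta> * kfun n q z x))" for z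
    by (intro ext) (simp add: SB_kernel_def B kfun_def algebra_simps)
  show ?thesis unfolding e_eq \<rho>_eq
  proof (rule unitary_from_L2R_I[where h = "\<lambda>l x. complex_of_real (lag_fun n (pp l) (l div 2) x)"])
    show "orthonormal_seq lborel (\<lambda>l x. complex_of_real (lag_fun n (pp l) (l div 2) x))"
      unfolding pp_def by (rule orthonormal_lag_fun[OF n pq])
    show "orthonormal_seq (density lborel (\<lambda>z. ennreal (r (cmod z)))) (\<lambda>l z. of_real (\<kappa>\<kappa> l) * z ^ d l)"
    proof (rule orthonormal_monomials[OF r nonneg \<open>inj d\<close>])
      show "\<kappa>\<kappa> l \<noteq> 0" for l using \<kappa>0 by (simp add: \<kappa>\<kappa>_def)
      show "(\<integral>\<^sup>+z. ennreal ((cmod z) ^ (2 * d l) * r (cmod z)) \<partial>lborel) = ennreal (1 / (\<kappa>\<kappa> l)\<^sup>2)" for l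
        using moment[of "l div 2"] by (simp add: \<rho> d_def pp_def \<kappa>\<kappa>_def)
    qed
    fix f :: "real \<Rightarrow> complex"
    assume f: "f \<in> L2 lborel" and zero: "\<And>l. ip lborel f (\<lambda>x. complex_of_real (lag_fun n (pp l) (l div 2) x)) = 0"
    show "AE x in lborel. f x = 0"
    proof (rule lag_fun_complete[OF n pq f])
      show "(LINT x|lborel. f x * of_real (lag_fun n p k x)) = 0" for k
        using zero[of "2 * k"] by (simp add: ip_def pp_def)
      show "(LINT x|lborel. f x * of_real (lag_fun n q k x)) = 0" for k
        using zero[of "2 * k + 1"] by (simp add: ip_def pp_def)
    qed
  next
    fix z
    show "SB_kernel n B z \<in> L2 lborel" unfolding K_eq
      by (intro L2_scale L2_add kfun_L2 n)
    fix l
    let ?E = "exp (- (z ^ (2 * n)) / of_nat (2 * n))"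
    let ?h = "\<lambda>x. complex_of_real (lag_fun n (pp l) (l div 2) x)"
    have int: "integrable lborel (\<lambda>x. kfun n p' z x * ?h x)" for p'
      by (intro L2_mult_integrable kfun_L2 lag_fun_L2 n)
    have "(LINT x|lborel. SB_kernel n B z x * ?h x) = (LINT x|lborel. ?E * (of_real \<gamma> * (kfun n p z x * ?h x) + of_real \<delta> * (kfun n q z x * ?h x)))"
      unfolding K_eq by (simp add: algebra_simps)
    also have "\<dots> = ?E * (of_real \<gamma> * (LINT x|lborel. kfun n p z x * ?h x) + of_real \<delta> * (LINT x|lborel. kfun n q z x * ?h x))"
      using int[of p] int[of q] by simp
    \<comment> \<open>Only the part of the kernel with the parity of the test function contributes;
      the other integrand is odd.\<close>
    also have "\<dots> = ?E * (exp (z ^ (2 * n) / of_nat (2 * n)) * (of_real (\<kappa>\<kappa> l) * z ^ d l))"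
    proof (cases "even l")
      case True
      have "odd (q + p)" using pq by (simp add: add.commute)
      then show ?thesis using True
        by (simp add: pp_def integral_kfun_lag_fun[OF n] integral_kfun_lag_fun_opposite[OF n] \<kappa>\<kappa>_def d_def \<kappa>[symmetric])
    next
      case False
      then show ?thesis using pq
        by (simp add: pp_def integral_kfun_lag_fun[OF n] integral_kfun_lag_fun_opposite[OF n] \<kappa>\<kappa>_def d_def \<kappa>[symmetric])
    qed
    also have "\<dots> = of_real (\<kappa>\<kappa> l) * z ^ d l"
      by (simp add: mult.assoc[symmetric] exp_add[symmetric])
    finally show "(LINT x|lborel. SB_kernel n B z x * ?h x) = of_real (\<kappa>\<kappa> l) * z ^ d l" .
  qed (use nonneg in auto)
qed

text \<open>With t = |z|^2 the integrand is a multiple of t^(q + n - 1/2) K(t^n / n), so the Mellin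
  variable is (q + n + 1/2) / n = \<mu>. The factors n^\<mu> / n and 2^(\<mu>-2) combine to
  (2n)^(\<mu>-1) / 2, of which \<open>weight_const\<close> removes (2n)^(1/(2n)) / 2 together with
  the \<pi> of the radial integral, leaving (2n)^(q/n) / \<Gamma>(1/(2n)).\<close>

lemma nn_integral_bessel_weight:
  fixes n q :: nat and \<nu> :: real
  assumes n: "n \<ge> 1" and \<nu>: "\<bar>\<nu>\<bar> < \<mu>" and \<mu>: "\<mu> = 1 + 1 / (2 * real n) + real q / real n"
  shows "(\<integral>\<^sup>+z. ennreal ((cmod z) ^ (2 * q) * (weight_const n * ((cmod z)\<^sup>2) powr (real n - 1/2) * bessel_K \<nu> (((cmod z)\<^sup>2) ^ n / real n))) \<partial>lborel) =
    ennreal ((2 * real n) powr (real q / real n) * Gamma ((\<mu> + \<nu>) / 2) * Gamma ((\<mu> - \<nu>) / 2) / Gamma (1 / (2 * real n)))"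
proof -
  define a where "a = 1 / (2 * real n)"
  have a: "a > 0" using n by (simp add: a_def)
  have n0: "real n > 0" using n by simp
  define s where "s = real q + real n + 1 / 2"
  have s: "s / real n = \<mu>" using n by (simp add: s_def \<mu> field_simps)
  have W: "weight_const n > 0" using n a unfolding weight_const_def a_def[symmetric]
    by (intro divide_pos_pos mult_pos_pos Gamma_real_pos) auto
  have G: "Gamma ((\<mu> + \<nu>) / 2) > 0" "Gamma ((\<mu> - \<nu>) / 2) > 0" "Gamma a > 0"
    using \<nu> a by (auto intro!: Gamma_real_pos)
  define \<phi> where "\<phi> t = ennreal (t ^ q * (weight_const n * t powr (real n - 1/2) * bessel_K \<nu> (t ^ n / real n)))" for t
  have [measurable]: "\<phi> \<in> borel_measurable borel" unfolding \<phi>_def[abs_def] by measurable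
  have "(\<integral>\<^sup>+z. ennreal ((cmod z) ^ (2 * q) * (weight_const n * ((cmod z)\<^sup>2) powr (real n - 1/2) * bessel_K \<nu> (((cmod z)\<^sup>2) ^ n / real n))) \<partial>lborel)
     = (\<integral>\<^sup>+z. \<phi> ((cmod z)\<^sup>2) \<partial>lborel)"
    by (simp add: \<phi>_def power_mult)
  also have "\<dots> = ennreal pi * (\<integral>\<^sup>+t. \<phi> t * indicator {0<..} t \<partial>lborel)"
    by (rule nn_integral_radial) measurable
  also have "(\<integral>\<^sup>+t. \<phi> t * indicator {0<..} t \<partial>lborel) = 
     (\<integral>\<^sup>+t. ennreal (weight_const n) * (ennreal (t powr (s - 1)) * ennreal (bessel_K \<nu> (1 / real n * t powr real n)) * indicator {0<..} t) \<partial>lborel)"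
  proof (rule nn_integral_cong)
    fix t :: real
    show "\<phi> t * indicator {0<..} t = ennreal (weight_const n) * (ennreal (t powr (s - 1)) * ennreal (bessel_K \<nu> (1 / real n * t powr real n)) * indicator {0<..} t)"
    proof (cases "t > 0")
      case True
      have h1: "t ^ q * t powr (real n - 1/2) = t powr (s - 1)"
        using True by (simp add: powr_realpow[symmetric] powr_add[symmetric] s_def algebra_simps)
      have h2: "t ^ n / real n = 1 / real n * t powr real n" using True by (simp add: powr_realpow)
      have "t ^ q * (weight_const n * t powr (real n - 1/2) * bessel_K \<nu> (t ^ n / real n)) = 
         weight_const n * (t powr (s - 1) * bessel_K \<nu> (1 / real n * t powr real n))"
        unfolding h1[symmetric] h2[symmetric] by (simp only: mult_ac)
      then show ?thesis using True W bessel_K_nonneg by (simp add: \<phi>_def ennreal_mult[symmetric])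
    qed auto
  qed
  also have "\<dots> = ennreal (weight_const n) * (\<integral>\<^sup>+t. ennreal (t powr (s - 1)) * ennreal (bessel_K \<nu> (1 / real n * t powr real n)) * indicator {0<..} t \<partial>lborel)"
    by (rule nn_integral_cmult) measurable
  also have "(\<integral>\<^sup>+t. ennreal (t powr (s - 1)) * ennreal (bessel_K \<nu> (1 / real n * t powr real n)) * indicator {0<..} t \<partial>lborel) =
     ennreal ((1 / real n) powr (- s / real n) / real n) * (\<integral>\<^sup>+y. ennreal (y powr (s / real n - 1)) * ennreal (bessel_K \<nu> y) * indicator {0<..} y \<partial>lborel)"
    by (rule nn_integral_mellin_powr) (use n0 in auto)
  also have "(\<integral>\<^sup>+y. ennreal (y powr (s / real n - 1)) * ennreal (bessel_K \<nu> y) * indicator {0<..} y \<partial>lborel) =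
     ennreal (2 powr (\<mu> - 2) * Gamma ((\<mu> + \<nu>) / 2) * Gamma ((\<mu> - \<nu>) / 2))"
    unfolding s by (rule nn_integral_mellin_bessel_K[OF \<nu>])
  also have "ennreal pi * (ennreal (weight_const n) * (ennreal ((1 / real n) powr (- s / real n) / real n) * 
      ennreal (2 powr (\<mu> - 2) * Gamma ((\<mu> + \<nu>) / 2) * Gamma ((\<mu> - \<nu>) / 2)))) =
    ennreal (pi * (weight_const n * ((1 / real n) powr (- s / real n) / real n * (2 powr (\<mu> - 2) * Gamma ((\<mu> + \<nu>) / 2) * Gamma ((\<mu> - \<nu>) / 2)))))"
  proof -
    have "ennreal w * (ennreal x * (ennreal y * ennreal z)) = ennreal (w * (x * (y * z)))"
      if "w \<ge> 0" "x \<ge> 0" "y \<ge> 0" "z \<ge> 0" for w x y z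
      using that by (simp add: ennreal_mult)
    then show ?thesis using W G n0 by simp
  qed
  also have "pi * (weight_const n * ((1 / real n) powr (- s / real n) / real n * (2 powr (\<mu> - 2) * Gamma ((\<mu> + \<nu>) / 2) * Gamma ((\<mu> - \<nu>) / 2)))) = 
    (2 * real n) powr (real q / real n) * Gamma ((\<mu> + \<nu>) / 2) * Gamma ((\<mu> - \<nu>) / 2) / Gamma a"
  proof -
    have "(1 / real n) powr (- s / real n) = real n powr \<mu>"
      using n0 by (simp add: s minus_divide_left[symmetric] powr_minus powr_divide)
    then have "(1 / real n) powr (- s / real n) / real n * 2 powr (\<mu> - 2) = real n powr (\<mu> - 1) * 2 powr (\<mu> - 1) / 2"
      using n0 by (simp add: powr_diff power2_eq_square)
    also have "\<dots> = (2 * real n) powr (a + real q / real n) / 2"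
      using n0 by (simp add: powr_mult \<mu> a_def mult.commute)
    finally have "(1 / real n) powr (- s / real n) / real n * 2 powr (\<mu> - 2) = (2 * real n) powr a * (2 * real n) powr (real q / real n) / 2"
      by (simp add: powr_add)
    then have eq: "pi * (weight_const n * ((1 / real n) powr (- s / real n) / real n * 2 powr (\<mu> - 2))) = (2 * real n) powr (real q / real n) / Gamma a"
      using n0 unfolding weight_const_def a_def[symmetric] by (simp add: field_simps)
    have assoc: "p * (w * (c * (d * g * h))) = p * (w * (c * d)) * g * h" for p w c d g h :: real
      by simp
    show ?thesis unfolding assoc eq by simp
  qed
  finally show ?thesis by (simp add: a_def)
qed

section \<open>Identification of kernel series, coefficients and moments\<close>

lemma kterm_eq:
  assumes n: "n \<ge> 1"
  shows "of_real (2 ^ l) * (z * of_real x) ^ (2 * n * l + p)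
           / of_real ((2 * real n) ^ (2 * l) * Gamma (nu n p + 1 + l) * fact l) = kterm n p z x l"
proof -
  have "2 ^ l * x ^ (2 * n * l + p) / ((2 * real n) ^ (2 * l) * Gamma (nu n p + 1 + l) * fact l) = 
        x ^ p * (x ^ (2 * n) / real n) ^ l / ((2 * real n) ^ l * Gamma (nu n p + 1 + l) * fact l)"
  proof -
    have "(2 * real n) ^ (2 * l) = 2 ^ l * real n ^ l * (2 * real n) ^ l"
      unfolding mult_2[of l] power_add by (simp add: power_mult_distrib)
    moreover have "x ^ (2 * n * l + p) = x ^ p * (x ^ (2 * n)) ^ l" by (simp add: power_add power_mult)
    ultimately show ?thesis by (simp add: power_divide)
  qed
  then have "complex_of_real (2 ^ l * x ^ (2 * n * l + p) / ((2 * real n) ^ (2 * l) * Gamma (nu n p + 1 + l) * fact l)) =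
    of_real (x ^ p * (x ^ (2 * n) / real n) ^ l / ((2 * real n) ^ l * Gamma (nu n p + 1 + l) * fact l))" by (rule arg_cong)
  then have "z ^ (2 * n * l + p) * complex_of_real (2 ^ l * x ^ (2 * n * l + p) / ((2 * real n) ^ (2 * l) * Gamma (nu n p + 1 + l) * fact l)) =
    z ^ (2 * n * l + p) * of_real (x ^ p * (x ^ (2 * n) / real n) ^ l / ((2 * real n) ^ l * Gamma (nu n p + 1 + l) * fact l))" by simp
  then show ?thesis
    unfolding kterm_def of_real_divide of_real_mult[of "2 ^ l"] power_mult_distrib[of z] of_real_power[of x]
    by (simp only: times_divide_eq_right times_divide_eq_left mult_ac)
qed

lemma kpart_series:
  assumes n: "n \<ge> 1" and G: "\<And>l. G l = nu n p + 1 + real l" and d: "\<And>l. d l = 2 * n * l + p"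
  shows "(\<Sum>l. of_real (2 ^ l) * (z * of_real x) ^ d l / of_real ((2 * real n) ^ (2 * l) * Gamma (G l) * fact l)) = kpart n p z x"
  unfolding kpart_def G d kterm_eq[OF n] ..

text \<open>The quotient 2^(l + 1/2) / (2n)^(2l + 1) is sqrt 2 / (2n) times the one in
  \<open>kterm_eq\<close>; this constant enters the scalar of the second half of each
  kernel.\<close>

lemma kpart_series_half:
  assumes n: "n \<ge> 1" and G: "\<And>l. G l = nu n p + 1 + real l" and d: "\<And>l. d l = 2 * n * l + p"
  shows "(\<Sum>l. of_real (2 powr (real l + 1/2)) * (z * of_real x) ^ d l
            / of_real ((2 * real n) ^ (2 * l + 1) * Gamma (G l) * fact l)) = of_real (sqrt 2 / (2 * real n)) * kpart n p z x"
proof -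
  have "of_real (2 powr (real l + 1/2)) * (z * of_real x) ^ d l / of_real ((2 * real n) ^ (2 * l + 1) * Gamma (G l) * fact l) = 
    of_real (sqrt 2 / (2 * real n)) * kterm n p z x l" for l
  proof -
    have "2 powr (real l + 1/2) = 2 ^ l * sqrt 2" by (simp add: powr_add powr_realpow powr_half_sqrt)
    then show ?thesis unfolding kterm_eq[OF n, symmetric] G d by simp (simp add: mult_ac)
  qed
  moreover have "summable (kterm n p z x)"
    by (rule kterm_bound[OF n, of p z]) (rule summable_norm_cancel)
  ultimately show ?thesis unfolding kpart_def by (simp only: suminf_mult)
qed

text \<open>Comparing squares removes \<open>k\<close>: the factor (2n)^(2k) of \<open>Y\<close> is
  the square of the one in \<open>ecoeff\<close>, and what remains is the identity for \<gamma>^2.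
  The exponent \<open>c\<close> is the offset in the power of 2n in the basis: 0 and 2 - 1/n for
  \<open>e\<^sub>1\<close>, 1 - 1/n and 1 for \<open>e\<^sub>2\<close>.\<close>

lemma ecoeff_eq:
  assumes n: "n \<ge> 1" and \<gamma>: "\<gamma> \<ge> 0" "\<gamma>\<^sup>2 * real n powr nu n p = Gamma (1 / (2 * real n)) / (2 * real n) powr c"
    and Y: "Y = (2 * real n) powr (2 * real k + c)" and G: "G = nu n p + 1 + real k"
  shows "\<gamma> * ecoeff n p k = sqrt (Gamma (1 / (2 * real n)) / (Y * Gamma G * fact k))"
proof -
  define N where "N = 2 * real n"
  have N: "N > 0" using n by (simp add: N_def)
  have "Y = N powr c * (N ^ k)\<^sup>2"
    unfolding Y N_def[symmetric] using N powr_realpow[OF N, of "2 * k"]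
    by (simp add: powr_add power_mult[symmetric] mult.commute)
  then have "Gamma (1 / (2 * real n)) / (Y * Gamma G * fact k) = \<gamma>\<^sup>2 * real n powr nu n p / (Gamma G * fact k) / (N ^ k)\<^sup>2"
    unfolding \<gamma>(2) N_def[symmetric] by (simp add: mult_ac)
  also have "\<dots> = \<gamma>\<^sup>2 * (real n powr nu n p / (Gamma G * fact k)) / (N ^ k)\<^sup>2" by simp
  also have "sqrt \<dots> = \<gamma> * (sqrt (real n powr nu n p / (Gamma G * fact k)) / N ^ k)"
    using \<gamma>(1) N by (simp only: real_sqrt_divide[of _ "(N ^ k)\<^sup>2"] real_sqrt_mult[of "\<gamma>\<^sup>2"] real_sqrt_abs) simp
  finally show ?thesis by (simp add: ecoeff_def G N_def)
qed

text \<open>In each use one of \<open>A\<close> and \<open>B\<close> is k + 1 and supplies k!, and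
  the other supplies the Gamma factor of the basis function; which is which depends on the sign of
  \<open>nu\<close> for the exponent at hand.\<close>

lemma bessel_weight_moment:
  assumes n: "n \<ge> 1" and \<mu>: "\<bar>\<nu>\<bar> < 1 + 1 / (2 * real n) + real q / real n"
    and A: "(1 + 1 / (2 * real n) + real q / real n + \<nu>) / 2 = A" "(1 + 1 / (2 * real n) + real q / real n - \<nu>) / 2 = B"
    and g: "Gamma A * Gamma B = g * fact k" "g > 0"
    and Y: "Y = (2 * real n) powr (real q / real n)" 
  shows "(\<integral>\<^sup>+z. ennreal ((cmod z) ^ (2 * q) * (weight_const n * ((cmod z)\<^sup>2) powr (real n - 1/2) * bessel_K \<nu> (((cmod z)\<^sup>2) ^ n / real n))) \<partial>lborel) =
    ennreal (1 / (sqrt (Gamma (1 / (2 * real n)) / (Y * g * fact k)))\<^sup>2)"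
proof -
  have "Y > 0" using n by (simp add: Y)
  moreover have "Gamma (1 / (2 * real n)) > 0" using n by (intro Gamma_real_pos) auto
  ultimately have "1 / (sqrt (Gamma (1 / (2 * real n)) / (Y * g * fact k)))\<^sup>2 = Y * (g * fact k) / Gamma (1 / (2 * real n))"
    using g(2) by simp
  then show ?thesis
    unfolding nn_integral_bessel_weight[OF n \<mu> refl] A g(1)[symmetric] Y by (simp add: mult.assoc)
qed

section \<open>The constants of the two transforms\<close>

lemma powr_square: "(x powr c)\<^sup>2 = x powr (2 * c)" for x c :: real
  by (simp add: power2_eq_square powr_add[symmetric])

lemma SB_\<alpha>_square: 
  assumes "n \<ge> 1"
  shows "SB_\<alpha> n \<ge> 0" "(SB_\<alpha> n)\<^sup>2 = real n powr (1 - 1 / (2 * real n)) * Gamma (1 / (2 * real n))"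
proof -
  have G: "Gamma (1 / (2 * real n)) > 0" using assms by (intro Gamma_real_pos) auto
  then show "SB_\<alpha> n \<ge> 0" by (simp add: SB_\<alpha>_def)
  show "(SB_\<alpha> n)\<^sup>2 = real n powr (1 - 1 / (2 * real n)) * Gamma (1 / (2 * real n))"
    using G assms by (simp add: SB_\<alpha>_def power_mult_distrib powr_square right_diff_distrib)
qed

lemma SB_\<beta>_square: 
  assumes "n \<ge> 1"
  shows "SB_\<beta> n \<ge> 0" "(SB_\<beta> n)\<^sup>2 = 2 powr (- 1 + 1 / real n) * real n powr (- 1 + 3 / (2 * real n)) * Gamma (1 / (2 * real n))"
proof -
  have G: "Gamma (1 / (2 * real n)) > 0" using assms by (intro Gamma_real_pos) auto
  then show "SB_\<beta> n \<ge> 0" by (simp add: SB_\<beta>_def)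
  have "(2 powr (- 1/2 + 1 / (2 * real n)))\<^sup>2 = 2 powr (- 1 + 1 / real n)"
    using assms by (simp add: powr_square distrib_left)
  moreover have "(real n powr (- 1/2 + 3 / (4 * real n)))\<^sup>2 = real n powr (- 1 + 3 / (2 * real n))"
    using assms by (simp add: powr_square distrib_left)
  ultimately show "(SB_\<beta> n)\<^sup>2 = 2 powr (- 1 + 1 / real n) * real n powr (- 1 + 3 / (2 * real n)) * Gamma (1 / (2 * real n))"
    using G by (simp add: SB_\<beta>_def power_mult_distrib)
qed

text \<open>Each transform has a pair of opposite values, whose positive member is the index of K in
  its weight.\<close>

lemma nu_values:
  assumes "n \<ge> 1"
  shows "nu n 0 = 1 / (2 * real n) - 1" "nu n (2 * n - 1) = 1 - 1 / (2 * real n)"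
    "nu n (n - 1) = - 1 / (2 * real n)" "nu n n = 1 / (2 * real n)"
  using assms by (auto simp: nu_def field_simps of_nat_diff)

lemma unitary_SB_transform\<^sub>1:
  assumes n: "n \<ge> 1"
  shows "unitary_from_L2R (SB_transform\<^sub>1 n) (\<FF>\<^sub>1 n) (weighted_inner (\<rho>\<^sub>1 n))"
proof -
  define a where "a = 1 / (2 * real n)"
  have a: "0 < a" "a < 1" "1 / real n = 2 * a" using n by (auto simp: a_def field_simps)
  have nu: "nu n 0 = a - 1" "nu n (2 * n - 1) = 1 - a" using nu_values[OF n] by (simp_all add: a_def)
  have G: "Gamma a > 0" "Gamma (real k + a) > 0" "Gamma (real k + 2 - a) > 0" for k
    using a by (auto intro!: Gamma_real_pos)
  define \<kappa> where "\<kappa> k = sqrt (Gamma (1 / (2 * real n)) / ((2 * real n) ^ (2 * k) * Gamma (real k + 1 / (2 * real n)) * fact k))" for k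
  define \<kappa>' where "\<kappa>' k = sqrt (Gamma (1 / (2 * real n)) / ((2 * real n) powr (2 * real k + 2 - 1 / real n)
             * Gamma (real k + 2 - 1 / (2 * real n)) * fact k))" for k
  define r where "r t = weight_const n * (t\<^sup>2) powr (real n - 1/2) * bessel_K (1 - 1 / (2 * real n)) ((t\<^sup>2) ^ n / real n)" for t
  \<comment> \<open>The factor sqrt 2 / (2n) is the one that \<open>kpart_series_half\<close>
    extracts from the second series.\<close>
  define \<delta> where "\<delta> = SB_\<beta> n * sqrt 2 / (2 * real n)"
  have "unitary_from_L2R (\<lambda>f z. LINT x|lborel. SB_kernel n (B\<^sub>1 n) z x * f x) (l2_span (e\<^sub>1 n)) (weighted_inner (\<rho>\<^sub>1 n))"
  proof (rule unitary_SB_transform[where p = 0 and q = "2 * n - 1" and \<gamma> = "SB_\<alpha> n" and \<delta> = \<delta> and \<kappa> = \<kappa> and \<kappa>' = \<kappa>' and r = r])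
    show "n \<ge> 1" "odd (0 + (2 * n - 1))" using n by auto
    show "B\<^sub>1 n z x = of_real (SB_\<alpha> n) * kpart n 0 z x + of_real \<delta> * kpart n (2 * n - 1) z x" for z x
    proof -
      have "(\<Sum>l. of_real (2 ^ l) * (z * of_real x) ^ (2 * n * l)
        / of_real ((2 * real n) ^ (2 * l) * Gamma (real l + 1 / (2 * real n)) * fact l)) = kpart n 0 z x"
        by (rule kpart_series[OF n, where G = "\<lambda>l. real l + 1 / (2 * real n)" and d = "\<lambda>l. 2 * n * l"])
           (simp_all add: nu a_def)
      moreover have "(\<Sum>l. of_real (2 powr (real l + 1/2)) * (z * of_real x) ^ (2 * n * l + 2 * n - 1)
        / of_real ((2 * real n) ^ (2 * l + 1) * Gamma (real l + 2 - 1 / (2 * real n)) * fact l)) =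
        of_real (sqrt 2 / (2 * real n)) * kpart n (2 * n - 1) z x"
        proof (rule kpart_series_half[OF n, where G = "\<lambda>l. real l + 2 - 1 / (2 * real n)" and d = "\<lambda>l. 2 * n * l + 2 * n - 1"])
          show "real l + 2 - 1 / (2 * real n) = nu n (2 * n - 1) + 1 + real l" for l unfolding nu a_def by simp
          show "2 * n * l + 2 * n - 1 = 2 * n * l + (2 * n - 1)" for l using n by simp
        qed
      ultimately show ?thesis unfolding B\<^sub>1_def by (simp only:) (simp add: \<delta>_def)
    qed
    show "e\<^sub>1 n l z = (if even l then of_real (\<kappa> (l div 2)) * z ^ (2 * n * (l div 2) + 0)
                     else of_real (\<kappa>' (l div 2)) * z ^ (2 * n * (l div 2) + (2 * n - 1)))" for l z
      using n by (simp add: e\<^sub>1_def Let_def \<kappa>_def \<kappa>'_def)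
    show "SB_\<alpha> n * ecoeff n 0 k = \<kappa> k" for k unfolding \<kappa>_def
    \<comment> \<open>The square of \<alpha> carries n^(1 - a), which cancels n^(a - 1) from
      \<open>nu n 0\<close>; no power of 2n is left, hence c = 0.\<close>
    proof (rule ecoeff_eq[OF n, where c = 0])
      show "(SB_\<alpha> n)\<^sup>2 * real n powr nu n 0 = Gamma (1 / (2 * real n)) / (2 * real n) powr 0"
        using n unfolding SB_\<alpha>_square[OF n] a_def[symmetric] nu by (simp add: powr_add[symmetric])
      show "(2 * real n) ^ (2 * k) = (2 * real n) powr (2 * real k + 0)"
        using n powr_realpow[of "2 * real n" "2 * k"] by simp
    qed (use n SB_\<alpha>_square[OF n] in \<open>auto simp: nu a_def\<close>)
    show "\<delta> * ecoeff n (2 * n - 1) k = \<kappa>' k" for k unfolding \<kappa>'_def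
    \<comment> \<open>Here \<delta>^2 = \<beta>^2 / (2 n^2). The powers of 2 and of n both end with
      exponent 2a - 2 and merge into one power of 2n; the exponents in \<beta> are made for
      this.\<close>
    proof (rule ecoeff_eq[OF n, where c = "2 - 2 * a"])
      have "\<delta>\<^sup>2 * real n powr nu n (2 * n - 1) = (SB_\<beta> n)\<^sup>2 / 2 / (real n)\<^sup>2 * real n powr (1 - a)"
        unfolding nu \<delta>_def by (simp add: power_mult_distrib power_divide)
      also have "\<dots> = Gamma a * (2 powr (- 1 + 2 * a) / 2) * (real n powr (- 1 + 3 * a) * real n powr (1 - a) / (real n)\<^sup>2)"
      proof -
        have "3 / (2 * real n) = 3 * a" by (simp add: a_def)
        then show ?thesis unfolding SB_\<beta>_square[OF n] a(3) a_def[symmetric] by simp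
      qed
      also have "2 powr (- 1 + 2 * a) / 2 = 2 powr (2 * a - 2)" by (simp add: powr_diff powr_add powr_minus)
      also have "real n powr (- 1 + 3 * a) * real n powr (1 - a) / (real n)\<^sup>2 = real n powr (2 * a - 2)"
        using n by (simp only: powr_add[symmetric]) (simp add: powr_diff)
      also have "Gamma a * 2 powr (2 * a - 2) * real n powr (2 * a - 2) = Gamma a / (2 * real n) powr (2 - 2 * a)"
        using n by (simp add: powr_mult powr_diff field_simps)
      finally show "\<delta>\<^sup>2 * real n powr nu n (2 * n - 1) = Gamma (1 / (2 * real n)) / (2 * real n) powr (2 - 2 * a)"
        by (simp add: a_def)
      show "(2 * real n) powr (2 * real k + 2 - 1 / real n) = (2 * real n) powr (2 * real k + (2 - 2 * a))"
        unfolding a(3) by (simp add: algebra_simps)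
      show "real k + 2 - 1 / (2 * real n) = nu n (2 * n - 1) + 1 + real k" unfolding nu a_def by simp
    qed (use SB_\<beta>_square[OF n] in \<open>simp add: \<delta>_def\<close>)
    show "\<kappa> k \<noteq> 0" for k using G(1)[THEN less_imp_neq] G(2)[of k] G(3)[of k] n by (simp add: \<kappa>_def a_def)
    show "\<kappa>' k \<noteq> 0" for k using G(1)[THEN less_imp_neq] G(2)[of k] G(3)[of k] n by (simp add: \<kappa>'_def a_def)
    show "r \<in> borel_measurable borel" unfolding r_def[abs_def] by measurable
    show "r t \<ge> 0" for t
      unfolding r_def weight_const_def using G(1) by (intro mult_nonneg_nonneg bessel_K_nonneg) (auto simp: a_def)
    show \<rho>: "\<rho>\<^sub>1 n z = r (cmod z)" for z by (simp add: \<rho>\<^sub>1_def r_def)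
    fix k
    show "(\<integral>\<^sup>+z. ennreal ((cmod z) ^ (2 * (2 * n * k + 0)) * \<rho>\<^sub>1 n z) \<partial>lborel) = ennreal (1 / (\<kappa> k)\<^sup>2)"
      unfolding \<rho>\<^sub>1_def \<kappa>_def
    \<comment> \<open>The parameter \<open>nu n 0\<close> is a - 1 < 0, so adding the index of K
      cancels it and gives k + 1 as first argument.\<close>
    proof (rule bessel_weight_moment[OF n, where A = "real k + 1" and B = "real k + 1 / (2 * real n)"])
      have q: "real (2 * n * k + 0) / real n = 2 * real k" using n by simp
      show "\<bar>1 - 1 / (2 * real n)\<bar> < 1 + 1 / (2 * real n) + real (2 * n * k + 0) / real n"
        unfolding q a_def[symmetric] using a by simp
      show "(1 + 1 / (2 * real n) + real (2 * n * k + 0) / real n + (1 - 1 / (2 * real n))) / 2 = real k + 1"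
           "(1 + 1 / (2 * real n) + real (2 * n * k + 0) / real n - (1 - 1 / (2 * real n))) / 2 = real k + 1 / (2 * real n)"
        unfolding q a_def[symmetric] by simp_all
      show "(2 * real n) ^ (2 * k) = (2 * real n) powr (real (2 * n * k + 0) / real n)"
        unfolding q using n powr_realpow[of "2 * real n" "2 * k"] by simp
    qed (use G(1) G(2)[of k] G(3)[of k] in \<open>auto simp: Gamma_fact a_def add.commute\<close>)
    show "(\<integral>\<^sup>+z. ennreal ((cmod z) ^ (2 * (2 * n * k + (2 * n - 1))) * \<rho>\<^sub>1 n z) \<partial>lborel) = ennreal (1 / (\<kappa>' k)\<^sup>2)"
      unfolding \<rho>\<^sub>1_def \<kappa>'_def
    proof (rule bessel_weight_moment[OF n, where A = "real k + 2 - 1 / (2 * real n)" and B = "real k + 1"])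
      have q: "real (2 * n * k + (2 * n - 1)) / real n = 2 * real k + 2 - 1 / real n"
        using n by (simp add: of_nat_diff field_simps)
      have q': "2 * real k + 2 - 1 / real n = 2 * real k + 2 - 2 * a" using a by simp
      show "\<bar>1 - 1 / (2 * real n)\<bar> < 1 + 1 / (2 * real n) + real (2 * n * k + (2 * n - 1)) / real n"
        unfolding q q' a_def[symmetric] using a by simp
      show "(1 + 1 / (2 * real n) + real (2 * n * k + (2 * n - 1)) / real n + (1 - 1 / (2 * real n))) / 2 = real k + 2 - 1 / (2 * real n)"
           "(1 + 1 / (2 * real n) + real (2 * n * k + (2 * n - 1)) / real n - (1 - 1 / (2 * real n))) / 2 = real k + 1"
        unfolding q q' a_def[symmetric] by (simp_all add: field_simps)
      show "(2 * real n) powr (2 * real k + 2 - 1 / real n) = (2 * real n) powr (real (2 * n * k + (2 * n - 1)) / real n)"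
        unfolding q ..
    qed (use G(1) G(2)[of k] G(3)[of k] in \<open>auto simp: Gamma_fact a_def add.commute\<close>)
  qed
  then show ?thesis by (simp add: SB_transform\<^sub>1_def[abs_def] \<FF>\<^sub>1_def)
qed

lemma unitary_SB_transform\<^sub>2:
  assumes n: "n \<ge> 1"
  shows "unitary_from_L2R (SB_transform\<^sub>2 n) (\<FF>\<^sub>2 n) (weighted_inner (\<rho>\<^sub>2 n))"
proof -
  define a where "a = 1 / (2 * real n)"
  have a: "0 < a" "a < 1" "1 / real n = 2 * a" using n by (auto simp: a_def field_simps)
  have nu: "nu n (n - 1) = - a" "nu n n = a" using nu_values[OF n] by (simp_all add: a_def)
  have G: "Gamma a > 0" "Gamma (real k + 1 - a) > 0" "Gamma (real k + 1 + a) > 0" for k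
    using a by (auto intro!: Gamma_real_pos)
  define \<kappa> where "\<kappa> k = sqrt (Gamma (1 / (2 * real n)) / ((2 * real n) powr (2 * real k + 1 - 1 / real n)
             * Gamma (real k + 1 - 1 / (2 * real n)) * fact k))" for k
  define \<kappa>' where "\<kappa>' k = sqrt (Gamma (1 / (2 * real n)) / ((2 * real n) ^ (2 * k + 1) * Gamma (real k + 1 + 1 / (2 * real n)) * fact k))" for k
  define r where "r t = weight_const n * (t\<^sup>2) powr (real n - 1/2) * bessel_K (1 / (2 * real n)) ((t\<^sup>2) ^ n / real n)" for t
  define \<delta> where "\<delta> = SB_\<alpha> n * sqrt 2 / (2 * real n)"
  have "unitary_from_L2R (\<lambda>f z. LINT x|lborel. SB_kernel n (B\<^sub>2 n) z x * f x) (l2_span (e\<^sub>2 n)) (weighted_inner (\<rho>\<^sub>2 n))"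
  proof (rule unitary_SB_transform[where p = "n - 1" and q = n and \<gamma> = "SB_\<beta> n" and \<delta> = \<delta> and \<kappa> = \<kappa> and \<kappa>' = \<kappa>' and r = r])
    show "n \<ge> 1" "odd (n - 1 + n)" using n by auto
    show "B\<^sub>2 n z x = of_real (SB_\<beta> n) * kpart n (n - 1) z x + of_real \<delta> * kpart n n z x" for z x
    proof -
      have "(\<Sum>l. of_real (2 ^ l) * (z * of_real x) ^ (2 * n * l + n - 1)
        / of_real ((2 * real n) ^ (2 * l) * Gamma (real l + 1 - 1 / (2 * real n)) * fact l)) = kpart n (n - 1) z x"
        proof (rule kpart_series[OF n, where G = "\<lambda>l. real l + 1 - 1 / (2 * real n)" and d = "\<lambda>l. 2 * n * l + n - 1"])
          show "real l + 1 - 1 / (2 * real n) = nu n (n - 1) + 1 + real l" for l unfolding nu a_def by simp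
          show "2 * n * l + n - 1 = 2 * n * l + (n - 1)" for l using n by simp
        qed
      moreover have "(\<Sum>l. of_real (2 powr (real l + 1/2)) * (z * of_real x) ^ (2 * n * l + n)
        / of_real ((2 * real n) ^ (2 * l + 1) * Gamma (real l + 1 + 1 / (2 * real n)) * fact l)) =
        of_real (sqrt 2 / (2 * real n)) * kpart n n z x"
        proof (rule kpart_series_half[OF n, where G = "\<lambda>l. real l + 1 + 1 / (2 * real n)" and d = "\<lambda>l. 2 * n * l + n"])
          show "real l + 1 + 1 / (2 * real n) = nu n (n) + 1 + real l" for l unfolding nu a_def by simp
          show "2 * n * l + n = 2 * n * l + (n)" for l using n by simp
        qed
      ultimately show ?thesis unfolding B\<^sub>2_def by (simp only:) (simp add: \<delta>_def)
    qed
    show "e\<^sub>2 n l z = (if even l then of_real (\<kappa> (l div 2)) * z ^ (2 * n * (l div 2) + (n - 1))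
                     else of_real (\<kappa>' (l div 2)) * z ^ (2 * n * (l div 2) + n))" for l z
      using n by (simp add: e\<^sub>2_def Let_def \<kappa>_def \<kappa>'_def)
    show "SB_\<beta> n * ecoeff n (n - 1) k = \<kappa> k" for k unfolding \<kappa>_def
    \<comment> \<open>The same \<beta>, now without the factor 1 / (2 n^2): the powers of 2 and of n
      both have exponent 2a - 1.\<close>
    proof (rule ecoeff_eq[OF n, where c = "1 - 2 * a"])
      have "(SB_\<beta> n)\<^sup>2 * real n powr nu n (n - 1) = Gamma a * 2 powr (- 1 + 2 * a) * (real n powr (- 1 + 3 * a) * real n powr (- a))"
      proof -
        have "3 / (2 * real n) = 3 * a" by (simp add: a_def)
        then show ?thesis unfolding nu SB_\<beta>_square[OF n] a(3) a_def[symmetric] by simp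
      qed
      also have "real n powr (- 1 + 3 * a) * real n powr (- a) = real n powr (- 1 + 2 * a)"
        by (simp add: powr_add[symmetric])
      also have "Gamma a * 2 powr (- 1 + 2 * a) * real n powr (- 1 + 2 * a) = Gamma a / (2 * real n) powr (1 - 2 * a)"
        using n by (simp add: powr_mult powr_diff powr_add powr_minus field_simps)
      finally show "(SB_\<beta> n)\<^sup>2 * real n powr nu n (n - 1) = Gamma (1 / (2 * real n)) / (2 * real n) powr (1 - 2 * a)"
        by (simp add: a_def)
      show "(2 * real n) powr (2 * real k + 1 - 1 / real n) = (2 * real n) powr (2 * real k + (1 - 2 * a))"
        unfolding a(3) by (simp add: algebra_simps)
      show "real k + 1 - 1 / (2 * real n) = nu n (n - 1) + 1 + real k" unfolding nu a_def by simp
    qed (rule SB_\<beta>_square[OF n])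
    show "\<delta> * ecoeff n n k = \<kappa>' k" for k unfolding \<kappa>'_def
    \<comment> \<open>Here \<delta>^2 = \<alpha>^2 / (2 n^2), and n^(1 - a) n^a = n leaves
      \<Gamma>(a) / (2n), hence c = 1.\<close>
    proof (rule ecoeff_eq[OF n, where c = 1])
      have "\<delta>\<^sup>2 * real n powr nu n n = (SB_\<alpha> n)\<^sup>2 / 2 / (real n)\<^sup>2 * real n powr a"
        unfolding nu \<delta>_def by (simp add: power_mult_distrib power_divide)
      also have "\<dots> = Gamma a / 2 * (real n powr (1 - a) * real n powr a) / (real n)\<^sup>2"
        unfolding SB_\<alpha>_square[OF n] by (simp add: a_def[symmetric])
      also have "real n powr (1 - a) * real n powr a = real n"
        using n by (simp add: powr_add[symmetric])
      also have "Gamma a / 2 * real n / (real n)\<^sup>2 = Gamma a / (2 * real n) powr 1"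
        using n by (simp add: power2_eq_square)
      finally show "\<delta>\<^sup>2 * real n powr nu n n = Gamma (1 / (2 * real n)) / (2 * real n) powr 1"
        by (simp add: a_def)
      show "(2 * real n) ^ (2 * k + 1) = (2 * real n) powr (2 * real k + 1)"
        using n powr_realpow[of "2 * real n" "2 * k + 1"] by (simp add: powr_add)
    qed (use n SB_\<alpha>_square[OF n] in \<open>auto simp: nu \<delta>_def a_def\<close>)
    show "\<kappa> k \<noteq> 0" for k using G(1)[THEN less_imp_neq] G(2)[of k] G(3)[of k] n by (simp add: \<kappa>_def a_def)
    show "\<kappa>' k \<noteq> 0" for k using G(1)[THEN less_imp_neq] G(2)[of k] G(3)[of k] n by (simp add: \<kappa>'_def a_def)
    show "r \<in> borel_measurable borel" unfolding r_def[abs_def] by measurable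
    show "r t \<ge> 0" for t
      unfolding r_def weight_const_def using G(1) by (intro mult_nonneg_nonneg bessel_K_nonneg) (auto simp: a_def)
    show \<rho>: "\<rho>\<^sub>2 n z = r (cmod z)" for z by (simp add: \<rho>\<^sub>2_def r_def)
    fix k
    show "(\<integral>\<^sup>+z. ennreal ((cmod z) ^ (2 * (2 * n * k + (n - 1))) * \<rho>\<^sub>2 n z) \<partial>lborel) = ennreal (1 / (\<kappa> k)\<^sup>2)"
      unfolding \<rho>\<^sub>2_def \<kappa>_def
    proof (rule bessel_weight_moment[OF n, where A = "real k + 1" and B = "real k + 1 - 1 / (2 * real n)"])
      have q: "real (2 * n * k + (n - 1)) / real n = 2 * real k + 1 - 1 / real n"
        using n by (simp add: of_nat_diff field_simps)
      have q': "2 * real k + 1 - 1 / real n = 2 * real k + 1 - 2 * a" using a by simp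
      show "\<bar>1 / (2 * real n)\<bar> < 1 + 1 / (2 * real n) + real (2 * n * k + (n - 1)) / real n"
        unfolding q q' a_def[symmetric] using a by simp
      show "(1 + 1 / (2 * real n) + real (2 * n * k + (n - 1)) / real n + 1 / (2 * real n)) / 2 = real k + 1"
           "(1 + 1 / (2 * real n) + real (2 * n * k + (n - 1)) / real n - 1 / (2 * real n)) / 2 = real k + 1 - 1 / (2 * real n)"
        unfolding q q' a_def[symmetric] by (simp_all add: field_simps)
      show "(2 * real n) powr (2 * real k + 1 - 1 / real n) = (2 * real n) powr (real (2 * n * k + (n - 1)) / real n)"
        unfolding q ..
    qed (use G(1) G(2)[of k] G(3)[of k] in \<open>auto simp: Gamma_fact a_def add.commute\<close>)
    show "(\<integral>\<^sup>+z. ennreal ((cmod z) ^ (2 * (2 * n * k + n)) * \<rho>\<^sub>2 n z) \<partial>lborel) = ennreal (1 / (\<kappa>' k)\<^sup>2)"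
      unfolding \<rho>\<^sub>2_def \<kappa>'_def
    proof (rule bessel_weight_moment[OF n, where A = "real k + 1 + 1 / (2 * real n)" and B = "real k + 1"])
      have q: "real (2 * n * k + n) / real n = 2 * real k + 1" using n by (simp add: field_simps)
      show "\<bar>1 / (2 * real n)\<bar> < 1 + 1 / (2 * real n) + real (2 * n * k + n) / real n"
        unfolding q a_def[symmetric] using a by simp
      show "(1 + 1 / (2 * real n) + real (2 * n * k + n) / real n + 1 / (2 * real n)) / 2 = real k + 1 + 1 / (2 * real n)"
           "(1 + 1 / (2 * real n) + real (2 * n * k + n) / real n - 1 / (2 * real n)) / 2 = real k + 1"
        unfolding q a_def[symmetric] by (simp_all add: field_simps)
      show "(2 * real n) ^ (2 * k + 1) = (2 * real n) powr (real (2 * n * k + n) / real n)"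
        unfolding q using n powr_realpow[of "2 * real n" "2 * k + 1"] by (simp add: powr_add)
    qed (use G(1) G(2)[of k] G(3)[of k] in \<open>auto simp: Gamma_fact a_def add.commute\<close>)
  qed
  then show ?thesis by (simp add: SB_transform\<^sub>2_def[abs_def] \<FF>\<^sub>2_def)
qed

theorem theorem4p2:
  fixes n :: nat
  assumes "n \<ge> 1"
  shows "unitary_from_L2R (SB_transform\<^sub>1 n) (\<FF>\<^sub>1 n) (weighted_inner (\<rho>\<^sub>1 n)) \<and>
         unitary_from_L2R (SB_transform\<^sub>2 n) (\<FF>\<^sub>2 n) (weighted_inner (\<rho>\<^sub>2 n)) \<and>
         (\<forall>f\<^sub>1\<in>L2R. \<forall>f\<^sub>2\<in>L2R.
            weighted_inner (\<rho>\<^sub>1 n) (SB_transform\<^sub>1 n f\<^sub>1) (SB_transform\<^sub>1 n f\<^sub>1) = L2R_inner f\<^sub>1 f\<^sub>1 \<and>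
            weighted_inner (\<rho>\<^sub>2 n) (SB_transform\<^sub>2 n f\<^sub>2) (SB_transform\<^sub>2 n f\<^sub>2) = L2R_inner f\<^sub>2 f\<^sub>2)"
  using unitary_SB_transform\<^sub>1[OF assms] unitary_SB_transform\<^sub>2[OF assms]
  unfolding unitary_from_L2R_def by blast

end
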